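(* If $\operatorname{conv}(G)$ has $t$ core facets, then a point can be separated from $\operatorname{conv}(G)$ in $O(nt+n\log n)$ time. That is, there is an algorithm which, given the list of the $t$ core facets of $\operatorname{conv}(G)$ (by their coefficients) and a point $(\bar x,\bar y)\in\mathbb{R}^n\times\mathbb{R}$, either correctly reports that $(\bar x,\bar y)\in\operatorname{conv}(G)$ or returns a linear inequality valid for $\operatorname{conv}(G)$ that is violated by $(\bar x,\bar y)$, using $O(nt+n\log n)$ arithmetic operations and comparisons.
   Context: Let $n\ge 2$, $N=\{1,\dots,n\}$, and let $\ell<u$ be real numbers. Let $X=\{x\in\mathbb{R}^n:\ell\le x_j\le u,\ j\in N\}$. For real coefficients $c_2,\dots,c_n$, not all zero, let $m(x)=\sum_{i=2}^n c_i\sum_{J\subseteq N,\ |J|=i}\prod_{j\in J}x_j$, and let $G=\{(x,y)\in\mathbb{R}^n\times\mathbb{R}: x\in X,\ y=m(x)\}$. The set $\operatorname{conv}(G)$ is a polytope of dimension $n+1$. A core inequality is a linear inequality $\beta_0+\sum_{j=1}^n\beta_jx_j+\beta' y\ge 0$ with $\beta'\in\{-1,1\}$ and $\beta_1\le\cdots\le\beta_n$. It is a core facet if it is valid for $\operatorname{conv}(G)$ (satisfied by all its points) and the set of points of $\operatorname{conv}(G)$ satisfying it with equality is a facet of $\operatorname{conv}(G)$. Facets with $\beta'=0$ are called trivial: for $n\ge3$ they are exactly the bounds $\ell\le x_j\le u$, $j\in N$, and for $n=2$ there are none. *)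

theory Defs
  imports "HOL-Analysis.Analysis" "HOL-Analysis.Finite_Function_Topology"
begin

section \<open>The polytope\<close>

text \<open>
  The algorithm is uniform in the dimension, so the dimension cannot be a type.  A vector of
  $R^n$ is a finitely supported function with support in \<open>{1..n}\<close>, and
  $R^n \times R$ is the subspace of the vectors \<open>(x, y)\<close> with \<open>x \<in> Rn n\<close> in the real
  normed vector space \<open>(nat \<Rightarrow>\<^sub>0 real) \<times> real\<close>; convexity, affine independence and faces
  are those of the library in that space.
\<close>

type_synonym rvec = "nat \<Rightarrow>\<^sub>0 real"

abbreviation coord :: "rvec \<Rightarrow> nat \<Rightarrow> real" where
  "coord \<equiv> Poly_Mapping.lookup"

definition Rn :: "nat \<Rightarrow> rvec set" where
  "Rn n = {x. Poly_Mapping.keys x \<subseteq> {1..n}}"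

definition box_X :: "nat \<Rightarrow> real \<Rightarrow> real \<Rightarrow> rvec set" where
  "box_X n l u = {x \<in> Rn n. \<forall>j\<in>{1..n}. l \<le> coord x j \<and> coord x j \<le> u}"

definition m_fun :: "nat \<Rightarrow> (nat \<Rightarrow> real) \<Rightarrow> rvec \<Rightarrow> real" where
  "m_fun n c x =
     (\<Sum>i=2..n. c i * (\<Sum>J | J \<subseteq> {1..n} \<and> card J = i. \<Prod>j\<in>J. coord x j))"

definition graph_G :: "nat \<Rightarrow> real \<Rightarrow> real \<Rightarrow> (nat \<Rightarrow> real) \<Rightarrow> (rvec \<times> real) set" where
  "graph_G n l u c = {(x, y). x \<in> box_X n l u \<and> y = m_fun n c x}"

definition conv_G :: "nat \<Rightarrow> real \<Rightarrow> real \<Rightarrow> (nat \<Rightarrow> real) \<Rightarrow> (rvec \<times> real) set" where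
  "conv_G n l u c = convex hull graph_G n l u c"

text \<open>
  The library's \<open>aff_dim\<close> and \<open>facet_of\<close> are restricted to Euclidean spaces.  These are the
  same definitions for arbitrary real vector spaces; \<open>finite B\<close> is then no longer automatic.
\<close>

definition affine_dim :: "'a::real_vector set \<Rightarrow> int" where
  "affine_dim V = (SOME d::int. \<exists>B. finite B \<and> affine hull B = affine hull V \<and>
     \<not> affine_dependent B \<and> of_nat (card B) = d + 1)"

definition is_facet_of :: "'a::real_vector set \<Rightarrow> 'a set \<Rightarrow> bool" where
  "is_facet_of F S \<longleftrightarrow> F face_of S \<and> F \<noteq> {} \<and> affine_dim F = affine_dim S - 1"

lemma affine_dim_eq_aff_dim:
  fixes V :: "'a::euclidean_space set"
  shows "affine_dim V = aff_dim V"
proof -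
  have "(\<exists>B. finite B \<and> affine hull B = affine hull V \<and> \<not> affine_dependent B \<and>
           of_nat (card B) = d + 1) \<longleftrightarrow>
        (\<exists>B. affine hull B = affine hull V \<and> \<not> affine_dependent B \<and>
           of_nat (card B) = d + 1)" for d :: int
    using aff_independent_finite by blast
  then show ?thesis
    unfolding affine_dim_def aff_dim_def by simp
qed

lemma is_facet_of_eq_facet_of:
  fixes F S :: "'a::euclidean_space set"
  shows "is_facet_of F S \<longleftrightarrow> F facet_of S"
  by (simp add: is_facet_of_def facet_of_def affine_dim_eq_aff_dim)

text \<open>The inequality with coefficients \<open>(b0, b, b')\<close> is \<open>0 \<le> ineq_lhs n b0 b b' (x, y)\<close>.\<close>

fun ineq_lhs :: "nat \<Rightarrow> real \<Rightarrow> (nat \<Rightarrow> real) \<Rightarrow> real \<Rightarrow> rvec \<times> real \<Rightarrow> real" where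
  "ineq_lhs n b0 b b' (x, y) = b0 + (\<Sum>j=1..n. b j * coord x j) + b' * y"

definition valid_ineq ::
  "nat \<Rightarrow> real \<Rightarrow> (nat \<Rightarrow> real) \<Rightarrow> real \<Rightarrow> (rvec \<times> real) set \<Rightarrow> bool" where
  "valid_ineq n b0 b b' P \<longleftrightarrow> (\<forall>p\<in>P. 0 \<le> ineq_lhs n b0 b b' p)"

definition core_ineq :: "nat \<Rightarrow> real \<times> rvec \<times> real \<Rightarrow> bool" where
  "core_ineq n = (\<lambda>(b0, b, b'). b \<in> Rn n \<and> b' \<in> {-1, 1} \<and> mono_on {1..n} (coord b))"

definition core_facets ::
  "nat \<Rightarrow> real \<Rightarrow> real \<Rightarrow> (nat \<Rightarrow> real) \<Rightarrow> (real \<times> rvec \<times> real) set" where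
  "core_facets n l u c = {(b0, b, b').
     core_ineq n (b0, b, b') \<and>
     valid_ineq n b0 (coord b) b' (conv_G n l u c) \<and>
     is_facet_of {p \<in> conv_G n l u c. ineq_lhs n b0 (coord b) b' p = 0} (conv_G n l u c)}"


section \<open>The model of computation\<close>

text \<open>
  A real RAM, presented as a structured imperative language.  The memory consists of named
  arrays of natural numbers (counters and addresses) and named arrays of reals; a program
  mentions finitely many names, and a scalar variable is an array used at index 0 only.
  Reals are subject to exact arithmetic and comparisons; there is no rounding, so information
  flows from reals to natural numbers only through tests.  Natural numbers can only be added,
  subtracted and compared, since unit-cost multiplication of addresses would make the model
  unreasonably strong.
\<close>

record ram_state =
  imem :: "string \<Rightarrow> nat \<Rightarrow> nat"
  rmem :: "string \<Rightarrow> nat \<Rightarrow> real"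

datatype iexp = INum nat | IRead string iexp | IAdd iexp iexp | ISub iexp iexp

datatype rexp = RNum int | RRead string iexp
  | RAdd rexp rexp | RSub rexp rexp | RMul rexp rexp | RDiv rexp rexp

datatype bexp = ILess iexp iexp | RLess rexp rexp | BNot bexp | BAnd bexp bexp

datatype com = Skip
  | IAssign string iexp iexp
  | RAssign string iexp rexp
  | Seq com com
  | Cond bexp com com
  | While bexp com

text \<open>Subtraction of natural numbers is truncated, and division by zero yields zero.\<close>

fun ival :: "ram_state \<Rightarrow> iexp \<Rightarrow> nat" where
  "ival s (INum k) = k"
| "ival s (IRead a e) = imem s a (ival s e)"
| "ival s (IAdd e f) = ival s e + ival s f"
| "ival s (ISub e f) = ival s e - ival s f"

fun rval :: "ram_state \<Rightarrow> rexp \<Rightarrow> real" where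
  "rval s (RNum k) = of_int k"
| "rval s (RRead a e) = rmem s a (ival s e)"
| "rval s (RAdd e f) = rval s e + rval s f"
| "rval s (RSub e f) = rval s e - rval s f"
| "rval s (RMul e f) = rval s e * rval s f"
| "rval s (RDiv e f) = rval s e / rval s f"

fun bval :: "ram_state \<Rightarrow> bexp \<Rightarrow> bool" where
  "bval s (ILess e f) \<longleftrightarrow> ival s e < ival s f"
| "bval s (RLess e f) \<longleftrightarrow> rval s e < rval s f"
| "bval s (BNot b) \<longleftrightarrow> \<not> bval s b"
| "bval s (BAnd b d) \<longleftrightarrow> bval s b \<and> bval s d"

text \<open>
  Evaluating an expression costs one unit per constant, memory access, arithmetic operation,
  comparison and Boolean connective.
\<close>

fun icost :: "iexp \<Rightarrow> nat" where
  "icost (INum k) = 1"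
| "icost (IRead a e) = 1 + icost e"
| "icost (IAdd e f) = 1 + icost e + icost f"
| "icost (ISub e f) = 1 + icost e + icost f"

fun rcost :: "rexp \<Rightarrow> nat" where
  "rcost (RNum k) = 1"
| "rcost (RRead a e) = 1 + icost e"
| "rcost (RAdd e f) = 1 + rcost e + rcost f"
| "rcost (RSub e f) = 1 + rcost e + rcost f"
| "rcost (RMul e f) = 1 + rcost e + rcost f"
| "rcost (RDiv e f) = 1 + rcost e + rcost f"

fun bcost :: "bexp \<Rightarrow> nat" where
  "bcost (ILess e f) = 1 + icost e + icost f"
| "bcost (RLess e f) = 1 + rcost e + rcost f"
| "bcost (BNot b) = 1 + bcost b"
| "bcost (BAnd b d) = 1 + bcost b + bcost d"

text \<open>\<open>exec p s k s'\<close>: started in \<open>s\<close>, the program \<open>p\<close> halts in \<open>s'\<close> after \<open>k\<close> time units.\<close>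

inductive exec :: "com \<Rightarrow> ram_state \<Rightarrow> nat \<Rightarrow> ram_state \<Rightarrow> bool" where
  exec_Skip: "exec Skip s 1 s"
| exec_IAssign: "exec (IAssign a e f) s (1 + icost e + icost f)
    (s\<lparr>imem := (imem s)(a := (imem s a)(ival s e := ival s f))\<rparr>)"
| exec_RAssign: "exec (RAssign a e f) s (1 + icost e + rcost f)
    (s\<lparr>rmem := (rmem s)(a := (rmem s a)(ival s e := rval s f))\<rparr>)"
| exec_Seq: "exec p s k s' \<Longrightarrow> exec q s' k' s'' \<Longrightarrow> exec (Seq p q) s (k + k') s''"
| exec_CondT: "bval s b \<Longrightarrow> exec p s k s' \<Longrightarrow> exec (Cond b p q) s (bcost b + k) s'"
| exec_CondF: "\<not> bval s b \<Longrightarrow> exec q s k s' \<Longrightarrow> exec (Cond b p q) s (bcost b + k) s'"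
| exec_WhileF: "\<not> bval s b \<Longrightarrow> exec (While b p) s (bcost b) s"
| exec_WhileT: "bval s b \<Longrightarrow> exec p s k s' \<Longrightarrow> exec (While b p) s' k' s'' \<Longrightarrow>
    exec (While b p) s (bcost b + k + k') s''"

inductive_cases exec_SkipE: "exec Skip s k s'"
inductive_cases exec_IAssignE: "exec (IAssign a e f) s k s'"
inductive_cases exec_RAssignE: "exec (RAssign a e f) s k s'"
inductive_cases exec_SeqE: "exec (Seq p q) s k s'"
inductive_cases exec_CondE: "exec (Cond b p q) s k s'"
inductive_cases exec_WhileE: "exec (While b p) s k s'"

lemma exec_deterministic:
  "exec p s k s' \<Longrightarrow> exec p s j t \<Longrightarrow> k = j \<and> s' = t"
proof (induction arbitrary: j t rule: exec.induct)
  case exec_Skip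
  then show ?case by (auto elim: exec_SkipE)
next
  case exec_IAssign
  then show ?case by (auto elim: exec_IAssignE)
next
  case exec_RAssign
  then show ?case by (auto elim: exec_RAssignE)
next
  case exec_Seq
  from exec_Seq.prems show ?case
    by (rule exec_SeqE) (use exec_Seq.IH in blast)
next
  case exec_CondT
  from exec_CondT.prems show ?case
    by (rule exec_CondE) (use exec_CondT.IH exec_CondT.hyps in blast)+
next
  case exec_CondF
  from exec_CondF.prems show ?case
    by (rule exec_CondE) (use exec_CondF.IH exec_CondF.hyps in blast)+
next
  case exec_WhileF
  from exec_WhileF.prems show ?case
    by (rule exec_WhileE) (use exec_WhileF.hyps in blast)+
next
  case exec_WhileT
  from exec_WhileT.prems show ?case
    by (rule exec_WhileE) (use exec_WhileT.IH exec_WhileT.hyps in blast)+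
qed


section \<open>The separation problem\<close>

text \<open>
  The input: the box \<open>[l, u]^n\<close>, the list \<open>Fs\<close> of inequalities (the coefficients of the
  variables stored row by row in one array) and the point \<open>(x, y)\<close>.  Memory cells that are not
  part of the input have arbitrary contents.
\<close>

definition separation_input ::
  "nat \<Rightarrow> real \<Rightarrow> real \<Rightarrow> (real \<times> rvec \<times> real) list \<Rightarrow> rvec \<Rightarrow> real \<Rightarrow> ram_state \<Rightarrow> bool" where
  "separation_input n l u Fs x y s \<longleftrightarrow>
     imem s ''n'' 0 = n \<and> imem s ''t'' 0 = length Fs \<and>
     rmem s ''l'' 0 = l \<and> rmem s ''u'' 0 = u \<and>
     (\<forall>j\<in>{1..n}. rmem s ''x'' j = coord x j) \<and> rmem s ''y'' 0 = y \<and>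
     (\<forall>k<length Fs. case Fs ! k of (b0, b, b') \<Rightarrow>
        rmem s ''beta0'' k = b0 \<and>
        (\<forall>j\<in>{1..n}. rmem s ''beta'' (k * n + j) = coord b j) \<and>
        rmem s ''betay'' k = b')"

text \<open>
  The output: answer 0 reports membership; answer 1 means that the arrays \<open>alpha0\<close>, \<open>alpha\<close>,
  \<open>alphay\<close> hold the coefficients of a separating inequality.
\<close>

definition separation_output ::
  "nat \<Rightarrow> (rvec \<times> real) set \<Rightarrow> rvec \<Rightarrow> real \<Rightarrow> ram_state \<Rightarrow> bool" where
  "separation_output n P x y s \<longleftrightarrow>
     (imem s ''answer'' 0 = 0 \<and> (x, y) \<in> P) \<or>
     (imem s ''answer'' 0 = 1 \<and>
      (let a0 = rmem s ''alpha0'' 0; a = rmem s ''alpha''; a' = rmem s ''alphay'' 0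
       in valid_ineq n a0 a a' P \<and> ineq_lhs n a0 a a' (x, y) < 0))"

end

theory Submission
  imports Defs "HOL-Combinatorics.Permutations"
begin

text \<open>
  The polytope is symmetric under permutations of the coordinates, and a valid inequality with
  \<open>\<beta>' = 0\<close> only restricts the coordinates \<open>x\<close>, so it is implied by the bounds.  Hence a point over
  the box lies in the hull iff all coordinate permutations of all core facets hold at it.  By the
  rearrangement inequality (\<open>rearrangement\<close>) the permutation that is worst for one core facet pairs
  its increasing coefficients with the coordinates of the point in decreasing order.  This
  permutation does not depend on the facet: one sort, in time \<open>O(n log n)\<close>, prepares the point for
  all \<open>t\<close> facets, and each facet then costs one scalar product.

  That the core facets suffice (\<open>violated_core_facet\<close>) is linear programming.  As \<open>m\<close> is affine in
  each coordinate, the hull is spanned by the graph over the \<open>2^n\<close> vertices of the box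
  (\<open>conv_G_eq_vertex_hull\<close>).  A point outside it violates some valid inequality with
  \<open>\<beta>' = \<plusminus>1\<close>.  As long as the vertices where this inequality is tight do not span \<open>R^n\<close> affinely,
  it can be tilted, still violated, until one more vertex becomes tight (\<open>tighter_inequality\<close>).
  When the tight vertices span \<open>R^n\<close>, the tight points of the hull span a hyperplane, and since
  \<open>m\<close> does not agree with an affine function on the vertices, they form a facet
  (\<open>rigid_imp_facet\<close>).  Sorting the coefficients turns it into a core facet, which is violated by
  a permutation of the point.

  The algorithm is written in the imperative language as a check of the bounds, a bottom-up merge
  sort of the indices, which needs no arithmetic on addresses beyond addition, and a loop over the
  facets.  Correctness and running time are proved together by the triples \<open>halts_in\<close>.
\<close>

section \<open>Vectors and affine functions\<close>

lemma coord_scaleR [simp]: "coord (a *\<^sub>R x) j = a * coord x j"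
proof -
  have "finite {i. a *\<^sub>R coord x i \<noteq> 0}"
    by (rule finite_subset[OF _ finite_lookup[of x]]) auto
  then show ?thesis
    by (simp add: scaleR_poly_mapping_def Abs_poly_mapping_inverse)
qed

lemmas coord_simps = lookup_add lookup_minus coord_scaleR

lemma Rn_iff: "x \<in> Rn n \<longleftrightarrow> (\<forall>j. j \<notin> {1..n} \<longrightarrow> coord x j = 0)"
  by (auto simp: Rn_def in_keys_iff subset_iff)

lemma Rn_add: "x \<in> Rn n \<Longrightarrow> y \<in> Rn n \<Longrightarrow> x + y \<in> Rn n"
  and Rn_scaleR: "x \<in> Rn n \<Longrightarrow> a *\<^sub>R x \<in> Rn n"
  by (auto simp: Rn_iff coord_simps)

lemma Rn_eqI: "x \<in> Rn n \<Longrightarrow> y \<in> Rn n \<Longrightarrow> (\<And>j. j \<in> {1..n} \<Longrightarrow> coord x j = coord y j) \<Longrightarrow> x = y"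
  by (metis Rn_iff poly_mapping_eqI)

definition vec :: "nat \<Rightarrow> (nat \<Rightarrow> real) \<Rightarrow> rvec" where
  "vec n f = Abs_poly_mapping (\<lambda>j. if j \<in> {1..n} then f j else 0)"

lemma coord_vec [simp]: "coord (vec n f) j = (if j \<in> {1..n} then f j else 0)"
proof -
  have "finite {j. (if j \<in> {1..n} then f j else 0) \<noteq> 0}"
    by (rule finite_subset[of _ "{1..n}"]) auto
  then show ?thesis by (simp add: vec_def Abs_poly_mapping_inverse)
qed

lemma vec_in_Rn [simp]: "vec n f \<in> Rn n"
  by (simp add: Rn_iff)

lemma bounded_linear_coord: "bounded_linear (\<lambda>x. coord x j)"
proof (rule bounded_linear_intro[where K=1])
  fix x :: rvec
  have "norm (coord x j) \<le> (\<Sum>i \<in> Poly_Mapping.keys x. norm (coord x i))"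
  proof (cases "j \<in> Poly_Mapping.keys x")
    case True
    then show ?thesis by (intro member_le_sum) auto
  next
    case False
    then show ?thesis by (simp add: in_keys_iff sum_nonneg)
  qed
  then show "norm (coord x j) \<le> norm x * 1"
    by (simp add: norm_poly_mapping_def dist_poly_mapping_def)
qed (auto simp: coord_simps)

definition aff :: "nat \<Rightarrow> real \<Rightarrow> (nat \<Rightarrow> real) \<Rightarrow> rvec \<Rightarrow> real" where
  "aff n d0 d x = d0 + (\<Sum>j=1..n. d j * coord x j)"

lemma ineq_lhs_aff: "ineq_lhs n b0 b b' (x, y) = aff n b0 b x + b' * y"
  by (simp add: aff_def)

lemma aff_combine: "aff n d0 d ((1 - a) *\<^sub>R x + a *\<^sub>R y) = (1 - a) * aff n d0 d x + a * aff n d0 d y"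
  by (simp add: aff_def coord_simps algebra_simps sum.distrib sum_distrib_left sum_subtractf)

lemma ineq_lhs_combine:
  assumes "a + b = 1"
  shows "ineq_lhs n b0 d b' (a *\<^sub>R p + b *\<^sub>R q) = a * ineq_lhs n b0 d b' p + b * ineq_lhs n b0 d b' q"
proof -
  obtain x y x' y' where p: "p = (x, y)" and q: "q = (x', y')" by fastforce
  have "aff n b0 d (a *\<^sub>R x + b *\<^sub>R x') = a * aff n b0 d x + b * aff n b0 d x'"
    using aff_combine[of n b0 d b x x'] assms by (simp add: eq_diff_eq[symmetric])
  then show ?thesis
    by (simp add: p q ineq_lhs_aff algebra_simps del: ineq_lhs.simps)
qed

section \<open>The polytope as the hull of its vertices\<close>

definition verts :: "nat \<Rightarrow> real \<Rightarrow> real \<Rightarrow> rvec set" where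
  "verts n l u = {v \<in> Rn n. \<forall>j\<in>{1..n}. coord v j \<in> {l, u}}"

lemma finite_verts: "finite (verts n l u)"
proof (rule finite_imageD)
  show "finite ((\<lambda>v. {j \<in> {1..n}. coord v j = u}) ` verts n l u)"
    by (rule finite_subset[of _ "Pow {1..n}"]) auto
  show "inj_on (\<lambda>v. {j \<in> {1..n}. coord v j = u}) (verts n l u)"
  proof (rule inj_onI)
    fix v w assume v: "v \<in> verts n l u" and w: "w \<in> verts n l u"
      and eq: "{j \<in> {1..n}. coord v j = u} = {j \<in> {1..n}. coord w j = u}"
    show "v = w"
    proof (rule Rn_eqI[of v n])
      fix j assume j: "j \<in> {1..n}"
      have "coord v j = u \<longleftrightarrow> coord w j = u" using eq j by blast
      moreover have "coord v j \<in> {l, u}" "coord w j \<in> {l, u}" using v w j unfolding verts_def by blast+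
      ultimately show "coord v j = coord w j" by auto
    qed (use v w in \<open>auto simp: verts_def\<close>)
  qed
qed

text \<open>
  A monomial of \<open>m\<close> contains each variable at most once.
\<close>

lemma m_fun_affine_in_coordinate:
  assumes eq: "\<And>k. k \<noteq> j \<Longrightarrow> coord x k = coord y k"
  shows "m_fun n c ((1 - a) *\<^sub>R x + a *\<^sub>R y) = (1 - a) * m_fun n c x + a * m_fun n c y"
proof -
  let ?z = "(1 - a) *\<^sub>R x + a *\<^sub>R y"
  have z: "coord ?z k = coord x k" "coord y k = coord x k" if "k \<noteq> j" for k
    using eq[OF that] by (simp_all add: coord_simps algebra_simps)
  have P: "(\<Prod>k\<in>J. coord ?z k) = (1 - a) * (\<Prod>k\<in>J. coord x k) + a * (\<Prod>k\<in>J. coord y k)"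
    if J: "J \<subseteq> {1..n}" for J
  proof -
    have fin: "finite J" using J finite_subset by blast
    show ?thesis
    proof (cases "j \<in> J")
      case True
      have "(\<Prod>k\<in>J - {j}. coord ?z k) = (\<Prod>k\<in>J - {j}. coord x k)"
        "(\<Prod>k\<in>J - {j}. coord y k) = (\<Prod>k\<in>J - {j}. coord x k)"
        using z by (auto intro!: prod.cong)
      then show ?thesis
        by (simp add: prod.remove[OF fin True] coord_simps algebra_simps)
    next
      case False
      have "(\<Prod>k\<in>J. coord ?z k) = (\<Prod>k\<in>J. coord x k)"
        "(\<Prod>k\<in>J. coord y k) = (\<Prod>k\<in>J. coord x k)"
        using z False by (metis prod.cong)+
      then show ?thesis by (simp add: algebra_simps)
    qed
  qed
  have "m_fun n c ?z = (\<Sum>i=2..n. c i * (\<Sum>J | J \<subseteq> {1..n} \<and> card J = i.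
      (1 - a) * (\<Prod>k\<in>J. coord x k) + a * (\<Prod>k\<in>J. coord y k)))"
    unfolding m_fun_def by (intro sum.cong refl arg_cong2[where f="(*)"]) (use P in auto)
  also have "\<dots> = (1 - a) * m_fun n c x + a * m_fun n c y"
    unfolding m_fun_def sum.distrib sum_distrib_left[symmetric]
    by (simp add: distrib_left sum.distrib sum_distrib_left mult.left_commute)
  finally show ?thesis .
qed

text \<open>
  Moving one coordinate at a time, every point of the graph is a combination of two points of the
  graph in which one more coordinate is \<open>l\<close> or \<open>u\<close>.  The set \<open>A\<close> of admissible weights covers two
  uses: with \<open>A = {0..1}\<close> the graph over the box lies in the convex hull of the vertices, and with
  \<open>A = UNIV\<close> the whole graph lies in their affine hull.
\<close>

lemma graph_point_from_vertices:
  assumes Q: "\<And>v. v \<in> verts n l u \<Longrightarrow> (v, m_fun n c v) \<in> Q"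
    and closed: "\<And>p q a. p \<in> Q \<Longrightarrow> q \<in> Q \<Longrightarrow> a \<in> A \<Longrightarrow> (1 - a) *\<^sub>R p + a *\<^sub>R q \<in> Q"
    and x: "x \<in> Rn n" "\<And>j. j \<in> {1..n} \<Longrightarrow> \<exists>a\<in>A. coord x j = (1 - a) * l + a * u"
  shows "(x, m_fun n c x) \<in> Q"
proof -
  have "(x, m_fun n c x) \<in> Q"
    if "k \<le> n" "x \<in> Rn n" "\<And>j. j \<in> {1..k} \<Longrightarrow> \<exists>a\<in>A. coord x j = (1 - a) * l + a * u"
      "\<And>j. j \<in> {k<..n} \<Longrightarrow> coord x j \<in> {l, u}" for k x
    using that
  proof (induction k arbitrary: x)
    case 0
    then show ?case by (intro Q) (auto simp: verts_def)
  next
    case (Suc k)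
    obtain a where a: "a \<in> A" "coord x (Suc k) = (1 - a) * l + a * u"
      using Suc.prems(3)[of "Suc k"] by auto
    \<comment> \<open>induction step: \<open>x\<close> lies on the line through the points with \<open>l\<close> and \<open>u\<close> in coordinate \<open>k + 1\<close>\<close>
    define X where "X t = Poly_Mapping.update (Suc k) t x" for t
    have X: "coord (X t) j = (if j = Suc k then t else coord x j)" for t j
      by (simp add: X_def lookup_update)
    have inQ: "(X t, m_fun n c (X t)) \<in> Q" if "t \<in> {l, u}" for t
    proof (rule Suc.IH)
      show "k \<le> n" using Suc.prems by simp
      show "X t \<in> Rn n" using Suc.prems by (auto simp: Rn_iff X)
      show "\<exists>a\<in>A. coord (X t) j = (1 - a) * l + a * u" if "j \<in> {1..k}" for j
        using Suc.prems(3)[of j] that by (auto simp: X)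
      show "coord (X t) j \<in> {l, u}" if "j \<in> {k<..n}" for j
        using Suc.prems(4)[of j] that \<open>t \<in> {l, u}\<close> by (auto simp: X)
    qed
    have xX: "x = (1 - a) *\<^sub>R X l + a *\<^sub>R X u"
      by (rule poly_mapping_eqI) (auto simp: coord_simps X a algebra_simps)
    have "m_fun n c x = (1 - a) * m_fun n c (X l) + a * m_fun n c (X u)"
      by (subst xX, rule m_fun_affine_in_coordinate[of "Suc k"]) (simp add: X)
    then have comb: "(x, m_fun n c x) = (1 - a) *\<^sub>R (X l, m_fun n c (X l)) + a *\<^sub>R (X u, m_fun n c (X u))"
      using xX by simp
    show ?case unfolding comb by (intro closed inQ a(1)) simp_all
  qed
  from this[of n x] x show ?thesis by auto
qed

definition vgraph :: "nat \<Rightarrow> real \<Rightarrow> real \<Rightarrow> (nat \<Rightarrow> real) \<Rightarrow> (rvec \<times> real) set" where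
  "vgraph n l u c = (\<lambda>v. (v, m_fun n c v)) ` verts n l u"

lemma finite_vgraph: "finite (vgraph n l u c)"
  by (simp add: vgraph_def finite_verts)

lemma conv_G_eq_vertex_hull:
  assumes "l < u"
  shows "conv_G n l u c = convex hull (vgraph n l u c)"
proof -
  have "vgraph n l u c \<subseteq> graph_G n l u c"
    using assms by (force simp: vgraph_def graph_G_def box_X_def verts_def)
  moreover have "graph_G n l u c \<subseteq> convex hull (vgraph n l u c)"
  proof (clarsimp simp: graph_G_def)
    fix x assume x: "x \<in> box_X n l u"
    show "(x, m_fun n c x) \<in> convex hull (vgraph n l u c)"
    proof (rule graph_point_from_vertices[where A="{0..1}"])
      show "(v, m_fun n c v) \<in> convex hull (vgraph n l u c)" if "v \<in> verts n l u" for v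
        using that by (auto simp: vgraph_def intro: hull_inc)
      show "(1 - a) *\<^sub>R p + a *\<^sub>R q \<in> convex hull (vgraph n l u c)"
        if "p \<in> convex hull (vgraph n l u c)" "q \<in> convex hull (vgraph n l u c)" "a \<in> {0..1}" for p q a
        using that by (intro convexD[OF convex_convex_hull]) auto
      show "x \<in> Rn n" using x by (simp add: box_X_def)
      fix j assume j: "j \<in> {1..n}"
      then have "l \<le> coord x j" "coord x j \<le> u" using x by (auto simp: box_X_def)
      moreover define a where "a = (coord x j - l) / (u - l)"
      ultimately have "a \<in> {0..1}" using assms by (simp add: divide_le_eq)
      moreover have "a * (u - l) = coord x j - l" using assms by (simp add: a_def)
      then have "coord x j = (1 - a) * l + a * u" by (simp add: algebra_simps)
      ultimately show "\<exists>a\<in>{0..1}. coord x j = (1 - a) * l + a * u" by blast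
    qed
  qed
  ultimately show ?thesis
    unfolding conv_G_def by (meson antisym convex_convex_hull hull_minimal hull_mono)
qed

lemma convex_ineq: "convex {p. 0 \<le> ineq_lhs n b0 b b' p}"
  by (rule convexI) (simp add: ineq_lhs_combine del: ineq_lhs.simps)

lemma valid_ineq_iff_vertices:
  assumes "l < u"
  shows "valid_ineq n b0 b b' (conv_G n l u c) \<longleftrightarrow>
    (\<forall>v\<in>verts n l u. 0 \<le> aff n b0 b v + b' * m_fun n c v)"
proof
  assume valid: "valid_ineq n b0 b b' (conv_G n l u c)"
  show "\<forall>v\<in>verts n l u. 0 \<le> aff n b0 b v + b' * m_fun n c v"
  proof
    fix v assume "v \<in> verts n l u"
    then have "(v, m_fun n c v) \<in> conv_G n l u c"
      by (auto simp: conv_G_eq_vertex_hull[OF assms] vgraph_def intro: hull_inc)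
    then show "0 \<le> aff n b0 b v + b' * m_fun n c v"
      using valid by (auto simp: valid_ineq_def ineq_lhs_aff simp del: ineq_lhs.simps)
  qed
next
  assume "\<forall>v\<in>verts n l u. 0 \<le> aff n b0 b v + b' * m_fun n c v"
  then have "vgraph n l u c \<subseteq> {p. 0 \<le> ineq_lhs n b0 b b' p}"
    by (auto simp: vgraph_def ineq_lhs_aff simp del: ineq_lhs.simps)
  then have "convex hull vgraph n l u c \<subseteq> {p. 0 \<le> ineq_lhs n b0 b b' p}"
    by (rule hull_minimal) (rule convex_ineq)
  then show "valid_ineq n b0 b b' (conv_G n l u c)"
    by (auto simp: valid_ineq_def conv_G_eq_vertex_hull[OF assms])
qed

lemma conv_G_fst_box:
  assumes "p \<in> conv_G n l u c"
  shows "fst p \<in> box_X n l u"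
proof -
  have "convex {p :: rvec \<times> real. fst p \<in> box_X n l u}"
  proof (rule convexI)
    fix p q :: "rvec \<times> real" and a b :: real
    assume p: "p \<in> {p. fst p \<in> box_X n l u}" "q \<in> {p. fst p \<in> box_X n l u}"
      and ab: "0 \<le> a" "0 \<le> b" "a + b = 1"
    have "a *\<^sub>R fst p + b *\<^sub>R fst q \<in> box_X n l u"
      unfolding box_X_def
    proof (intro CollectI conjI)
      show "a *\<^sub>R fst p + b *\<^sub>R fst q \<in> Rn n"
        using p by (auto simp: box_X_def intro: Rn_add Rn_scaleR)
      show "\<forall>j\<in>{1..n}. l \<le> coord (a *\<^sub>R fst p + b *\<^sub>R fst q) j \<and>
        coord (a *\<^sub>R fst p + b *\<^sub>R fst q) j \<le> u"
      proof
        fix j assume j: "j \<in> {1..n}"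
        then have "coord (fst p) j \<in> {l..u}" "coord (fst q) j \<in> {l..u}"
          using p by (auto simp: box_X_def)
        then have "a *\<^sub>R coord (fst p) j + b *\<^sub>R coord (fst q) j \<in> {l..u}"
          using ab convex_real_interval(5) by (intro convexD) auto
        then show "l \<le> coord (a *\<^sub>R fst p + b *\<^sub>R fst q) j \<and>
          coord (a *\<^sub>R fst p + b *\<^sub>R fst q) j \<le> u"
          by (auto simp: coord_simps)
      qed
    qed
    then show "a *\<^sub>R p + b *\<^sub>R q \<in> {p. fst p \<in> box_X n l u}" by simp
  qed
  moreover have "graph_G n l u c \<subseteq> {p. fst p \<in> box_X n l u}" by (auto simp: graph_G_def)
  ultimately have "conv_G n l u c \<subseteq> {p. fst p \<in> box_X n l u}"
    by (simp add: conv_G_def hull_minimal)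
  then show ?thesis using assms by auto
qed

lemma m_fun_indicator:
  assumes K: "K \<subseteq> {1..n}" and small: "\<And>i. i \<in> {2..n} \<Longrightarrow> i < card K \<Longrightarrow> c i = 0"
  shows "m_fun n c (vec n (\<lambda>j. if j \<in> K then 1 else 0)) = (if 2 \<le> card K then c (card K) else 0)"
proof -
  let ?x = "vec n (\<lambda>j. if j \<in> K then 1 else 0)"
  have finK: "finite K" using K finite_subset by blast
  have cK: "card K \<le> n" using card_mono[OF _ K] by simp
  have P: "(\<Prod>j\<in>J. coord ?x j) = (if J \<subseteq> K then 1 else 0)" if J: "J \<subseteq> {1..n}" for J
  proof (cases "J \<subseteq> K")
    case True
    then show ?thesis using J by (intro prod.neutral[THEN trans]) (auto dest: subsetD)
  next
    case False
    then obtain j where "j \<in> J" "j \<notin> K" by blast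
    moreover have "finite J" using J finite_subset by blast
    ultimately show ?thesis using False J
      by (auto intro!: prod_zero)
  qed
  have E: "(\<Sum>J | J \<subseteq> {1..n} \<and> card J = i. \<Prod>j\<in>J. coord ?x j) = (if i = card K then 1 else 0)"
    if "card K \<le> i" for i
  proof -
    have eq: "J = K" if "J \<subseteq> K" "card J = i" for J
      using that \<open>card K \<le> i\<close> finK by (simp add: card_seteq)
    have "(\<Sum>J | J \<subseteq> {1..n} \<and> card J = i. \<Prod>j\<in>J. coord ?x j) =
      (\<Sum>J | J \<subseteq> {1..n} \<and> card J = i. if J = K then 1 else 0)"
    proof (intro sum.cong refl)
      fix J assume "J \<in> {J. J \<subseteq> {1..n} \<and> card J = i}"
      then show "(\<Prod>j\<in>J. coord ?x j) = (if J = K then 1 else 0)"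
        using P[of J] eq[of J] by auto
    qed
    also have "\<dots> = (if i = card K then 1 else 0)"
      using K by (auto simp: sum.delta')
    finally show ?thesis .
  qed
  have "m_fun n c ?x = (\<Sum>i=2..n. if i = card K then c i else 0)"
    unfolding m_fun_def
  proof (intro sum.cong refl)
    fix i assume i: "i \<in> {2..n}"
    show "c i * (\<Sum>J | J \<subseteq> {1..n} \<and> card J = i. \<Prod>j\<in>J. coord ?x j) = (if i = card K then c i else 0)"
      using small[OF i] E[of i] by (cases "i < card K") auto
  qed
  then show ?thesis using cK by (auto simp: sum.delta)
qed

text \<open>
  The hull has full dimension.  If \<open>m\<close> were affine on the vertices, it would be affine on all of
  \<open>R^n\<close>.  At the indicator vectors of sets with fewer than \<open>i\<close> elements, where \<open>i \<ge> 2\<close> is the least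
  degree with \<open>c i \<noteq> 0\<close>, the function \<open>m\<close> vanishes; the empty set and the singletons show that the
  affine function is zero.  But at the indicator vector of \<open>{1..i}\<close> the value of \<open>m\<close> is \<open>c i\<close>.
\<close>

lemma m_fun_not_affine_on_vertices:
  assumes lu: "l < u" and c: "\<exists>i\<in>{2..n}. c i \<noteq> 0" and b': "b' \<noteq> 0"
  shows "\<exists>v\<in>verts n l u. aff n b0 b v + b' * m_fun n c v \<noteq> 0"
proof (rule ccontr)
  assume "\<not> ?thesis"
  then have van: "aff n b0 b v + b' * m_fun n c v = 0" if "v \<in> verts n l u" for v
    using that by blast
  have all: "aff n b0 b x + b' * m_fun n c x = 0" if x: "x \<in> Rn n" for x
  proof -
    have "(x, m_fun n c x) \<in> {p. ineq_lhs n b0 b b' p = 0}"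
    proof (rule graph_point_from_vertices[where A=UNIV and l=l and u=u])
      show "(v, m_fun n c v) \<in> {p. ineq_lhs n b0 b b' p = 0}" if "v \<in> verts n l u" for v
        using van[OF that] by (simp add: ineq_lhs_aff del: ineq_lhs.simps)
      show "(1 - a) *\<^sub>R p + a *\<^sub>R q \<in> {p. ineq_lhs n b0 b b' p = 0}"
        if "p \<in> {p. ineq_lhs n b0 b b' p = 0}" "q \<in> {p. ineq_lhs n b0 b b' p = 0}" for p q a
        using that by (simp add: ineq_lhs_combine del: ineq_lhs.simps)
      fix j
      define a where "a = (coord x j - l) / (u - l)"
      have "a * (u - l) = coord x j - l" using lu by (simp add: a_def)
      then have "coord x j = (1 - a) * l + a * u"
        by (simp add: algebra_simps)
      then show "\<exists>a\<in>UNIV. coord x j = (1 - a) * l + a * u" by blast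
    qed (rule x)
    then show ?thesis by (simp add: ineq_lhs_aff del: ineq_lhs.simps)
  qed
  obtain i where i: "i \<in> {2..n}" "c i \<noteq> 0" and "\<forall>k<i. \<not> (k \<in> {2..n} \<and> c k \<noteq> 0)"
    using exists_least_iff[of "\<lambda>i. i \<in> {2..n} \<and> c i \<noteq> 0"] c by blast
  then have small: "c k = 0" if "k \<in> {2..n}" "k < i" for k
    using that by blast
  have ind: "aff n b0 b (vec n (\<lambda>j. if j \<in> K then 1 else 0)) = b0 + (\<Sum>j\<in>K. b j)" if "K \<subseteq> {1..n}" for K
  proof -
    have "(\<Sum>j=1..n. b j * coord (vec n (\<lambda>j. if j \<in> K then 1 else 0)) j) = (\<Sum>j=1..n. if j \<in> K then b j else 0)"
      by (intro sum.cong) auto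
    also have "\<dots> = (\<Sum>j\<in>K. b j)"
      using that by (simp add: sum.inter_restrict[symmetric] Int_absorb1)
    finally show ?thesis by (simp add: aff_def)
  qed
  have m: "b0 + (\<Sum>j\<in>K. b j) + b' * (if 2 \<le> card K then c (card K) else 0) = 0"
    if "K \<subseteq> {1..n}" "card K \<le> i" for K
    using all[OF vec_in_Rn, of "\<lambda>j. if j \<in> K then 1 else 0"] ind[OF that(1)]
      m_fun_indicator[OF that(1), of c] small that(2) by auto
  have "b0 = 0" using m[of "{}"] by simp
  moreover have "b j = 0" if "j \<in> {1..n}" for j
    using m[of "{j}"] that i \<open>b0 = 0\<close> by simp
  ultimately have "b' * c i = 0" using m[of "{1..i}"] i by simp
  then show False using b' i by simp
qed

section \<open>Separating inequalities\<close>

text \<open>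
  The separating hyperplane is orthogonal to the segment from the point to its nearest point in the
  hull.  The norm of the ambient space does not come from an inner product; it serves for
  compactness only, and distances are measured by the Euclidean form \<open>ip\<close> on the coordinates in use.
\<close>

lemma separating_inequality:
  assumes lu: "l < u" and x: "x \<in> Rn n" and out: "(x, y) \<notin> conv_G n l u c"
  obtains b0 b b' where "valid_ineq n b0 b b' (conv_G n l u c)" "ineq_lhs n b0 b b' (x, y) < 0"
proof -
  let ?S = "conv_G n l u c"
  define ip where "ip p q = (\<Sum>j=1..n. coord (fst p) j * coord (fst q) j) + snd p * snd q"
    for p q :: "rvec \<times> real"
  have ip_add: "ip (p + q) r = ip p r + ip q r" "ip r (p + q) = ip r p + ip r q"
    and ip_diff: "ip (p - q) r = ip p r - ip q r" "ip r (p - q) = ip r p - ip r q"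
    and ip_scale: "ip (a *\<^sub>R p) r = a * ip p r" "ip r (a *\<^sub>R p) = a * ip r p" for p q r a
    by (simp_all add: ip_def coord_simps algebra_simps sum.distrib sum_subtractf sum_distrib_left)
  have ip_comm: "ip p q = ip q p" for p q by (simp add: ip_def mult.commute)
  have ip_nonneg: "0 \<le> ip p p" for p by (simp add: ip_def sum_nonneg)
  define z where "z = (x, y)"
  have cc: "continuous_on ?S (\<lambda>p. coord (f p) j)" if "continuous_on ?S f" for j and f :: "rvec \<times> real \<Rightarrow> rvec"
    using bounded_linear.continuous_on[OF bounded_linear_coord that] .
  have cont: "continuous_on ?S (\<lambda>p. ip (p - z) (p - z))"
    unfolding ip_def by (intro continuous_intros cc)
  have comp: "compact ?S"
    by (simp add: conv_G_eq_vertex_hull[OF lu] finite_imp_compact_convex_hull finite_vgraph)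
  have conv: "convex ?S" by (simp add: conv_G_def)
  have "vec n (\<lambda>_. l) \<in> verts n l u" by (auto simp: verts_def)
  then have "?S \<noteq> {}" by (auto simp: conv_G_eq_vertex_hull[OF lu] vgraph_def)
  then obtain q where q: "q \<in> ?S" and min: "\<And>p. p \<in> ?S \<Longrightarrow> ip (q - z) (q - z) \<le> ip (p - z) (p - z)"
    using continuous_attains_inf[OF comp _ cont] by blast
  have pos: "0 < ip (q - z) (q - z)"
  proof (rule ccontr)
    assume "\<not> ?thesis"
    then have "ip (q - z) (q - z) = 0" using ip_nonneg[of "q - z"] by simp
    then have "(\<Sum>j=1..n. (coord (fst (q - z)) j)\<^sup>2) + (snd (q - z))\<^sup>2 = 0"
      by (simp add: ip_def power2_eq_square)
    then have "(\<Sum>j=1..n. (coord (fst (q - z)) j)\<^sup>2) = 0" "snd (q - z) = 0"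
      by (simp_all add: add_nonneg_eq_0_iff sum_nonneg)
    then have "\<forall>j\<in>{1..n}. coord (fst q) j = coord x j" "snd q = y"
      by (simp_all add: sum_nonneg_eq_0_iff coord_simps z_def)
    moreover have "fst q \<in> Rn n" using conv_G_fst_box[OF q] by (simp add: box_X_def)
    ultimately have "q = (x, y)" using Rn_eqI[OF _ x] by (metis prod.collapse)
    then show False using q out by simp
  qed
  have obtuse: "0 \<le> ip (q - z) (r - q)" if r: "r \<in> ?S" for r
  proof (rule ccontr)
    define I where "I = ip (q - z) (r - q)"
    define R where "R = ip (r - q) (r - q)"
    assume "\<not> ?thesis"
    then have I: "I < 0" by (simp add: I_def)
    have R: "0 \<le> R" by (simp add: R_def ip_nonneg)
    \<comment> \<open>a step from \<open>q\<close> towards \<open>r\<close> so short that the linear decrease outweighs the quadratic term\<close>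
    define t where "t = min 1 (- I / (R + 1))"
    have t: "0 < t" "t \<le> 1" using I R by (auto simp: t_def field_simps)
    have "t * R \<le> (- I / (R + 1)) * R" using R by (intro mult_right_mono) (auto simp: t_def)
    also have "\<dots> \<le> - I" using I R by (simp add: field_simps)
    finally have tR: "t * R \<le> - I" .
    have "(1 - t) *\<^sub>R q + t *\<^sub>R r \<in> ?S" using t q r conv by (intro convexD) auto
    then have "ip (q - z) (q - z) \<le> ip ((1 - t) *\<^sub>R q + t *\<^sub>R r - z) ((1 - t) *\<^sub>R q + t *\<^sub>R r - z)"
      by (rule min)
    also have "(1 - t) *\<^sub>R q + t *\<^sub>R r - z = (q - z) + t *\<^sub>R (r - q)"
      by (simp add: algebra_simps)
    also have "ip \<dots> \<dots> = ip (q - z) (q - z) + (2 * t * I + t * (t * R))"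
      by (simp only: ip_add ip_scale I_def R_def ip_comm[of "r - q" "q - z"]) (simp add: algebra_simps)
    finally have "0 \<le> t * (2 * I + t * R)" by (simp add: algebra_simps)
    then have "0 \<le> 2 * I + t * R" using t by (simp add: zero_le_mult_iff)
    then show False using tR I by simp
  qed
  let ?a = "- ip (q - z) q" and ?b = "coord (fst (q - z))" and ?d = "snd (q - z)"
  have lhs: "ineq_lhs n ?a ?b ?d p = ip (q - z) (p - q)" for p
    by (cases p) (simp only: ineq_lhs.simps ip_diff(2), simp add: ip_def)
  show ?thesis
  proof
    show "valid_ineq n ?a ?b ?d ?S" unfolding valid_ineq_def lhs using obtuse by blast
    have "ip (q - z) (z - q) = - ip (q - z) (q - z)" by (simp add: ip_diff)
    then show "ineq_lhs n ?a ?b ?d (x, y) < 0" unfolding lhs using pos by (simp add: z_def)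
  qed
qed

section \<open>Affine dimension and facets\<close>

lemma affine_independent_insert_gen:
  fixes B :: "'a::real_vector set"
  assumes B: "\<not> affine_dependent B" "B \<noteq> {}" and q: "q \<notin> affine hull B"
  shows "\<not> affine_dependent (insert q B)"
proof -
  obtain a where a: "a \<in> B" using B by blast
  have qB: "q \<notin> B" using q hull_inc by metis
  let ?W = "(\<lambda>x. - a + x) ` (B - {a})"
  have "independent ?W" using B affine_dependent_iff_dependent2[OF a] by blast
  moreover have "- a + q \<notin> span ?W"
  proof
    assume "- a + q \<in> span ?W"
    then have "a + (- a + q) \<in> (\<lambda>x. a + x) ` span ?W" by blast
    then show False using q affine_hull_span2[OF a] by simp
  qed
  ultimately have "independent (insert (- a + q) ?W)" by (simp add: independent_insertI)
  moreover have "insert (- a + q) ?W = (\<lambda>x. - a + x) ` (insert q B - {a})"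
    using a qB by auto
  ultimately show ?thesis
    using affine_dependent_iff_dependent2[of a "insert q B"] a by simp
qed

text \<open>
  The dimension is chosen by \<open>SOME\<close> from the sizes of affine bases; it is meaningful because
  all of these have the same size, as in any vector space.
\<close>

lemma affine_basis_card_unique:
  fixes B C :: "'a::real_vector set"
  assumes B: "finite B" "\<not> affine_dependent B" and C: "finite C" "\<not> affine_dependent C"
    and eq: "affine hull B = affine hull C"
  shows "card B = card C"
proof (cases "B = {}")
  case True
  then show ?thesis using eq by simp
next
  case False
  then have "C \<noteq> {}" using eq by auto
  with False obtain a b where a: "a \<in> B" and b: "b \<in> C" by blast
  let ?U = "(\<lambda>x. - a + x) ` (B - {a})" and ?W = "(\<lambda>x. - b + x) ` (C - {b})"
  have ind: "independent ?U" "independent ?W"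
    using B C affine_dependent_iff_dependent2[OF a] affine_dependent_iff_dependent2[OF b] by blast+
  have hull: "(\<lambda>x. a + x) ` span ?U = (\<lambda>x. b + x) ` span ?W"
    using eq affine_hull_span2[OF a] affine_hull_span2[OF b] by simp
  have sub: "span U \<subseteq> span W" if h: "(\<lambda>x. a + x) ` span U = (\<lambda>x. b + x) ` span W"
    for a b :: 'a and U W
  proof
    fix v assume "v \<in> span U"
    then have "a + v \<in> (\<lambda>x. b + x) ` span W" "a + 0 \<in> (\<lambda>x. b + x) ` span W"
      using h span_zero by (metis imageI)+
    then obtain w w' where "w \<in> span W" "w' \<in> span W" "a + v = b + w" "a + 0 = b + w'" by blast
    then have "v = w - w'" by (simp add: algebra_simps)
    then show "v \<in> span W" using \<open>w \<in> span W\<close> \<open>w' \<in> span W\<close> by (simp add: span_diff)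
  qed
  have "span ?U = span ?W" using sub[OF hull] sub[OF hull[symmetric]] by simp
  then have "card ?U = card ?W"
    using dim_span_eq_card_independent[OF ind(1)] dim_span_eq_card_independent[OF ind(2)] by simp
  then have "card (B - {a}) = card (C - {b})" by (simp add: card_image)
  then show ?thesis using a b B C by (metis card_Suc_Diff1)
qed

lemma affine_dim_eq:
  assumes "finite B" "\<not> affine_dependent B" "affine hull B = affine hull V"
  shows "affine_dim V = int (card B) - 1"
  unfolding affine_dim_def
proof (rule some_equality)
  show "\<exists>C. finite C \<and> affine hull C = affine hull V \<and> \<not> affine_dependent C \<and>
      of_nat (card C) = int (card B) - 1 + 1"
    using assms by auto
next
  fix d :: int assume "\<exists>C. finite C \<and> affine hull C = affine hull V \<and> \<not> affine_dependent C \<and>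
      of_nat (card C) = d + 1"
  then obtain C where "finite C" "affine hull C = affine hull V" "\<not> affine_dependent C"
    "int (card C) = d + 1" by blast
  then show "d = int (card B) - 1" using affine_basis_card_unique[of B C] assms by simp
qed

text \<open>
  A basis of the direction space of \<open>T\<close> together with the direction to \<open>z\<close> is independent, and a
  linear map can be prescribed on it.
\<close>

lemma affine_functional_off_hull:
  fixes z :: "'a::real_vector"
  assumes a: "a \<in> T" and z: "z \<notin> affine hull T"
  obtains f :: "'a \<Rightarrow> real" where "linear f" "\<And>q. q \<in> T \<Longrightarrow> f q = f a" "f z \<noteq> f a"
proof -
  let ?W = "(\<lambda>x. - a + x) ` (T - {a})"
  have z': "- a + z \<notin> span ?W"
  proof
    assume "- a + z \<in> span ?W"
    then have "a + (- a + z) \<in> (\<lambda>x. a + x) ` span ?W" by blast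
    then show False using z affine_hull_span2[OF a] by simp
  qed
  obtain B where B: "B \<subseteq> ?W" "independent B" "?W \<subseteq> span B"
    using basis_exists by metis
  then have "- a + z \<notin> span B" using z' span_mono by blast
  then have "independent (insert (- a + z) B)" using B(2) by (simp add: independent_insertI)
  then obtain f :: "'a \<Rightarrow> real" where f: "linear f"
    "\<forall>x\<in>insert (- a + z) B. f x = (if x = - a + z then 1 else 0)"
    using linear_independent_extend[of "insert (- a + z) B" "\<lambda>x. if x = - a + z then 1 else 0"] by blast
  have "- a + z \<notin> B" using \<open>- a + z \<notin> span B\<close> span_base by blast
  then have "f x = 0" if "x \<in> B" for x using f(2) that by auto
  then have 0: "f x = 0" if "x \<in> span B" for x
    using linear_eq_0_on_span[OF f(1)] that by blast
  show ?thesis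
  proof
    show "linear f" by (rule f)
    show "f q = f a" if "q \<in> T" for q
    proof (cases "q = a")
      case False
      then have "- a + q \<in> ?W" using that by blast
      then have "f (- a + q) = 0" using 0 B(3) by blast
      then show ?thesis using f(1) by (simp add: linear_diff)
    qed simp
    have "f (- a + z) = 1" using f(2) by simp
    then show "f z \<noteq> f a" using f(1) by (auto simp: linear_diff)
  qed
qed

definition tight :: "nat \<Rightarrow> real \<Rightarrow> real \<Rightarrow> (nat \<Rightarrow> real) \<Rightarrow> real \<Rightarrow> (nat \<Rightarrow> real) \<Rightarrow> real \<Rightarrow> rvec set" where
  "tight n l u c b0 b b' = {v \<in> verts n l u. aff n b0 b v + b' * m_fun n c v = 0}"

text \<open>
  Affine spanning of \<open>R^n\<close>, stated dually: an inequality whose tight vertices are not rigid can be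
  tilted along the nonzero affine function that vanishes there.
\<close>

definition rigid :: "nat \<Rightarrow> rvec set \<Rightarrow> bool" where
  "rigid n T \<longleftrightarrow> (\<forall>d0 d. (\<forall>v\<in>T. aff n d0 d v = 0) \<longrightarrow> d0 = 0 \<and> (\<forall>j\<in>{1..n}. d j = 0))"

lemma Rn_expand:
  assumes "x \<in> Rn n"
  shows "x = (\<Sum>j=1..n. coord x j *\<^sub>R vec n (\<lambda>i. if i = j then 1 else 0))"
proof (rule poly_mapping_eqI)
  fix k
  have "coord (\<Sum>j=1..n. coord x j *\<^sub>R vec n (\<lambda>i. if i = j then 1 else 0)) k
    = (\<Sum>j=1..n. coord x j * coord (vec n (\<lambda>i. if i = j then 1 else 0)) k)"
    by (simp add: lookup_sum del: coord_vec)
  also have "\<dots> = (\<Sum>j=1..n. if j = k then coord x j else 0)"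
    by (intro sum.cong) auto
  also have "\<dots> = coord x k" using assms by (auto simp: Rn_iff)
  finally show "coord x k = coord (\<Sum>j=1..n. coord x j *\<^sub>R vec n (\<lambda>i. if i = j then 1 else 0)) k" ..
qed

lemma linear_on_Rn:
  assumes f: "linear (f :: rvec \<Rightarrow> real)" and x: "x \<in> Rn n"
  shows "f x = (\<Sum>j=1..n. f (vec n (\<lambda>i. if i = j then 1 else 0)) * coord x j)"
  by (subst Rn_expand[OF x]) (simp add: linear_sum[OF f] linear_cmul[OF f] mult.commute)

text \<open>
  A point of the hyperplane outside the affine hull of the tight points would be detected by a
  linear functional that is constant on them.  On the hyperplane \<open>y\<close> is an affine function of \<open>x\<close>
  because \<open>b' \<noteq> 0\<close>, so the functional is an affine function of \<open>x\<close> alone, and rigidity makes it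
  vanish.
\<close>

lemma affine_hull_tight:
  assumes b': "b' \<in> {-1, 1}" and rigid: "rigid n (tight n l u c b0 b b')"
  shows "affine hull ((\<lambda>v. (v, m_fun n c v)) ` tight n l u c b0 b b')
    = {p. fst p \<in> Rn n \<and> ineq_lhs n b0 b b' p = 0}" (is "affine hull ?T = ?H")
proof
  have "affine ?H"
    unfolding affine_def
    by (auto simp: ineq_lhs_combine intro: Rn_add Rn_scaleR simp del: ineq_lhs.simps)
  moreover have "?T \<subseteq> ?H"
    by (auto simp: tight_def verts_def ineq_lhs_aff simp del: ineq_lhs.simps)
  ultimately show "affine hull ?T \<subseteq> ?H" by (simp add: hull_minimal)
  show "?H \<subseteq> affine hull ?T"
  proof (rule ccontr)
    assume "\<not> ?thesis"
    then obtain z where z: "z \<in> ?H" "z \<notin> affine hull ?T" by blast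
    have "tight n l u c b0 b b' \<noteq> {}"
      using rigid unfolding rigid_def by (metis empty_iff zero_neq_one)
    then obtain a where a: "a \<in> ?T" by blast
    obtain f :: "rvec \<times> real \<Rightarrow> real" where f: "linear f" "\<And>q. q \<in> ?T \<Longrightarrow> f q = f a" "f z \<noteq> f a"
      using affine_functional_off_hull[OF a z(2)] by blast
    have bb: "b' * b' = 1" using b' by auto
    define e where "e j = f (vec n (\<lambda>i. if i = j then 1 else 0), 0)" for j
    define d where "d j = e j - f (0, 1) * b' * b j" for j
    \<comment> \<open>the functional \<open>f - f a\<close> after eliminating \<open>y\<close> by the equation of the hyperplane\<close>
    define d0 where "d0 = - f a - f (0, 1) * b' * b0"
    have rep: "f p - f a = aff n d0 d (fst p)" if p: "p \<in> ?H" for p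
    proof -
      obtain x y where xy: "p = (x, y)" by fastforce
      have x: "x \<in> Rn n" and eq: "aff n b0 b x + b' * y = 0"
        using p by (auto simp: xy ineq_lhs_aff simp del: ineq_lhs.simps)
      have "b' * (aff n b0 b x + b' * y) = b' * aff n b0 b x + (b' * b') * y" by (simp add: algebra_simps)
      then have y: "y = - b' * aff n b0 b x" using eq bb by simp
      have "linear (\<lambda>x. f (x, 0))"
      proof (rule linearI)
        show "f (x + y, 0) = f (x, 0) + f (y, 0)" for x y
          using linear_add[OF f(1), of "(x, 0)" "(y, 0)"] by simp
        show "f (r *\<^sub>R x, 0) = r *\<^sub>R f (x, 0)" for r x
          using linear_cmul[OF f(1), of r "(x, 0)"] by simp
      qed
      from linear_on_Rn[OF this x] have "f (x, 0) = (\<Sum>j=1..n. e j * coord x j)" by (simp add: e_def)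
      moreover have "f (0, y) = y * f (0, 1)"
        using linear_cmul[OF f(1), of y "(0, 1)"] by simp
      moreover have "f p = f (x, 0) + f (0, y)"
        using linear_add[OF f(1), of "(x, 0)" "(0, y)"] by (simp add: xy)
      ultimately have "f p = (\<Sum>j=1..n. e j * coord x j) - b' * aff n b0 b x * f (0, 1)"
        using y by simp
      then show ?thesis
        by (simp add: xy aff_def d_def d0_def algebra_simps sum_subtractf sum_distrib_left)
    qed
    have "aff n d0 d v = 0" if "v \<in> tight n l u c b0 b b'" for v
      using rep[of "(v, m_fun n c v)"] f(2)[of "(v, m_fun n c v)"] that \<open>?T \<subseteq> ?H\<close> by auto
    then have "d0 = 0 \<and> (\<forall>j\<in>{1..n}. d j = 0)" using rigid unfolding rigid_def by blast
    then have "aff n d0 d (fst z) = 0" by (simp add: aff_def)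
    then show False using rep[OF z(1)] f(3) by simp
  qed
qed

lemma face_of_tight:
  assumes "valid_ineq n b0 b b' (conv_G n l u c)"
  shows "{p \<in> conv_G n l u c. ineq_lhs n b0 b b' p = 0} face_of conv_G n l u c" (is "?F face_of ?S")
  unfolding face_of_def
proof (intro conjI ballI impI)
  have conv: "convex ?S" by (simp add: conv_G_def)
  show "?F \<subseteq> ?S" by blast
  show "convex ?F"
  proof (rule convexI)
    fix p q :: "rvec \<times> real" and s t :: real
    assume "p \<in> ?F" "q \<in> ?F" "0 \<le> s" "0 \<le> t" "s + t = 1"
    then show "s *\<^sub>R p + t *\<^sub>R q \<in> ?F"
      using convexD[OF conv, of p q s t] by (simp add: ineq_lhs_combine del: ineq_lhs.simps)
  qed
  fix p q r assume pq: "p \<in> ?S" "q \<in> ?S" and r: "r \<in> ?F" "r \<in> open_segment p q"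
  obtain t where t: "0 < t" "t < 1" "r = (1 - t) *\<^sub>R p + t *\<^sub>R q"
    using r(2) by (auto simp: in_segment)
  have nn: "0 \<le> ineq_lhs n b0 b b' p" "0 \<le> ineq_lhs n b0 b b' q"
    using assms pq by (auto simp: valid_ineq_def simp del: ineq_lhs.simps)
  have "(1 - t) * ineq_lhs n b0 b b' p + t * ineq_lhs n b0 b b' q = 0"
    using r(1) t by (simp add: ineq_lhs_combine del: ineq_lhs.simps)
  then have "(1 - t) * ineq_lhs n b0 b b' p = 0" "t * ineq_lhs n b0 b b' q = 0"
    using nn t by (smt (verit) mult_nonneg_nonneg)+
  then show "p \<in> ?F" "q \<in> ?F" using t pq by (simp_all del: ineq_lhs.simps)
qed

text \<open>
  The tight points span a hyperplane, and adding one vertex \<open>q\<close> of the hull off this hyperplane to an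
  affine basis gives an affine basis of the hull: every point is its vertical projection \<open>pr\<close> to the
  hyperplane plus a multiple of \<open>q - pr q\<close>.  So the dimensions differ by one.
\<close>

lemma rigid_imp_facet:
  assumes lu: "l < u" and c: "\<exists>i\<in>{2..n}. c i \<noteq> 0" and b': "b' \<in> {-1, 1}"
    and valid: "valid_ineq n b0 b b' (conv_G n l u c)"
    and rigid: "rigid n (tight n l u c b0 b b')"
  shows "is_facet_of {p \<in> conv_G n l u c. ineq_lhs n b0 b b' p = 0} (conv_G n l u c)"
    (is "is_facet_of ?F ?S")
proof -
  let ?T = "(\<lambda>v. (v, m_fun n c v)) ` tight n l u c b0 b b'"
  let ?H = "{p. fst p \<in> Rn n \<and> ineq_lhs n b0 b b' p = 0}"
  note hullT = affine_hull_tight[OF b' rigid]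
  have vS: "(v, m_fun n c v) \<in> ?S" if "v \<in> verts n l u" for v
    using that by (auto simp: conv_G_eq_vertex_hull[OF lu] vgraph_def intro: hull_inc)
  have SRn: "fst p \<in> Rn n" if "p \<in> ?S" for p using conv_G_fst_box[OF that] by (simp add: box_X_def)
  have TF: "?T \<subseteq> ?F" using vS by (auto simp: tight_def ineq_lhs_aff simp del: ineq_lhs.simps)
  have FH: "?F \<subseteq> ?H" using SRn by blast
  have "affine ?H" using hullT affine_affine_hull by metis
  then have hullF: "affine hull ?F = ?H"
    using hull_minimal[OF FH, of affine] hull_mono[OF TF, of affine] hullT by blast
  have "tight n l u c b0 b b' \<noteq> {}"
    using rigid unfolding rigid_def by (metis empty_iff zero_neq_one)
  then have Tne: "?T \<noteq> {}" by blast
  then have Fne: "?F \<noteq> {}" using TF by blast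
  obtain B where B: "B \<subseteq> ?T" "\<not> affine_dependent B" "affine hull ?T = affine hull B"
    using affine_basis_exists by blast
  have finB: "finite B"
    by (rule finite_subset[OF B(1)]) (simp add: tight_def finite_verts)
  have Bne: "B \<noteq> {}" using B(3) Tne by (metis affine_hull_eq_empty)
  have dimF: "affine_dim ?F = int (card B) - 1"
    using affine_dim_eq[OF finB B(2)] B(3) hullT hullF by simp
  have b'0: "b' \<noteq> 0" using b' by auto
  obtain w where w: "w \<in> verts n l u" "aff n b0 b w + b' * m_fun n c w \<noteq> 0"
    using m_fun_not_affine_on_vertices[OF lu c b'0] by blast
  define q where "q = (w, m_fun n c w)"
  have q: "q \<in> ?S" "ineq_lhs n b0 b b' q \<noteq> 0"
    using w vS[OF w(1)] by (simp_all add: q_def ineq_lhs_aff del: ineq_lhs.simps)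
  then have qB: "q \<notin> affine hull B" using B(3) hullT by auto
  have "?S \<subseteq> affine hull (insert q B)"
  proof
    fix p assume p: "p \<in> ?S"
    define t where "t = ineq_lhs n b0 b b' p / ineq_lhs n b0 b b' q"
    have tb: "ineq_lhs n b0 b b' p = t * ineq_lhs n b0 b b' q" using q(2) by (simp add: t_def)
    have bb: "b' * b' = 1" using b' by auto
    define pr where "pr p = (fst p, snd p - b' * ineq_lhs n b0 b b' p)" for p
    have ilp: "ineq_lhs n b0 b b' (pr p) = 0" for p
    proof -
      have "ineq_lhs n b0 b b' (pr p) = ineq_lhs n b0 b b' p - (b' * b') * ineq_lhs n b0 b b' p"
        by (cases p) (simp only: pr_def ineq_lhs_aff fst_conv snd_conv, simp add: algebra_simps)
      then show ?thesis using bb by simp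
    qed
    have H: "pr p \<in> affine hull B" if "p \<in> ?S" for p
    proof -
      have "pr p \<in> ?H" using SRn[OF that] ilp by (simp add: pr_def)
      then show ?thesis using hullT B(3) by simp
    qed
    then have H': "pr p \<in> affine hull (insert q B)" if "p \<in> ?S" for p
      using that hull_mono[of B "insert q B" affine] by blast
    have "q \<in> affine hull (insert q B)" by (simp add: hull_inc)
    moreover have "p = t *\<^sub>R q + 1 *\<^sub>R pr p + (- t) *\<^sub>R pr q"
      using tb by (simp add: prod_eq_iff pr_def algebra_simps)
    moreover have "t + 1 + (- t) = 1" by simp
    ultimately show "p \<in> affine hull (insert q B)"
      using mem_affine_3[OF affine_affine_hull _ H'[OF p] H'[OF q(1)]] by metis
  qed
  moreover have "insert q B \<subseteq> ?S" using q(1) B(1) TF by blast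
  ultimately have "affine hull (insert q B) = affine hull ?S"
    by (metis affine_affine_hull antisym hull_minimal hull_mono)
  then have "affine_dim ?S = int (card (insert q B)) - 1"
    using affine_independent_insert_gen[OF B(2) Bne qB] finB by (intro affine_dim_eq) auto
  moreover have "q \<notin> B" using qB hull_inc by metis
  ultimately have "affine_dim ?S = int (card B)" using finB by simp
  then show ?thesis
    using face_of_tight[OF valid] Fne dimF by (simp add: is_facet_of_def)
qed

section \<open>Violated inequalities that define facets\<close>

lemma valid_ineq_scale:
  assumes "valid_ineq n b0 b b' P" "0 < s"
  shows "valid_ineq n (s * b0) (\<lambda>j. s * b j) (s * b') P"
    and "ineq_lhs n (s * b0) (\<lambda>j. s * b j) (s * b') p = s * ineq_lhs n b0 b b' p"
proof -
  have eq: "ineq_lhs n (s * b0) (\<lambda>j. s * b j) (s * b') p = s * ineq_lhs n b0 b b' p" for p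
    by (cases p) (simp add: algebra_simps sum_distrib_left)
  show "valid_ineq n (s * b0) (\<lambda>j. s * b j) (s * b') P"
    using assms unfolding valid_ineq_def eq by simp
  show "ineq_lhs n (s * b0) (\<lambda>j. s * b j) (s * b') p = s * ineq_lhs n b0 b b' p" by (rule eq)
qed

text \<open>
  This is the validity criterion for the hull with \<open>m = 0\<close> and an inequality that ignores \<open>y\<close>.
\<close>

lemma aff_nonneg_box:
  assumes lu: "l < u" and x: "x \<in> box_X n l u" and nn: "\<And>v. v \<in> verts n l u \<Longrightarrow> 0 \<le> aff n d0 d v"
  shows "0 \<le> aff n d0 d x"
proof -
  have "valid_ineq n d0 d 0 (conv_G n l u (\<lambda>_. 0))"
    using nn by (simp add: valid_ineq_iff_vertices[OF lu])
  moreover have "(x, m_fun n (\<lambda>_. 0) x) \<in> conv_G n l u (\<lambda>_. 0)"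
    unfolding conv_G_def by (rule hull_inc) (simp add: graph_G_def x)
  ultimately show ?thesis by (auto simp: valid_ineq_def ineq_lhs_aff simp del: ineq_lhs.simps)
qed

text \<open>
  An inequality with \<open>b' = 0\<close> cannot separate a point over the box, as it has the same value at the
  point \<open>(x, m x)\<close> of the hull.  Any other inequality can be scaled to \<open>b' = \<plusminus>1\<close>.
\<close>

lemma separating_inequality_normalised:
  assumes lu: "l < u" and x: "x \<in> box_X n l u" and out: "(x, y) \<notin> conv_G n l u c"
  obtains b0 b b' where "b' \<in> {-1, 1}" "valid_ineq n b0 b b' (conv_G n l u c)"
    "ineq_lhs n b0 b b' (x, y) < 0"
proof -
  have "x \<in> Rn n" using x by (simp add: box_X_def)
  from separating_inequality[OF lu this out] obtain b0 b b' where
    b: "valid_ineq n b0 b b' (conv_G n l u c)" "ineq_lhs n b0 b b' (x, y) < 0" .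
  have "b' \<noteq> 0"
  proof
    assume 0: "b' = 0"
    have "(x, m_fun n c x) \<in> conv_G n l u c"
      unfolding conv_G_def by (rule hull_inc) (simp add: graph_G_def x)
    then have "0 \<le> ineq_lhs n b0 b b' (x, m_fun n c x)" using b(1) unfolding valid_ineq_def by blast
    then show False using b(2) 0 by simp
  qed
  define s where "s = 1 / \<bar>b'\<bar>"
  have s: "0 < s" "s * b' \<in> {-1, 1}" using \<open>b' \<noteq> 0\<close> by (auto simp: s_def abs_if)
  show ?thesis
    using that[OF s(2) valid_ineq_scale(1)[OF b(1) s(1)]] valid_ineq_scale(2)[OF b(1) s(1)] b(2) s(1)
    by (simp add: mult_pos_neg del: ineq_lhs.simps)
qed

lemma nonzero_aff_on_vertices:
  assumes lu: "l < u" and nz: "\<not> (d0 = 0 \<and> (\<forall>j\<in>{1..n}. d j = 0))"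
  obtains v where "v \<in> verts n l u" "aff n d0 d v \<noteq> 0"
proof -
  have "\<exists>v\<in>verts n l u. aff n d0 d v \<noteq> 0"
  proof (rule ccontr)
    assume "\<not> ?thesis"
    then have 0: "aff n d0 d v = 0" if "v \<in> verts n l u" for v using that by blast
    \<comment> \<open>the corner with all coordinates \<open>l\<close> (index 0 is out of range) and its neighbours\<close>
    define w where "w k = vec n (\<lambda>j. if j = k then u else l)" for k
    have w: "aff n d0 d (w k) = d0 + (\<Sum>j=1..n. d j * l) + (if k \<in> {1..n} then d k * (u - l) else 0)" for k
    proof -
      have "(\<Sum>j=1..n. d j * coord (w k) j) = (\<Sum>j=1..n. d j * l + (if j = k then d k * (u - l) else 0))"
        by (intro sum.cong) (auto simp: w_def algebra_simps)
      then show ?thesis by (simp add: aff_def sum.distrib)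
    qed
    have wv: "w k \<in> verts n l u" for k by (auto simp: w_def verts_def)
    have l: "d0 + (\<Sum>j=1..n. d j * l) = 0" using w[of 0] 0[OF wv[of 0]] by simp
    have d: "d k = 0" if "k \<in> {1..n}" for k
      using w[of k] 0[OF wv[of k]] l that lu by simp
    then have "d0 = 0" using l by simp
    with d nz show False by blast
  qed
  then show ?thesis using that by blast
qed

text \<open>
  A step of the simplex method.  Let \<open>e\<close> be a nonzero affine function that vanishes on the tight
  vertices.  Adding a multiple of \<open>e\<close> keeps these tight.  Up to sign, \<open>e\<close> is nonpositive at \<open>x\<close>, so
  that the inequality remains violated, and negative at some vertex, so that this vertex stops the
  movement.  The first vertex to do so becomes tight.
\<close>

lemma tighter_inequality:
  assumes lu: "l < u" and x: "x \<in> box_X n l u"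
    and valid: "valid_ineq n b0 b b' (conv_G n l u c)" and viol: "ineq_lhs n b0 b b' (x, y) < 0"
    and loose: "\<not> rigid n (tight n l u c b0 b b')"
  obtains a0 a where "valid_ineq n a0 a b' (conv_G n l u c)" "ineq_lhs n a0 a b' (x, y) < 0"
    "tight n l u c b0 b b' \<subset> tight n l u c a0 a b'"
proof -
  obtain d0 d where van: "\<And>v. v \<in> tight n l u c b0 b b' \<Longrightarrow> aff n d0 d v = 0"
    and nz: "\<not> (d0 = 0 \<and> (\<forall>j\<in>{1..n}. d j = 0))"
    using loose unfolding rigid_def by blast
  have neg: "aff n (- d0) (\<lambda>j. - d j) v = - aff n d0 d v" for v by (simp add: aff_def sum_negf)
  have "\<exists>e0 e. (\<forall>v\<in>tight n l u c b0 b b'. aff n e0 e v = 0) \<and> aff n e0 e x \<le> 0 \<and>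
    (\<exists>v\<in>verts n l u. aff n e0 e v < 0)"
  proof -
    \<comment> \<open>the box is the hull of its vertices; if the function is zero at \<open>x\<close>, its sign is chosen by any vertex where it is not zero\<close>
    have "\<exists>v\<in>verts n l u. aff n e0 e v < 0" if "aff n e0 e x < 0" for e0 e
      using aff_nonneg_box[OF lu x, of e0 e] that by force
    moreover obtain v where "v \<in> verts n l u" "aff n d0 d v \<noteq> 0"
      using nonzero_aff_on_vertices[OF lu nz] .
    ultimately show ?thesis
      using van neg
      by (cases "aff n d0 d x < 0 \<or> (aff n d0 d x = 0 \<and> aff n d0 d v < 0)")
        (rule exI[of _ d0], rule exI[of _ d], force,
         rule exI[of _ "- d0"], rule exI[of _ "\<lambda>j. - d j"],
         smt (verit))
  qed
  then obtain e0 e where e: "\<And>v. v \<in> tight n l u c b0 b b' \<Longrightarrow> aff n e0 e v = 0" "aff n e0 e x \<le> 0"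
    and ex: "\<exists>v\<in>verts n l u. aff n e0 e v < 0" by blast
  define N where "N = {v \<in> verts n l u. aff n e0 e v < 0}"
  have N: "finite N" "N \<noteq> {}" using ex finite_verts by (auto simp: N_def)
  define slack where "slack v = aff n b0 b v + b' * m_fun n c v" for v
  have slack: "0 \<le> slack v" if "v \<in> verts n l u" for v
    using valid that by (simp add: slack_def valid_ineq_iff_vertices[OF lu])
  \<comment> \<open>ratio test: vertex \<open>v\<close> becomes tight at step length \<open>r v\<close>\<close>
  define r where "r v = slack v / (- aff n e0 e v)" for v
  obtain w where w: "w \<in> N" "\<And>v. v \<in> N \<Longrightarrow> r w \<le> r v"
    using N by (metis arg_min_least arg_min_if_finite(1))
  have r0: "0 \<le> r w" using w(1) slack by (auto simp: r_def N_def intro!: divide_nonneg_neg divide_nonneg_pos)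
  have comb: "aff n (b0 + r w * e0) (\<lambda>j. b j + r w * e j) v = aff n b0 b v + r w * aff n e0 e v" for v
    by (simp add: aff_def algebra_simps sum.distrib sum_distrib_left)
  show ?thesis
  proof
    show "valid_ineq n (b0 + r w * e0) (\<lambda>j. b j + r w * e j) b' (conv_G n l u c)"
      unfolding valid_ineq_iff_vertices[OF lu] comb
    proof
      fix v assume v: "v \<in> verts n l u"
      have "0 \<le> slack v + r w * aff n e0 e v"
      proof (cases "v \<in> N")
        case True
        then have "aff n e0 e v < 0" by (simp add: N_def)
        moreover have "r w \<le> slack v / (- aff n e0 e v)" using w(2)[OF True] by (simp add: r_def)
        ultimately have "r w * (- aff n e0 e v) \<le> slack v"
          by (subst (asm) pos_le_divide_eq) auto
        then show ?thesis by simp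
      next
        case False
        then have "0 \<le> aff n e0 e v" using v by (simp add: N_def)
        then show ?thesis using slack[OF v] r0 by simp
      qed
      then show "0 \<le> aff n b0 b v + r w * aff n e0 e v + b' * m_fun n c v" by (simp add: slack_def)
    qed
    have "r w * aff n e0 e x \<le> 0" using r0 e(2) by (simp add: mult_nonneg_nonpos)
    then show "ineq_lhs n (b0 + r w * e0) (\<lambda>j. b j + r w * e j) b' (x, y) < 0"
      using viol by (simp add: ineq_lhs_aff comb del: ineq_lhs.simps)
    have wneg: "aff n e0 e w < 0" using w(1) by (simp add: N_def)
    then have "slack w + r w * aff n e0 e w = 0" by (simp add: r_def)
    then have "w \<in> tight n l u c (b0 + r w * e0) (\<lambda>j. b j + r w * e j) b'"
      using w(1) by (simp add: tight_def comb N_def slack_def)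
    moreover have "w \<notin> tight n l u c b0 b b'" using e(1) wneg by force
    moreover have "tight n l u c b0 b b' \<subseteq> tight n l u c (b0 + r w * e0) (\<lambda>j. b j + r w * e j) b'"
      using e(1) by (auto simp: tight_def comb)
    ultimately show "tight n l u c b0 b b' \<subset> tight n l u c (b0 + r w * e0) (\<lambda>j. b j + r w * e j) b'"
      by blast
  qed
qed

text \<open>
  Tilting strictly enlarges the set of tight vertices, so it ends.
\<close>

lemma rigid_separating_inequality:
  assumes lu: "l < u" and x: "x \<in> box_X n l u" and out: "(x, y) \<notin> conv_G n l u c"
  obtains b0 b b' where "b' \<in> {-1, 1}" "valid_ineq n b0 b b' (conv_G n l u c)"
    "ineq_lhs n b0 b b' (x, y) < 0" "rigid n (tight n l u c b0 b b')"
proof -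
  obtain b0 b b' where b': "b' \<in> {-1, 1}" and
    b: "valid_ineq n b0 b b' (conv_G n l u c)" "ineq_lhs n b0 b b' (x, y) < 0"
    using separating_inequality_normalised[OF lu x out] .
  have "\<exists>a0 a. valid_ineq n a0 a b' (conv_G n l u c) \<and> ineq_lhs n a0 a b' (x, y) < 0 \<and>
      rigid n (tight n l u c a0 a b')"
    using b
  proof (induction "card (verts n l u) - card (tight n l u c b0 b b')" arbitrary: b0 b rule: less_induct)
    case less
    show ?case
    proof (cases "rigid n (tight n l u c b0 b b')")
      case True
      then show ?thesis using less.prems by blast
    next
      case False
      obtain a0 a where a: "valid_ineq n a0 a b' (conv_G n l u c)" "ineq_lhs n a0 a b' (x, y) < 0"
        "tight n l u c b0 b b' \<subset> tight n l u c a0 a b'"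
        using tighter_inequality[OF lu x less.prems False] .
      have sub: "tight n l u c a0 a b' \<subseteq> verts n l u" by (auto simp: tight_def)
      have "card (tight n l u c b0 b b') < card (tight n l u c a0 a b')"
        using a(3) finite_subset[OF sub finite_verts] by (simp add: psubset_card_mono)
      moreover have "card (tight n l u c a0 a b') \<le> card (verts n l u)"
        using card_mono[OF finite_verts sub] .
      ultimately show ?thesis by (intro less.hyps[OF _ a(1,2)]) linarith
    qed
  qed
  then show ?thesis using that[OF b'] by blast
qed

section \<open>Symmetry and the rearrangement inequality\<close>

definition perm_vec :: "nat \<Rightarrow> (nat \<Rightarrow> nat) \<Rightarrow> rvec \<Rightarrow> rvec" where
  "perm_vec n \<pi> x = vec n (\<lambda>j. coord x (\<pi> j))"

lemma m_fun_perm_vec: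
  assumes \<pi>: "\<pi> permutes {1..n}"
  shows "m_fun n c (perm_vec n \<pi> x) = m_fun n c x"
proof -
  have inj: "inj \<pi>" using permutes_inj[OF \<pi>] .
  have "(\<Sum>J | J \<subseteq> {1..n} \<and> card J = i. \<Prod>j\<in>J. coord (perm_vec n \<pi> x) j) =
    (\<Sum>J | J \<subseteq> {1..n} \<and> card J = i. \<Prod>j\<in>J. coord x j)" for i
  proof (rule sum.reindex_bij_witness[where i="\<lambda>J. inv \<pi> ` J" and j="\<lambda>J. \<pi> ` J"])
    fix J assume J: "J \<in> {J. J \<subseteq> {1..n} \<and> card J = i}"
    show "inv \<pi> ` \<pi> ` J = J" using inj by (simp add: image_comp)
    have "\<pi> ` J \<subseteq> \<pi> ` {1..n}" using J by blast
    then show "\<pi> ` J \<in> {J. J \<subseteq> {1..n} \<and> card J = i}"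
      using J permutes_image[OF \<pi>] card_image[OF inj_on_subset[OF inj subset_UNIV]] by auto
    show "\<pi> ` inv \<pi> ` J = J" using permutes_surj[OF \<pi>] by (simp add: image_comp surj_iff)
    have "inv \<pi> ` J \<subseteq> inv \<pi> ` {1..n}" using J by blast
    then show "inv \<pi> ` J \<in> {J. J \<subseteq> {1..n} \<and> card J = i}"
      using J permutes_image[OF permutes_inv[OF \<pi>]]
        card_image[OF inj_on_subset[OF permutes_inj[OF permutes_inv[OF \<pi>]] subset_UNIV]] by auto
    show "(\<Prod>j\<in>\<pi> ` J. coord x j) = (\<Prod>j\<in>J. coord (perm_vec n \<pi> x) j)"
      using J by (subst prod.reindex[OF inj_on_subset[OF inj subset_UNIV]])
        (auto simp: perm_vec_def intro!: prod.cong)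
  qed
  then show ?thesis by (simp add: m_fun_def)
qed

lemma aff_perm_vec:
  assumes \<pi>: "\<pi> permutes {1..n}"
  shows "aff n b0 (b \<circ> \<pi>) (perm_vec n \<pi> x) = aff n b0 b x"
proof -
  have "(\<Sum>j=1..n. (b \<circ> \<pi>) j * coord (perm_vec n \<pi> x) j) = (\<Sum>j=1..n. ((\<lambda>j. b j * coord x j) \<circ> \<pi>) j)"
    by (intro sum.cong) (auto simp: perm_vec_def)
  also have "\<dots> = (\<Sum>j=1..n. b j * coord x j)"
    by (rule sum.permute[OF \<pi>, symmetric])
  finally show ?thesis by (simp add: aff_def)
qed

lemma perm_vec_verts:
  assumes \<pi>: "\<pi> permutes {1..n}" and v: "v \<in> verts n l u"
  shows "perm_vec n \<pi> v \<in> verts n l u"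
  unfolding verts_def
proof (intro CollectI conjI ballI)
  show "perm_vec n \<pi> v \<in> Rn n" by (simp add: perm_vec_def)
  fix j assume "j \<in> {1..n}"
  then have "\<pi> j \<in> {1..n}" using permutes_in_image[OF \<pi>] by blast
  then show "coord (perm_vec n \<pi> v) j \<in> {l, u}"
    using v \<open>j \<in> {1..n}\<close> unfolding verts_def perm_vec_def by simp
qed

lemma vertex_eq_perm_vec:
  assumes \<pi>: "\<pi> permutes {1..n}" and v: "v \<in> verts n l u"
  obtains w where "w \<in> verts n l u" "v = perm_vec n \<pi> w"
proof
  show "perm_vec n (inv \<pi>) v \<in> verts n l u" using perm_vec_verts[OF permutes_inv[OF \<pi>] v] .
  have "v \<in> Rn n" using v by (simp add: verts_def)
  then show "v = perm_vec n \<pi> (perm_vec n (inv \<pi>) v)"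
  proof (rule Rn_eqI)
    fix j assume j: "j \<in> {1..n}"
    then have "\<pi> j \<in> {1..n}" using permutes_in_image[OF \<pi>] by blast
    then show "coord v j = coord (perm_vec n \<pi> (perm_vec n (inv \<pi>) v)) j"
      using j permutes_inverses(2)[OF \<pi>] by (simp add: perm_vec_def)
  qed (simp add: perm_vec_def)
qed

lemma valid_ineq_permute:
  assumes lu: "l < u" and \<pi>: "\<pi> permutes {1..n}" and valid: "valid_ineq n b0 b b' (conv_G n l u c)"
  shows "valid_ineq n b0 (b \<circ> \<pi>) b' (conv_G n l u c)"
  unfolding valid_ineq_iff_vertices[OF lu]
proof
  fix v assume "v \<in> verts n l u"
  then obtain w where "w \<in> verts n l u" "v = perm_vec n \<pi> w" using vertex_eq_perm_vec[OF \<pi>] by blast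
  then show "0 \<le> aff n b0 (b \<circ> \<pi>) v + b' * m_fun n c v"
    using valid by (simp add: valid_ineq_iff_vertices[OF lu] aff_perm_vec[OF \<pi>] m_fun_perm_vec[OF \<pi>])
qed

text \<open>
  Permuting the coefficients permutes the tight vertices.
\<close>

lemma rigid_tight_permute:
  assumes \<pi>: "\<pi> permutes {1..n}" and rigid: "rigid n (tight n l u c b0 b b')"
  shows "rigid n (tight n l u c b0 (b \<circ> \<pi>) b')"
  unfolding rigid_def
proof (intro allI impI)
  fix d0 and d :: "nat \<Rightarrow> real"
  assume van: "\<forall>v\<in>tight n l u c b0 (b \<circ> \<pi>) b'. aff n d0 d v = 0"
  have "aff n d0 (d \<circ> inv \<pi>) w = 0" if w: "w \<in> tight n l u c b0 b b'" for w
  proof -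
    have "perm_vec n \<pi> w \<in> tight n l u c b0 (b \<circ> \<pi>) b'"
      using w perm_vec_verts[OF \<pi>] by (simp add: tight_def aff_perm_vec[OF \<pi>] m_fun_perm_vec[OF \<pi>])
    then have "aff n d0 d (perm_vec n \<pi> w) = 0" using van by blast
    moreover have "(d \<circ> inv \<pi>) \<circ> \<pi> = d" using permutes_inverses(2)[OF \<pi>] by auto
    ultimately show ?thesis using aff_perm_vec[OF \<pi>, of d0 "d \<circ> inv \<pi>" w] by simp
  qed
  then have "d0 = 0 \<and> (\<forall>j\<in>{1..n}. (d \<circ> inv \<pi>) j = 0)" using rigid unfolding rigid_def by blast
  moreover have "(d \<circ> inv \<pi>) (\<pi> j) = d j" for j using permutes_inverses(2)[OF \<pi>] by simp
  ultimately show "d0 = 0 \<and> (\<forall>j\<in>{1..n}. d j = 0)"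
    using permutes_in_image[OF \<pi>] by metis
qed

lemma sorting_permutation:
  fixes b :: "nat \<Rightarrow> real"
  obtains \<pi> where "\<pi> permutes {1..n}" "mono_on {1..n} (b \<circ> \<pi>)"
proof -
  define xs where "xs = sort_key b [1..<Suc n]"
  have len: "length xs = n" and set: "set xs = {1..n}" and dist: "distinct xs"
    and sorted: "sorted (map b xs)"
    by (auto simp: xs_def)
  define \<pi> where "\<pi> j = (if j \<in> {1..n} then xs ! (j - 1) else j)" for j
  have "bij_betw (\<lambda>j. j - 1) {1..n} {..<n}"
    by (rule bij_betw_byWitness[where f'=Suc]) auto
  then have "bij_betw (nth xs \<circ> (\<lambda>j. j - 1)) {1..n} {1..n}"
    by (rule bij_betw_trans) (rule bij_betw_nth[OF dist], auto simp: len set)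
  then have "bij_betw \<pi> {1..n} {1..n}"
    by (rule bij_betw_cong[THEN iffD1, rotated]) (auto simp: \<pi>_def)
  then have "\<pi> permutes {1..n}" by (rule bij_imp_permutes) (auto simp: \<pi>_def)
  moreover have "mono_on {1..n} (b \<circ> \<pi>)"
  proof (rule mono_onI)
    fix i j assume "i \<in> {1..n}" "j \<in> {1..n}" "i \<le> j"
    then show "(b \<circ> \<pi>) i \<le> (b \<circ> \<pi>) j"
      using sorted_nth_mono[OF sorted, of "i - 1" "j - 1"] len by (auto simp: \<pi>_def)
  qed
  ultimately show ?thesis using that by blast
qed

text \<open>
  The facet obtained from a separating inequality is moved to a core facet by sorting its
  coefficients; the permutation acts on the point in turn.
\<close>

theorem violated_core_facet:
  assumes lu: "l < u" and c: "\<exists>i\<in>{2..n}. c i \<noteq> 0"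
    and x: "x \<in> box_X n l u" and out: "(x, y) \<notin> conv_G n l u c"
  obtains b0 b b' \<pi> where "(b0, b, b') \<in> core_facets n l u c" "\<pi> permutes {1..n}"
    "b0 + (\<Sum>j=1..n. coord b j * coord x (\<pi> j)) + b' * y < 0"
proof -
  obtain b0 b b' where b': "b' \<in> {-1, 1}" and
    b: "valid_ineq n b0 b b' (conv_G n l u c)" "ineq_lhs n b0 b b' (x, y) < 0"
      "rigid n (tight n l u c b0 b b')"
    using rigid_separating_inequality[OF lu x out] .
  obtain \<pi> where \<pi>: "\<pi> permutes {1..n}" and mono: "mono_on {1..n} (b \<circ> \<pi>)"
    using sorting_permutation .
  define a where "a = vec n (b \<circ> \<pi>)"
  have a: "coord a j = (b \<circ> \<pi>) j" if "j \<in> {1..n}" for j using that by (simp add: a_def)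
  have aRn: "a \<in> Rn n" by (simp add: a_def)
  have affa: "aff n b0 (coord a) = aff n b0 (b \<circ> \<pi>)"
    by (rule ext) (use a in \<open>auto simp: aff_def intro!: sum.cong\<close>)
  have lhs: "ineq_lhs n b0 (coord a) b' = ineq_lhs n b0 (b \<circ> \<pi>) b'"
    by (rule ext) (auto simp: ineq_lhs_aff affa simp del: ineq_lhs.simps)
  have mono': "mono_on {1..n} (coord a)"
  proof (rule mono_onI)
    fix i j assume "i \<in> {1..n}" "j \<in> {1..n}" "i \<le> j"
    then show "coord a i \<le> coord a j" using mono_onD[OF mono] a by auto
  qed
  have valid: "valid_ineq n b0 (b \<circ> \<pi>) b' (conv_G n l u c)"
    using valid_ineq_permute[OF lu \<pi> b(1)] .
  have "is_facet_of {p \<in> conv_G n l u c. ineq_lhs n b0 (b \<circ> \<pi>) b' p = 0} (conv_G n l u c)"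
    using rigid_imp_facet[OF lu c b' valid rigid_tight_permute[OF \<pi> b(3)]] .
  then have "(b0, a, b') \<in> core_facets n l u c"
    using b' mono' valid by (auto simp: core_facets_def core_ineq_def lhs valid_ineq_def aRn)
  moreover have "(\<Sum>j=1..n. coord a j * coord x (\<pi> j)) = (\<Sum>j=1..n. (b \<circ> \<pi>) j * coord (perm_vec n \<pi> x) j)"
    by (intro sum.cong) (auto simp: a perm_vec_def)
  then have "b0 + (\<Sum>j=1..n. coord a j * coord x (\<pi> j)) + b' * y < 0"
    using b(2) aff_perm_vec[OF \<pi>, of b0 b x] by (simp add: aff_def)
  ultimately show ?thesis using that[OF _ \<pi>] by blast
qed

text \<open>
  Summation by parts: \<open>b\<close> is a constant plus nonnegative multiples of the indicator functions of
  the tails \<open>{i..n}\<close>.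
\<close>

lemma abel_nonneg:
  fixes b D :: "nat \<Rightarrow> real"
  assumes mono: "mono_on {1..n} b" and tail: "\<And>i. i \<in> {1..n} \<Longrightarrow> 0 \<le> (\<Sum>j=i..n. D j)"
    and total: "(\<Sum>j=1..n. D j) = 0"
  shows "0 \<le> (\<Sum>j=1..n. b j * D j)"
proof (cases "n = 0")
  case False
  have "b k * (\<Sum>j=k..n. D j) \<le> (\<Sum>j=k..n. b j * D j)" if "k \<le> n" "1 \<le> k" for k
    using that
  proof (induction k rule: inc_induct)
    case base
    then show ?case by simp
  next
    case (step k)
    have split: "(\<Sum>j=k..n. f j) = f k + (\<Sum>j=Suc k..n. f j)" for f :: "nat \<Rightarrow> real"
      using step by (simp add: sum.atLeast_Suc_atMost)
    have "b k \<le> b (Suc k)" using mono_onD[OF mono, of k "Suc k"] step by simp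
    then have "b k * (\<Sum>j=Suc k..n. D j) \<le> b (Suc k) * (\<Sum>j=Suc k..n. D j)"
      using tail[of "Suc k"] step by (intro mult_right_mono) auto
    also have "\<dots> \<le> (\<Sum>j=Suc k..n. b j * D j)" using step by simp
    finally show ?case using split[of D] split[of "\<lambda>j. b j * D j"] by (simp add: distrib_left)
  qed
  from this[of 1] show ?thesis using False total by simp
qed simp

text \<open>
  Among the subsets of \<open>{1..n}\<close> of the size of the tail \<open>{i..n}\<close>, this tail has the least sum of the decreasing
  sequence \<open>z\<close>.  So the tail sums of \<open>z \<circ> \<tau> - z\<close> are nonnegative, and summation by parts applies.
\<close>

theorem rearrangement:
  fixes b z :: "nat \<Rightarrow> real"
  assumes mono: "mono_on {1..n} b" and anti: "antimono_on {1..n} z" and \<tau>: "\<tau> permutes {1..n}"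
  shows "(\<Sum>j=1..n. b j * z j) \<le> (\<Sum>j=1..n. b j * z (\<tau> j))"
proof -
  have "0 \<le> (\<Sum>j=1..n. b j * (z (\<tau> j) - z j))"
  proof (rule abel_nonneg[OF mono])
    have "(\<Sum>j=1..n. z (\<tau> j)) = (\<Sum>j=1..n. z j)"
      using sum.permute[OF \<tau>, of z] by (simp add: o_def)
    then show "(\<Sum>j=1..n. z (\<tau> j) - z j) = 0" by (simp add: sum_subtractf)
  next
    fix i assume i: "i \<in> {1..n}"
    define L K where "L = {i..n}" and "K = \<tau> ` L"
    have fin: "finite L" "finite K" by (simp_all add: L_def K_def)
    have inj: "inj_on \<tau> L" using permutes_inj[OF \<tau>] by (rule inj_on_subset) simp
    have "L \<subseteq> {1..n}" using i by (auto simp: L_def)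
    then have K: "K \<subseteq> {1..n}" using permutes_image[OF \<tau>] by (auto simp: K_def)
    have "card K = card L" using card_image[OF inj] by (simp add: K_def)
    then have card: "card (K - L) = card (L - K)"
      using fin by (simp add: card_Diff_subset_Int Int_commute)
    have "sum z (L - K) \<le> of_nat (card (L - K)) * z i"
    proof (rule sum_bounded_above)
      fix j assume "j \<in> L - K"
      then show "z j \<le> z i" using monotone_onD[OF anti, of i j] i by (auto simp: L_def)
    qed
    also have "\<dots> = of_nat (card (K - L)) * z i" by (simp add: card)
    also have "\<dots> \<le> sum z (K - L)"
    proof (rule sum_bounded_below)
      fix j assume "j \<in> K - L"
      then show "z i \<le> z j" using monotone_onD[OF anti, of j i] i K by (auto simp: L_def)
    qed
    finally have "sum z (L - K) \<le> sum z (K - L)" .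
    moreover have "sum z L = sum z (L - K) + sum z (L \<inter> K)"
      using sum.Int_Diff[OF fin(1), of z K] by simp
    moreover have "sum z K = sum z (K - L) + sum z (L \<inter> K)"
      using sum.Int_Diff[OF fin(2), of z L] by (simp add: Int_commute)
    moreover have "sum z K = (\<Sum>j\<in>L. z (\<tau> j))" unfolding K_def by (simp add: sum.reindex[OF inj])
    ultimately show "0 \<le> (\<Sum>j=i..n. z (\<tau> j) - z j)" by (simp add: sum_subtractf L_def)
  qed
  then show ?thesis by (simp add: right_diff_distrib sum_subtractf)
qed

section \<open>Time-bounded execution\<close>

definition halts_in :: "com \<Rightarrow> ram_state \<Rightarrow> nat \<Rightarrow> (ram_state \<Rightarrow> bool) \<Rightarrow> bool" where
  "halts_in p s k Q \<longleftrightarrow> (\<exists>k' s'. exec p s k' s' \<and> k' \<le> k \<and> Q s')"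

lemma halts_in_mono:
  "halts_in p s k Q \<Longrightarrow> k \<le> k' \<Longrightarrow> (\<And>s'. Q s' \<Longrightarrow> R s') \<Longrightarrow> halts_in p s k' R"
  unfolding halts_in_def using le_trans by blast

lemma halts_in_Seq:
  assumes "halts_in p s k (\<lambda>s'. halts_in q s' k' Q)"
  shows "halts_in (Seq p q) s (k + k') Q"
  using assms unfolding halts_in_def by (meson add_le_mono exec_Seq)

lemma halts_in_Cond:
  assumes "bval s b \<Longrightarrow> halts_in p s k Q" "\<not> bval s b \<Longrightarrow> halts_in q s k Q"
  shows "halts_in (Cond b p q) s (bcost b + k) Q"
  using assms unfolding halts_in_def by (cases "bval s b") (meson add_left_mono exec_CondT exec_CondF)+

text \<open>
  The potential \<open>V\<close> is the time still available: each iteration pays for the test and the body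
  from it.  This covers loops whose iterations have different costs.
\<close>

lemma halts_in_While:
  assumes I: "I s"
    and body: "\<And>s. I s \<Longrightarrow> bval s b \<Longrightarrow>
      \<exists>k. halts_in p s k (\<lambda>s'. I s' \<and> bcost b + k + V s' \<le> V s)"
    and exit: "\<And>s. I s \<Longrightarrow> \<not> bval s b \<Longrightarrow> Q s"
  shows "halts_in (While b p) s (V s + bcost b) Q"
  using I
proof (induction "V s" arbitrary: s rule: less_induct)
  case less
  show ?case
  proof (cases "bval s b")
    case False
    then show ?thesis
      unfolding halts_in_def using exec_WhileF exit[OF less.prems] by (meson le_add2)
  next
    case True
    have pos: "0 < bcost b" by (cases b) auto
    obtain k k' s' where s': "exec p s k' s'" "k' \<le> k" "I s'" "bcost b + k + V s' \<le> V s"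
      using body[OF less.prems True] unfolding halts_in_def by blast
    then have "V s' < V s" using pos by linarith
    from less.hyps[OF this s'(3)] obtain k'' s'' where
      "exec (While b p) s' k'' s''" "k'' \<le> V s' + bcost b" "Q s''"
      unfolding halts_in_def by blast
    then show ?thesis
      unfolding halts_in_def using exec_WhileT[OF True s'(1)] s'(2,4)
      by (intro exI[of _ "bcost b + k' + k''"] exI[of _ s'']) auto
  qed
qed

text \<open>
  Programs without loops are evaluated symbolically: \<open>run\<close> computes the final state, and the time
  bound depends on the program text only.
\<close>

fun loop_free :: "com \<Rightarrow> bool" where
  "loop_free (Seq p q) \<longleftrightarrow> loop_free p \<and> loop_free q"
| "loop_free (Cond b p q) \<longleftrightarrow> loop_free p \<and> loop_free q"
| "loop_free (While b p) \<longleftrightarrow> False"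
| "loop_free _ \<longleftrightarrow> True"

fun run :: "com \<Rightarrow> ram_state \<Rightarrow> ram_state" where
  "run (IAssign a e f) s = s\<lparr>imem := (imem s)(a := (imem s a)(ival s e := ival s f))\<rparr>"
| "run (RAssign a e f) s = s\<lparr>rmem := (rmem s)(a := (rmem s a)(ival s e := rval s f))\<rparr>"
| "run (Seq p q) s = run q (run p s)"
| "run (Cond b p q) s = (if bval s b then run p s else run q s)"
| "run _ s = s"

fun time_bound :: "com \<Rightarrow> nat" where
  "time_bound (IAssign a e f) = 1 + icost e + icost f"
| "time_bound (RAssign a e f) = 1 + icost e + rcost f"
| "time_bound (Seq p q) = time_bound p + time_bound q"
| "time_bound (Cond b p q) = bcost b + time_bound p + time_bound q"
| "time_bound _ = 1"

lemma halts_in_loop_free: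
  assumes "loop_free p" "Q (run p s)"
  shows "halts_in p s (time_bound p) Q"
  using assms
proof (induction p arbitrary: s Q)
  case Skip
  then show ?case using exec_Skip by (auto simp: halts_in_def)
next
  case (IAssign a e f)
  then show ?case using exec_IAssign by (fastforce simp: halts_in_def)
next
  case (RAssign a e f)
  then show ?case using exec_RAssign by (fastforce simp: halts_in_def)
next
  case (Seq p q)
  then show ?case by (auto intro!: halts_in_Seq)
next
  case (Cond b p q)
  have "halts_in (Cond b p q) s (bcost b + (time_bound p + time_bound q)) Q"
  proof (rule halts_in_Cond)
    assume "bval s b"
    then have "halts_in p s (time_bound p) Q" using Cond by simp
    then show "halts_in p s (time_bound p + time_bound q) Q" by (rule halts_in_mono) auto
  next
    assume "\<not> bval s b"
    then have "halts_in q s (time_bound q) Q" using Cond by simp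
    then show "halts_in q s (time_bound p + time_bound q) Q" by (rule halts_in_mono) auto
  qed
  then show ?case by (simp add: add.assoc)
qed auto

lemma halts_in_loop_free_Seq:
  assumes "loop_free p" "halts_in q (run p s) k Q"
  shows "halts_in (Seq p q) s (time_bound p + k) Q"
  using assms by (intro halts_in_Seq halts_in_loop_free)

lemma halts_in_simple_While:
  assumes I: "I s" and lf: "loop_free p"
    and body: "\<And>s. I s \<Longrightarrow> bval s b \<Longrightarrow> I (run p s) \<and> V (run p s) < V s"
    and exit: "\<And>s. I s \<Longrightarrow> \<not> bval s b \<Longrightarrow> Q s"
  shows "halts_in (While b p) s ((bcost b + time_bound p) * V s + bcost b) Q"
proof (rule halts_in_While[where I=I, OF I _ exit])
  fix s assume s: "I s" "bval s b"
  have "Suc (V (run p s)) \<le> V s" using body[OF s] by simp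
  then have "(bcost b + time_bound p) * Suc (V (run p s)) \<le> (bcost b + time_bound p) * V s"
    by (rule mult_le_mono2)
  then have "halts_in p s (time_bound p) (\<lambda>s'. I s' \<and> bcost b + time_bound p +
      (bcost b + time_bound p) * V s' \<le> (bcost b + time_bound p) * V s)"
    using body[OF s] by (intro halts_in_loop_free[OF lf]) simp
  then show "\<exists>k. halts_in p s k (\<lambda>s'. I s' \<and> bcost b + k +
      (bcost b + time_bound p) * V s' \<le> (bcost b + time_bound p) * V s)"
    by blast
qed

section \<open>Merge sort\<close>

abbreviation Seq_syntax :: "com \<Rightarrow> com \<Rightarrow> com" (infixr \<open>;;\<close> 60) where
  "p ;; q \<equiv> Seq p q"
abbreviation ivar :: "string \<Rightarrow> iexp" where "ivar a \<equiv> IRead a (INum 0)"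
abbreviation rvar :: "string \<Rightarrow> rexp" where "rvar a \<equiv> RRead a (INum 0)"
abbreviation iset :: "string \<Rightarrow> iexp \<Rightarrow> com" where "iset a e \<equiv> IAssign a (INum 0) e"
abbreviation rset :: "string \<Rightarrow> rexp \<Rightarrow> com" where "rset a e \<equiv> RAssign a (INum 0) e"
abbreviation incr :: "string \<Rightarrow> com" where "incr a \<equiv> iset a (IAdd (ivar a) (INum 1))"

text \<open>
  The blocks \<open>a[lo..<mid]\<close> and \<open>a[mid..<hi]\<close> are merged into \<open>b[lo..<hi]\<close>; \<open>a\<close> contains indices of
  coordinates, which are compared by the values in the array \<open>x\<close>.
\<close>

definition merge_step :: com where
  "merge_step =
     Cond (BAnd (ILess (ivar ''i'') (ivar ''mid''))
                (BNot (BAnd (ILess (ivar ''j'') (ivar ''hi''))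
                            (RLess (RRead ''x'' (IRead ''a'' (ivar ''i'')))
                                   (RRead ''x'' (IRead ''a'' (ivar ''j'')))))))
       (IAssign ''b'' (ivar ''k'') (IRead ''a'' (ivar ''i'')) ;; incr ''i'')
       (IAssign ''b'' (ivar ''k'') (IRead ''a'' (ivar ''j'')) ;; incr ''j'') ;;
     incr ''k''"

abbreviation merge_guard :: bexp where
  "merge_guard \<equiv> ILess (ivar ''k'') (ivar ''hi'')"

definition descending :: "(nat \<Rightarrow> real) \<Rightarrow> (nat \<Rightarrow> nat) \<Rightarrow> nat \<Rightarrow> nat \<Rightarrow> bool" where
  "descending X a lo hi \<longleftrightarrow> (\<forall>p q. lo \<le> p \<longrightarrow> p \<le> q \<longrightarrow> q < hi \<longrightarrow> X (a q) \<le> X (a p))"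

text \<open>
  The invariant of merging.  That \<open>b\<close> contains the elements consumed so far is said by images only:
  the sort starts with the indices \<open>{1..n}\<close> in an array of length \<open>n\<close>, and as long as the image is
  \<open>{1..n}\<close>, nothing can be repeated.
\<close>

definition merged :: "(nat \<Rightarrow> real) \<Rightarrow> (nat \<Rightarrow> nat) \<Rightarrow> (nat \<Rightarrow> nat) \<Rightarrow> nat \<Rightarrow> nat \<Rightarrow> nat \<Rightarrow>
    nat \<Rightarrow> nat \<Rightarrow> nat \<Rightarrow> bool" where
  "merged X a b lo mid hi i j k \<longleftrightarrow>
     lo \<le> i \<and> i \<le> mid \<and> mid \<le> j \<and> j \<le> hi \<and> k + mid = i + j \<and>
     b ` {lo..<k} = a ` ({lo..<i} \<union> {mid..<j}) \<and> descending X b lo k \<and>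
     (\<forall>p\<in>{lo..<k}. \<forall>r\<in>{i..<mid} \<union> {j..<hi}. X (a r) \<le> X (b p))"

lemma merged_extend:
  assumes m: "merged X a b lo mid hi i j k"
    and r: "(r = i \<and> i < mid \<and> i' = Suc i \<and> j' = j) \<or> (r = j \<and> j < hi \<and> i' = i \<and> j' = Suc j)"
    and max: "\<And>q. q \<in> {i..<mid} \<union> {j..<hi} \<Longrightarrow> X (a q) \<le> X (a r)"
  shows "merged X a (b(k := a r)) lo mid hi i' j' (Suc k)"
proof -
  let ?b = "b(k := a r)"
  have k: "lo \<le> k" using m by (auto simp: merged_def)
  have rem: "r \<in> {i..<mid} \<union> {j..<hi}" using r by auto
  have old: "?b ` {lo..<k} = b ` {lo..<k}" by auto
  have "?b ` {lo..<Suc k} = insert (a r) (b ` {lo..<k})"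
    using k old by (simp only: atLeastLessThanSuc image_insert fun_upd_same if_True)
  also have "\<dots> = a ` ({lo..<i'} \<union> {mid..<j'})"
    using r m by (auto simp: merged_def atLeastLessThanSuc)
  finally have image: "?b ` {lo..<Suc k} = a ` ({lo..<i'} \<union> {mid..<j'})" .
  have bound: "X (a q) \<le> X (b p)" if "p \<in> {lo..<k}" "q \<in> {i..<mid} \<union> {j..<hi}" for p q
    using m that unfolding merged_def by blast
  have desc: "descending X ?b lo (Suc k)"
    unfolding descending_def
  proof (intro allI impI)
    fix p q assume pq: "lo \<le> p" "p \<le> q" "q < Suc k"
    show "X (?b q) \<le> X (?b p)"
    proof (cases "q = k")
      case True
      then show ?thesis using pq bound[OF _ rem, of p] by auto
    next
      case False
      then show ?thesis using pq m by (auto simp: merged_def descending_def)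
    qed
  qed
  have "X (a q) \<le> X (?b p)" if "p \<in> {lo..<Suc k}" "q \<in> {i'..<mid} \<union> {j'..<hi}" for p q
  proof -
    have q: "q \<in> {i..<mid} \<union> {j..<hi}" using that(2) r by auto
    show ?thesis using that(1) bound[OF _ q, of p] max[OF q] by (cases "p = k") auto
  qed
  then show ?thesis using m r image desc by (auto simp: merged_def)
qed

text \<open>
  The iterations are counted by \<open>k\<close>, since each one writes one entry of \<open>b\<close>.
\<close>

lemma merge_loop:
  assumes s: "imem s ''lo'' 0 = lo" "imem s ''mid'' 0 = mid" "imem s ''hi'' 0 = hi"
      "imem s ''i'' 0 = lo" "imem s ''j'' 0 = mid" "imem s ''k'' 0 = lo"
    and le: "lo \<le> mid" "mid \<le> hi"
    and desc: "descending (rmem s ''x'') (imem s ''a'') lo mid"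
      "descending (rmem s ''x'') (imem s ''a'') mid hi"
  shows "halts_in (While merge_guard merge_step) s
    ((bcost merge_guard + time_bound merge_step) * (hi - lo) + bcost merge_guard)
    (\<lambda>s'. rmem s' = rmem s \<and>
      (\<forall>v. v \<notin> {''i'', ''j'', ''k'', ''b''} \<longrightarrow> imem s' v = imem s v) \<and>
      (\<forall>p<lo. imem s' ''b'' p = imem s ''b'' p) \<and>
      imem s' ''b'' ` {lo..<hi} = imem s ''a'' ` {lo..<hi} \<and>
      descending (rmem s ''x'') (imem s' ''b'') lo hi)"
proof -
  let ?X = "rmem s ''x''" and ?a = "imem s ''a''"
  define I where "I s' \<longleftrightarrow> rmem s' = rmem s \<and>
      (\<forall>v. v \<notin> {''i'', ''j'', ''k'', ''b''} \<longrightarrow> imem s' v = imem s v) \<and>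
      (\<forall>p<lo. imem s' ''b'' p = imem s ''b'' p) \<and>
      merged ?X ?a (imem s' ''b'') lo mid hi (imem s' ''i'' 0) (imem s' ''j'' 0) (imem s' ''k'' 0)"
    for s' :: ram_state
  have "halts_in (While merge_guard merge_step) s
    ((bcost merge_guard + time_bound merge_step) * (hi - imem s ''k'' 0) + bcost merge_guard)
    (\<lambda>s'. I s' \<and> \<not> bval s' merge_guard)"
  proof (rule halts_in_simple_While[where I=I and V="\<lambda>s'. hi - imem s' ''k'' 0"])
    show "I s" using s le by (simp add: I_def merged_def descending_def)
    show "loop_free merge_step" by (simp add: merge_step_def)
    fix s' assume I: "I s'" and g: "bval s' merge_guard"
    define i j k where ijk: "i = imem s' ''i'' 0" "j = imem s' ''j'' 0" "k = imem s' ''k'' 0"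
    have fr: "imem s' ''mid'' 0 = mid" "imem s' ''hi'' 0 = hi" "imem s' ''a'' = ?a" "rmem s' = rmem s"
      using I s by (simp_all add: I_def)
    have m: "merged ?X ?a (imem s' ''b'') lo mid hi i j k" using I by (simp add: I_def ijk)
    have k: "k < hi" "lo \<le> k" using g fr m by (auto simp: ijk merged_def)
    have ij: "lo \<le> i" "i \<le> mid" "mid \<le> j" "j \<le> hi" "k + mid = i + j" using m by (auto simp: merged_def)
    define L where "L \<longleftrightarrow> i < mid \<and> \<not> (j < hi \<and> ?X (?a i) < ?X (?a j))"
    define r where "r = (if L then i else j)"
    have di: "?X (?a q) \<le> ?X (?a i)" if "q \<in> {i..<mid}" for q
      using that desc(1) ij by (auto simp: descending_def)
    have dj: "?X (?a q) \<le> ?X (?a j)" if "q \<in> {j..<hi}" for q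
      using that desc(2) ij by (auto simp: descending_def)
    have "merged ?X ?a ((imem s' ''b'')(k := ?a r)) lo mid hi
        (if L then Suc i else i) (if L then j else Suc j) (Suc k)"
    proof (rule merged_extend[OF m])
      show "(r = i \<and> i < mid \<and> (if L then Suc i else i) = Suc i \<and> (if L then j else Suc j) = j) \<or>
        (r = j \<and> j < hi \<and> (if L then Suc i else i) = i \<and> (if L then j else Suc j) = Suc j)"
        using k ij by (auto simp: r_def L_def)
      show "?X (?a q) \<le> ?X (?a r)" if "q \<in> {i..<mid} \<union> {j..<hi}" for q
        using that di[of q] dj[of q] di[of i] dj[of j] by (auto simp: r_def L_def)
    qed
    then have "I (run merge_step s')"
      using I k fr by (auto simp: I_def merge_step_def L_def r_def ijk[symmetric] fun_upd_def split: if_splits)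
    moreover have "imem (run merge_step s') ''k'' 0 = Suc k"
      by (simp add: merge_step_def ijk)
    ultimately show "I (run merge_step s') \<and> hi - imem (run merge_step s') ''k'' 0 < hi - imem s' ''k'' 0"
      using k by (simp add: ijk)
  qed simp
  then show ?thesis
    unfolding s(6)
  proof (rule halts_in_mono)
    fix s' assume "I s' \<and> \<not> bval s' merge_guard"
    then have I: "I s'" and g: "\<not> bval s' merge_guard" by auto
    define i j k where ijk: "i = imem s' ''i'' 0" "j = imem s' ''j'' 0" "k = imem s' ''k'' 0"
    have m: "merged ?X ?a (imem s' ''b'') lo mid hi i j k" using I by (simp add: I_def ijk)
    have "imem s' ''hi'' 0 = hi" using I s by (simp add: I_def)
    then have "hi \<le> k" using g by (simp add: ijk)
    then have e: "i = mid" "j = hi" "k = hi" using m by (auto simp: merged_def)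
    have "{lo..<mid} \<union> {mid..<hi} = {lo..<hi}" using le by auto
    then show "rmem s' = rmem s \<and>
      (\<forall>v. v \<notin> {''i'', ''j'', ''k'', ''b''} \<longrightarrow> imem s' v = imem s v) \<and>
      (\<forall>p<lo. imem s' ''b'' p = imem s ''b'' p) \<and>
      imem s' ''b'' ` {lo..<hi} = ?a ` {lo..<hi} \<and> descending ?X (imem s' ''b'') lo hi"
      using I m by (simp add: I_def e merged_def)
  qed simp
qed

text \<open>
  A constant overhead is absorbed into the coefficient of a size that is at least 1.  The next two
  lemmas are instances in the shape in which the costs of one merge and of one round arise.
\<close>

lemma linear_bound: "1 \<le> m \<Longrightarrow> c * m + d \<le> (c + d) * (m :: nat)"
  by (cases m) (auto simp: algebra_simps)

lemma merge_cost_absorbed: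
  "1 \<le> m \<Longrightarrow> g + (t + (c * m + d + e)) \<le> (c + (d + (g + t + e))) * (m :: nat)"
  using linear_bound[of m c "d + (g + t + e)"] by simp

lemma round_cost_absorbed:
  "1 \<le> m \<Longrightarrow> g + (t + (c * m + p + (i + (c' * m + h + e))))
    \<le> (c + c' + (g + t + p + i + h + e)) * (m :: nat)"
  using linear_bound[of m "c + c'" "g + t + p + i + h + e"] by (simp add: distrib_right)

definition block_sorted :: "(nat \<Rightarrow> real) \<Rightarrow> (nat \<Rightarrow> nat) \<Rightarrow> nat \<Rightarrow> nat \<Rightarrow> bool" where
  "block_sorted X a w m \<longleftrightarrow> (\<forall>q. descending X a (q * w) (min (q * w + w) m))"

lemma descending_cong:
  "(\<And>p. lo \<le> p \<Longrightarrow> p < hi \<Longrightarrow> a p = b p) \<Longrightarrow> descending X a lo hi = descending X b lo hi"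
  by (auto simp: descending_def)

lemma block_sorted_one: "block_sorted X a (Suc 0) m"
  unfolding block_sorted_def descending_def
proof (intro allI impI)
  fix q p p' assume "q * Suc 0 \<le> p" "p \<le> p'" "p' < min (q * Suc 0 + Suc 0) m"
  then have "p' = p" by simp
  then show "X (a p') \<le> X (a p)" by simp
qed

text \<open>
  Only the block with number \<open>q\<close> is affected when \<open>hi\<close> advances inside or to the end of that block.
\<close>

lemma block_sorted_extend:
  assumes bs: "block_sorted X b w (q * w)" and same: "\<And>p. p < q * w \<Longrightarrow> b' p = b p"
    and new: "descending X b' (q * w) hi" and hi: "q * w \<le> hi" "hi \<le> q * w + w"
  shows "block_sorted X b' w hi"
  unfolding block_sorted_def
proof
  fix q'
  consider "q' < q" | "q' = q" | "q < q'" by linarith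
  then show "descending X b' (q' * w) (min (q' * w + w) hi)"
  proof cases
    case 1
    then have "Suc q' * w \<le> q * w" by (intro mult_le_mono1) simp
    then have le: "q' * w + w \<le> q * w" by (simp add: add.commute)
    then have "descending X b (q' * w) (q' * w + w)"
      using bs[unfolded block_sorted_def, rule_format, of q'] by (simp add: min_def)
    moreover have "min (q' * w + w) hi = q' * w + w" using le hi by simp
    moreover have "descending X b' (q' * w) (q' * w + w) = descending X b (q' * w) (q' * w + w)"
      using le same by (intro descending_cong) auto
    ultimately show ?thesis by simp
  next
    case 2
    then show ?thesis using new hi by (simp add: min_def)
  next
    case 3
    then have "Suc q * w \<le> q' * w" by (intro mult_le_mono1) simp
    then have "hi \<le> q' * w" using hi by simp
    then show ?thesis by (auto simp: descending_def)
  qed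
qed

definition merge_setup :: com where
  "merge_setup =
     iset ''mid'' (IAdd (ivar ''lo'') (ivar ''w'')) ;;
     Cond (ILess (ivar ''n'') (ivar ''mid'')) (iset ''mid'' (ivar ''n'')) Skip ;;
     iset ''hi'' (IAdd (ivar ''mid'') (ivar ''w'')) ;;
     Cond (ILess (ivar ''n'') (ivar ''hi'')) (iset ''hi'' (ivar ''n'')) Skip ;;
     iset ''i'' (ivar ''lo'') ;; iset ''j'' (ivar ''mid'') ;; iset ''k'' (ivar ''lo'')"

definition merge_blocks :: com where
  "merge_blocks = merge_setup ;; While merge_guard merge_step ;; iset ''lo'' (ivar ''hi'')"

abbreviation pass_guard :: bexp where
  "pass_guard \<equiv> ILess (ivar ''lo'') (ivar ''n'')"

definition merge_const :: nat where
  "merge_const = bcost merge_guard + time_bound merge_step + (bcost merge_guard +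
     (bcost pass_guard + time_bound merge_setup + time_bound (iset ''lo'' (ivar ''hi''))))"

text \<open>
  The overhead of each merge is charged to its output, which has at least one entry; hence the time
  is linear in \<open>n\<close> although the number of merges depends on the width.
\<close>

lemma merge_pass:
  assumes s: "imem s ''n'' 0 = n" "imem s ''w'' 0 = w" "imem s ''lo'' 0 = 0" and w: "0 < w"
    and bs: "block_sorted (rmem s ''x'') (imem s ''a'') w n"
  shows "halts_in (While pass_guard merge_blocks) s (merge_const * n + bcost pass_guard)
    (\<lambda>s'. rmem s' = rmem s \<and>
      (\<forall>v. v \<notin> {''lo'', ''mid'', ''hi'', ''i'', ''j'', ''k'', ''b''} \<longrightarrow> imem s' v = imem s v) \<and>
      imem s' ''b'' ` {0..<n} = imem s ''a'' ` {0..<n} \<and>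
      block_sorted (rmem s ''x'') (imem s' ''b'') (w + w) n)"
proof -
  let ?X = "rmem s ''x''" and ?a = "imem s ''a''"
  define I where "I s' \<longleftrightarrow> rmem s' = rmem s \<and>
      (\<forall>v. v \<notin> {''lo'', ''mid'', ''hi'', ''i'', ''j'', ''k'', ''b''} \<longrightarrow> imem s' v = imem s v) \<and>
      imem s' ''lo'' 0 \<le> n \<and>
      (imem s' ''lo'' 0 = n \<or> (\<exists>q. imem s' ''lo'' 0 = q * (w + w))) \<and>
      imem s' ''b'' ` {0..<imem s' ''lo'' 0} = ?a ` {0..<imem s' ''lo'' 0} \<and>
      block_sorted ?X (imem s' ''b'') (w + w) (imem s' ''lo'' 0)" for s' :: ram_state
  let ?V = "\<lambda>s'. merge_const * (n - imem s' ''lo'' 0)"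
  have "halts_in (While pass_guard merge_blocks) s (?V s + bcost pass_guard)
      (\<lambda>s'. I s' \<and> \<not> bval s' pass_guard)"
  proof (rule halts_in_While[where I=I])
    show "I s" using s by (auto simp: I_def block_sorted_def descending_def intro: exI[of _ 0])
    fix s1 assume I: "I s1" and g: "bval s1 pass_guard"
    define lo where "lo = imem s1 ''lo'' 0"
    have fr: "imem s1 ''n'' 0 = n" "imem s1 ''w'' 0 = w" "imem s1 ''a'' = ?a" "rmem s1 = rmem s"
      using I s by (simp_all add: I_def)
    have lo: "lo < n" using g fr by (simp add: lo_def)
    then obtain q where q: "lo = q * (w + w)" using I by (auto simp: I_def lo_def)
    define mid where "mid = min (lo + w) n"
    define hi where "hi = min (lo + w + w) n"
    have le: "lo \<le> mid" "mid \<le> hi" "lo < hi" "hi \<le> n" using lo w by (auto simp: mid_def hi_def)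
    define s2 where "s2 = run merge_setup s1"
    have s2: "imem s2 ''lo'' 0 = lo" "imem s2 ''mid'' 0 = mid" "imem s2 ''hi'' 0 = hi"
      "imem s2 ''i'' 0 = lo" "imem s2 ''j'' 0 = mid" "imem s2 ''k'' 0 = lo"
      "rmem s2 = rmem s" "imem s2 ''b'' = imem s1 ''b''" "imem s2 ''a'' = ?a"
      using fr lo w by (auto simp: s2_def merge_setup_def lo_def mid_def hi_def)
    have s2f: "imem s2 v = imem s1 v" if "v \<notin> {''mid'', ''hi'', ''i'', ''j'', ''k''}" for v
      using that by (auto simp: s2_def merge_setup_def)
    \<comment> \<open>block \<open>q\<close> of width \<open>2w\<close> consists of the blocks \<open>2q\<close> and \<open>2q + 1\<close> of width \<open>w\<close>\<close>
    have lo1: "2 * q * w = lo" and lo2: "(2 * q + 1) * w = lo + w"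
      by (simp_all add: q distrib_left distrib_right mult_2)
    have d1: "descending ?X ?a lo mid"
      using bs[unfolded block_sorted_def, rule_format, of "2 * q"]
      by (simp only: lo1 mid_def)
    have d2: "descending ?X ?a mid hi"
      using bs[unfolded block_sorted_def, rule_format, of "2 * q + 1"]
      unfolding lo2 by (cases "lo + w \<le> n") (simp_all add: mid_def hi_def, simp add: descending_def)
    let ?k = "time_bound merge_setup + ((bcost merge_guard + time_bound merge_step) * (hi - lo) +
      bcost merge_guard + time_bound (iset ''lo'' (ivar ''hi'')))"
    have "halts_in merge_blocks s1 ?k (\<lambda>s'. I s' \<and> imem s' ''lo'' 0 = hi)"
      unfolding merge_blocks_def
    proof (rule halts_in_loop_free_Seq, simp add: merge_setup_def, fold s2_def,
        rule halts_in_Seq, rule halts_in_mono[OF merge_loop[where lo=lo and mid=mid and hi=hi]])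
      fix s3 :: ram_state
      assume s3: "rmem s3 = rmem s2 \<and>
        (\<forall>v. v \<notin> {''i'', ''j'', ''k'', ''b''} \<longrightarrow> imem s3 v = imem s2 v) \<and>
        (\<forall>p<lo. imem s3 ''b'' p = imem s2 ''b'' p) \<and>
        imem s3 ''b'' ` {lo..<hi} = imem s2 ''a'' ` {lo..<hi} \<and>
        descending (rmem s2 ''x'') (imem s3 ''b'') lo hi"
      have "block_sorted ?X (imem s3 ''b'') (w + w) hi"
      proof (rule block_sorted_extend[where q=q and b="imem s1 ''b''"])
        show "block_sorted ?X (imem s1 ''b'') (w + w) (q * (w + w))"
          using I by (simp add: I_def lo_def[symmetric] q[symmetric])
        show "imem s3 ''b'' p = imem s1 ''b'' p" if "p < q * (w + w)" for p
          using s3 s2 that by (simp add: q)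
        show "descending ?X (imem s3 ''b'') (q * (w + w)) hi"
          using s3 s2 by (simp add: q[symmetric])
        show "q * (w + w) \<le> hi" "hi \<le> q * (w + w) + (w + w)" using le by (auto simp: q[symmetric] hi_def)
      qed
      moreover have "imem s3 ''b'' ` {0..<hi} = ?a ` {0..<hi}"
      proof -
        have split: "{0..<hi} = {0..<lo} \<union> {lo..<hi}" using le by auto
        have "imem s3 ''b'' ` {0..<lo} = imem s1 ''b'' ` {0..<lo}" using s3 s2 by simp
        also have "\<dots> = ?a ` {0..<lo}" using I by (simp add: I_def lo_def)
        finally show ?thesis using s3 s2 by (simp add: split image_Un)
      qed
      moreover have "hi = n \<or> (\<exists>q. hi = q * (w + w))"
      proof (cases "hi = n")
        case False
        then have "hi = Suc q * (w + w)" by (auto simp: hi_def q)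
        then show ?thesis by blast
      qed simp
      moreover have "imem s3 ''hi'' 0 = hi" using s3 s2 by simp
      ultimately have "I (run (iset ''lo'' (ivar ''hi'')) s3) \<and>
          imem (run (iset ''lo'' (ivar ''hi'')) s3) ''lo'' 0 = hi"
        using I s3 s2 s2f le by (auto simp: I_def)
      then show "halts_in (iset ''lo'' (ivar ''hi'')) s3 (time_bound (iset ''lo'' (ivar ''hi'')))
          (\<lambda>s'. I s' \<and> imem s' ''lo'' 0 = hi)"
        by (rule halts_in_loop_free[rotated]) simp
    qed (use s2 le d1 d2 in simp_all)
    moreover have "bcost pass_guard + ?k + merge_const * (n - hi) \<le> merge_const * (n - lo)"
    proof -
      have "bcost pass_guard + ?k \<le> merge_const * (hi - lo)"
        unfolding merge_const_def by (rule merge_cost_absorbed) (use le in simp)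
      moreover have "merge_const * (n - lo) = merge_const * (hi - lo) + merge_const * (n - hi)"
        using le by (simp add: distrib_left[symmetric])
      ultimately show ?thesis by (simp only: add_le_mono1)
    qed
    ultimately show "\<exists>k. halts_in merge_blocks s1 k (\<lambda>s'. I s' \<and>
        bcost pass_guard + k + merge_const * (n - imem s' ''lo'' 0) \<le> merge_const * (n - imem s1 ''lo'' 0))"
      unfolding lo_def[symmetric] by (intro exI[of _ ?k]) (erule halts_in_mono, simp, metis)
  qed simp
  then show ?thesis
  proof (rule halts_in_mono)
    fix s' assume I: "I s' \<and> \<not> bval s' pass_guard"
    then have "imem s' ''n'' = imem s ''n''" "imem s' ''lo'' 0 \<le> n" by (simp_all add: I_def)
    then have "imem s' ''lo'' 0 = n" using I s by simp
    then show "rmem s' = rmem s \<and>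
      (\<forall>v. v \<notin> {''lo'', ''mid'', ''hi'', ''i'', ''j'', ''k'', ''b''} \<longrightarrow> imem s' v = imem s v) \<and>
      imem s' ''b'' ` {0..<n} = ?a ` {0..<n} \<and> block_sorted ?X (imem s' ''b'') (w + w) n"
      using I by (simp add: I_def)
  qed (simp add: s)
qed

definition copy_step :: com where
  "copy_step = IAssign ''a'' (ivar ''i'') (IRead ''b'' (ivar ''i'')) ;; incr ''i''"

abbreviation i_guard :: bexp where
  "i_guard \<equiv> ILess (ivar ''i'') (ivar ''n'')"

lemma copy_loop:
  assumes s: "imem s ''n'' 0 = n" "imem s ''i'' 0 = 0"
  shows "halts_in (While i_guard copy_step) s ((bcost i_guard + time_bound copy_step) * n + bcost i_guard)
    (\<lambda>s'. rmem s' = rmem s \<and> (\<forall>v. v \<notin> {''a'', ''i''} \<longrightarrow> imem s' v = imem s v) \<and>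
      (\<forall>p<n. imem s' ''a'' p = imem s ''b'' p))"
proof -
  define I where "I s' \<longleftrightarrow> rmem s' = rmem s \<and> (\<forall>v. v \<notin> {''a'', ''i''} \<longrightarrow> imem s' v = imem s v) \<and>
      (\<forall>p<imem s' ''i'' 0. imem s' ''a'' p = imem s ''b'' p)" for s' :: ram_state
  have "halts_in (While i_guard copy_step) s
    ((bcost i_guard + time_bound copy_step) * (n - imem s ''i'' 0) + bcost i_guard)
    (\<lambda>s'. I s' \<and> \<not> bval s' i_guard)"
  proof (rule halts_in_simple_While[where I=I and V="\<lambda>s'. n - imem s' ''i'' 0"])
    show "I s" using s by (simp add: I_def)
    show "loop_free copy_step" by (simp add: copy_step_def)
    fix s' assume I: "I s'" and g: "bval s' i_guard"
    have "imem s' ''n'' = imem s ''n''" "imem s' ''b'' = imem s ''b''" using I by (simp_all add: I_def)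
    then show "I (run copy_step s') \<and> n - imem (run copy_step s') ''i'' 0 < n - imem s' ''i'' 0"
      using I g s by (simp add: I_def copy_step_def less_Suc_eq)
  qed simp
  then show ?thesis
  proof (rule halts_in_mono)
    fix s' assume I: "I s' \<and> \<not> bval s' i_guard"
    then have "imem s' ''n'' = imem s ''n''" by (simp add: I_def)
    then have "n \<le> imem s' ''i'' 0" using I s by simp
    then show "rmem s' = rmem s \<and> (\<forall>v. v \<notin> {''a'', ''i''} \<longrightarrow> imem s' v = imem s v) \<and>
        (\<forall>p<n. imem s' ''a'' p = imem s ''b'' p)"
      using I by (simp add: I_def)
  qed (simp add: s)
qed

definition identity_step :: com where
  "identity_step = IAssign ''a'' (ivar ''i'') (IAdd (ivar ''i'') (INum 1)) ;; incr ''i''"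

lemma identity_loop:
  assumes s: "imem s ''n'' 0 = n" "imem s ''i'' 0 = 0"
  shows "halts_in (While i_guard identity_step) s
    ((bcost i_guard + time_bound identity_step) * n + bcost i_guard)
    (\<lambda>s'. rmem s' = rmem s \<and> (\<forall>v. v \<notin> {''a'', ''i''} \<longrightarrow> imem s' v = imem s v) \<and>
      (\<forall>p<n. imem s' ''a'' p = Suc p))"
proof -
  define I where "I s' \<longleftrightarrow> rmem s' = rmem s \<and> (\<forall>v. v \<notin> {''a'', ''i''} \<longrightarrow> imem s' v = imem s v) \<and>
      (\<forall>p<imem s' ''i'' 0. imem s' ''a'' p = Suc p)" for s' :: ram_state
  have "halts_in (While i_guard identity_step) s
    ((bcost i_guard + time_bound identity_step) * (n - imem s ''i'' 0) + bcost i_guard)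
    (\<lambda>s'. I s' \<and> \<not> bval s' i_guard)"
  proof (rule halts_in_simple_While[where I=I and V="\<lambda>s'. n - imem s' ''i'' 0"])
    show "I s" using s by (simp add: I_def)
    show "loop_free identity_step" by (simp add: identity_step_def)
    fix s' assume I: "I s'" and g: "bval s' i_guard"
    have "imem s' ''n'' = imem s ''n''" "imem s' ''b'' = imem s ''b''" using I by (simp_all add: I_def)
    then show "I (run identity_step s') \<and> n - imem (run identity_step s') ''i'' 0 < n - imem s' ''i'' 0"
      using I g s by (simp add: I_def identity_step_def less_Suc_eq)
  qed simp
  then show ?thesis
  proof (rule halts_in_mono)
    fix s' assume I: "I s' \<and> \<not> bval s' i_guard"
    then have "imem s' ''n'' = imem s ''n''" by (simp add: I_def)
    then have "n \<le> imem s' ''i'' 0" using I s by simp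
    then show "rmem s' = rmem s \<and> (\<forall>v. v \<notin> {''a'', ''i''} \<longrightarrow> imem s' v = imem s v) \<and>
        (\<forall>p<n. imem s' ''a'' p = Suc p)"
      using I by (simp add: I_def)
  qed (simp add: s)
qed

abbreviation sort_guard :: bexp where
  "sort_guard \<equiv> ILess (ivar ''w'') (ivar ''n'')"

definition sort_round :: com where
  "sort_round = iset ''lo'' (INum 0) ;; While pass_guard merge_blocks ;;
     iset ''i'' (INum 0) ;; While i_guard copy_step ;; iset ''w'' (IAdd (ivar ''w'') (ivar ''w''))"

definition round_const :: nat where
  "round_const = merge_const + (bcost i_guard + time_bound copy_step) +
     (bcost sort_guard + time_bound (iset ''lo'' (INum 0)) + bcost pass_guard +
      time_bound (iset ''i'' (INum 0)) + bcost i_guard +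
      time_bound (iset ''w'' (IAdd (ivar ''w'') (ivar ''w''))))"

text \<open>
  The number of doublings after which the block width \<open>w\<close> reaches \<open>n\<close>.
\<close>

definition rounds :: "nat \<Rightarrow> nat \<Rightarrow> nat" where
  "rounds n w = nat \<lceil>log 2 (real n / real w)\<rceil>"

lemma rounds_double:
  assumes "0 < w" "w < n"
  shows "rounds n w = Suc (rounds n (w + w))"
proof -
  have "real (w + w) = 2 * real w" by simp
  then have double: "real n / real w = 2 * (real n / real (w + w))" by (simp only:)
  have "0 < real n / real (w + w)" using assms by simp
  then have "log 2 (2 * (real n / real (w + w))) = log 2 2 + log 2 (real n / real (w + w))"
    by (intro log_mult_pos) simp_all
  then have eq: "log 2 (real n / real w) = 1 + log 2 (real n / real (w + w))"
    by (simp only: double) simp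
  have "0 < log 2 (real n / real w)" using assms by (intro zero_less_log_cancel_iff[THEN iffD2]) simp_all
  then have "0 < 1 + \<lceil>log 2 (real n / real (w + w))\<rceil>" unfolding eq by linarith
  moreover have "\<lceil>1 + z\<rceil> = 1 + \<lceil>z\<rceil>" for z :: real by linarith
  ultimately show ?thesis unfolding rounds_def eq by simp
qed

definition sort_prog :: com where
  "sort_prog = iset ''i'' (INum 0) ;; While i_guard identity_step ;; iset ''w'' (INum 1) ;;
     While sort_guard sort_round"

definition sort_time :: "nat \<Rightarrow> nat" where
  "sort_time n = time_bound (iset ''i'' (INum 0)) +
     ((bcost i_guard + time_bound identity_step) * n + bcost i_guard +
      (time_bound (iset ''w'' (INum 1)) + (round_const * n * rounds n 1 + bcost sort_guard)))"

lemma sort_round: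
  assumes s: "imem s ''n'' 0 = n" "imem s ''w'' 0 = w" and w: "0 < w" "w < n"
    and bs: "block_sorted (rmem s ''x'') (imem s ''a'') w n"
  shows "\<exists>k. bcost sort_guard + k \<le> round_const * n \<and> halts_in sort_round s k
    (\<lambda>s'. rmem s' = rmem s \<and>
      (\<forall>v. v \<notin> {''a'', ''b'', ''w'', ''lo'', ''mid'', ''hi'', ''i'', ''j'', ''k''} \<longrightarrow>
        imem s' v = imem s v) \<and>
      imem s' ''w'' 0 = w + w \<and> imem s' ''a'' ` {0..<n} = imem s ''a'' ` {0..<n} \<and>
      block_sorted (rmem s ''x'') (imem s' ''a'') (w + w) n)"
proof -
  define s1 where "s1 = run (iset ''lo'' (INum 0)) s"
  let ?k = "time_bound (iset ''lo'' (INum 0)) + (merge_const * n + bcost pass_guard +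
    (time_bound (iset ''i'' (INum 0)) + ((bcost i_guard + time_bound copy_step) * n + bcost i_guard +
     time_bound (iset ''w'' (IAdd (ivar ''w'') (ivar ''w''))))))"
  have s1: "imem s1 ''n'' 0 = n" "imem s1 ''w'' 0 = w" "imem s1 ''lo'' 0 = 0"
    "imem s1 ''a'' = imem s ''a''" "rmem s1 = rmem s"
    using s by (simp_all add: s1_def)
  have s1f: "imem s1 v = imem s v" if "v \<noteq> ''lo''" for v using that by (simp add: s1_def)
  have "halts_in sort_round s ?k (\<lambda>s'. rmem s' = rmem s \<and>
      (\<forall>v. v \<notin> {''a'', ''b'', ''w'', ''lo'', ''mid'', ''hi'', ''i'', ''j'', ''k''} \<longrightarrow>
        imem s' v = imem s v) \<and>
      imem s' ''w'' 0 = w + w \<and> imem s' ''a'' ` {0..<n} = imem s ''a'' ` {0..<n} \<and>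
      block_sorted (rmem s ''x'') (imem s' ''a'') (w + w) n)"
    unfolding sort_round_def
  proof (rule halts_in_loop_free_Seq, simp, fold s1_def, rule halts_in_Seq,
      rule halts_in_mono[OF merge_pass[OF s1(1-3) w(1)]])
    show "block_sorted (rmem s1 ''x'') (imem s1 ''a'') w n" using bs s1 by simp
  next
    fix s2 :: ram_state assume s2: "rmem s2 = rmem s1 \<and>
      (\<forall>v. v \<notin> {''lo'', ''mid'', ''hi'', ''i'', ''j'', ''k'', ''b''} \<longrightarrow> imem s2 v = imem s1 v) \<and>
      imem s2 ''b'' ` {0..<n} = imem s1 ''a'' ` {0..<n} \<and>
      block_sorted (rmem s1 ''x'') (imem s2 ''b'') (w + w) n"
    define s3 where "s3 = run (iset ''i'' (INum 0)) s2"
    have s3: "imem s3 ''n'' 0 = n" "imem s3 ''i'' 0 = 0" "imem s3 ''b'' = imem s2 ''b''"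
      "rmem s3 = rmem s" "imem s3 ''w'' 0 = w"
      using s2 s1 by (simp_all add: s3_def)
    have s3f: "imem s3 v = imem s2 v" if "v \<noteq> ''i''" for v using that by (simp add: s3_def)
    show "halts_in (iset ''i'' (INum 0) ;; While i_guard copy_step ;;
        iset ''w'' (IAdd (ivar ''w'') (ivar ''w''))) s2
      (time_bound (iset ''i'' (INum 0)) + ((bcost i_guard + time_bound copy_step) * n + bcost i_guard +
       time_bound (iset ''w'' (IAdd (ivar ''w'') (ivar ''w'')))))
      (\<lambda>s'. rmem s' = rmem s \<and>
      (\<forall>v. v \<notin> {''a'', ''b'', ''w'', ''lo'', ''mid'', ''hi'', ''i'', ''j'', ''k''} \<longrightarrow>
        imem s' v = imem s v) \<and>
      imem s' ''w'' 0 = w + w \<and> imem s' ''a'' ` {0..<n} = imem s ''a'' ` {0..<n} \<and>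
      block_sorted (rmem s ''x'') (imem s' ''a'') (w + w) n)"
    proof (rule halts_in_loop_free_Seq, simp, fold s3_def, rule halts_in_Seq,
        rule halts_in_mono[OF copy_loop[OF s3(1,2)]])
      fix s4 :: ram_state assume s4: "rmem s4 = rmem s3 \<and> (\<forall>v. v \<notin> {''a'', ''i''} \<longrightarrow> imem s4 v = imem s3 v) \<and>
        (\<forall>p<n. imem s4 ''a'' p = imem s3 ''b'' p)"
      have im: "imem s4 ''a'' ` {0..<n} = imem s ''a'' ` {0..<n}"
        using s4 s3 s2 s1 by (auto simp: image_def)
      have "block_sorted (rmem s ''x'') (imem s4 ''a'') (w + w) n"
        unfolding block_sorted_def
      proof
        fix q
        have "descending (rmem s ''x'') (imem s2 ''b'') (q * (w + w)) (min (q * (w + w) + (w + w)) n)"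
          using s2 s1 by (simp add: block_sorted_def)
        moreover have "descending (rmem s ''x'') (imem s4 ''a'') (q * (w + w)) (min (q * (w + w) + (w + w)) n)
          = descending (rmem s ''x'') (imem s2 ''b'') (q * (w + w)) (min (q * (w + w) + (w + w)) n)"
          using s4 s3 by (intro descending_cong) auto
        ultimately show "descending (rmem s ''x'') (imem s4 ''a'') (q * (w + w)) (min (q * (w + w) + (w + w)) n)"
          by simp
      qed
      then show "halts_in (iset ''w'' (IAdd (ivar ''w'') (ivar ''w''))) s4
          (time_bound (iset ''w'' (IAdd (ivar ''w'') (ivar ''w''))))
          (\<lambda>s'. rmem s' = rmem s \<and>
          (\<forall>v. v \<notin> {''a'', ''b'', ''w'', ''lo'', ''mid'', ''hi'', ''i'', ''j'', ''k''} \<longrightarrow>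
            imem s' v = imem s v) \<and>
          imem s' ''w'' 0 = w + w \<and> imem s' ''a'' ` {0..<n} = imem s ''a'' ` {0..<n} \<and>
          block_sorted (rmem s ''x'') (imem s' ''a'') (w + w) n)"
        using im s4 s3 s3f s2 s1f by (intro halts_in_loop_free) auto
    qed simp
  qed simp
  moreover have "bcost sort_guard + ?k \<le> round_const * n"
    unfolding round_const_def by (rule round_cost_absorbed) (use w in simp)
  ultimately show ?thesis by blast
qed

lemma sort_prog:
  assumes n: "imem s ''n'' 0 = n"
  shows "halts_in sort_prog s (sort_time n)
    (\<lambda>s'. rmem s' = rmem s \<and>
      (\<forall>v. v \<notin> {''a'', ''b'', ''w'', ''lo'', ''mid'', ''hi'', ''i'', ''j'', ''k''} \<longrightarrow>
        imem s' v = imem s v) \<and>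
      imem s' ''a'' ` {0..<n} = {1..n} \<and> descending (rmem s ''x'') (imem s' ''a'') 0 n)"
  (is "halts_in _ _ _ ?Q")
proof -
  let ?X = "rmem s ''x''"
  define s1 where "s1 = run (iset ''i'' (INum 0)) s"
  have s1: "imem s1 ''n'' 0 = n" "imem s1 ''i'' 0 = 0" "rmem s1 = rmem s"
    using n by (simp_all add: s1_def)
  have s1f: "imem s1 v = imem s v" if "v \<noteq> ''i''" for v using that by (simp add: s1_def)
  show ?thesis
    unfolding sort_prog_def sort_time_def
  proof (rule halts_in_loop_free_Seq, simp, fold s1_def, rule halts_in_Seq,
      rule halts_in_mono[OF identity_loop[OF s1(1,2)]])
    fix s2 :: ram_state assume s2: "rmem s2 = rmem s1 \<and> (\<forall>v. v \<notin> {''a'', ''i''} \<longrightarrow> imem s2 v = imem s1 v) \<and>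
      (\<forall>p<n. imem s2 ''a'' p = Suc p)"
    define s3 where "s3 = run (iset ''w'' (INum 1)) s2"
    define I where "I s' \<longleftrightarrow> rmem s' = rmem s \<and>
      (\<forall>v. v \<notin> {''a'', ''b'', ''w'', ''lo'', ''mid'', ''hi'', ''i'', ''j'', ''k''} \<longrightarrow>
        imem s' v = imem s v) \<and>
      0 < imem s' ''w'' 0 \<and> imem s' ''a'' ` {0..<n} = {1..n} \<and>
      block_sorted ?X (imem s' ''a'') (imem s' ''w'' 0) n" for s' :: ram_state
    have im: "imem s2 ''a'' ` {0..<n} = {1..n}"
    proof -
      have "imem s2 ''a'' ` {0..<n} = Suc ` {0..<n}" using s2 by (intro image_cong) auto
      then show ?thesis by (simp add: image_Suc_atLeastLessThan atLeastLessThanSuc_atLeastAtMost)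
    qed
    have I3: "I s3" "imem s3 ''w'' 0 = 1"
      using s2 s1f im s1 block_sorted_one by (auto simp: I_def s3_def)
    have "halts_in (While sort_guard sort_round) s3
        (round_const * n * rounds n (imem s3 ''w'' 0) + bcost sort_guard) ?Q"
    proof (rule halts_in_While[where I=I and V="\<lambda>s'. round_const * n * rounds n (imem s' ''w'' 0)"])
      show "I s3" by (rule I3)
    next
      fix s4 assume I: "I s4" and g: "bval s4 sort_guard"
      define w where "w = imem s4 ''w'' 0"
      have n4: "imem s4 ''n'' 0 = n" using I n by (simp add: I_def)
      have w: "0 < w" "w < n" using I g n4 by (auto simp: I_def w_def)
      have "block_sorted (rmem s4 ''x'') (imem s4 ''a'') w n" using I by (simp add: I_def w_def)
      from sort_round[OF n4 w_def[symmetric] w this]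
      obtain k where k: "bcost sort_guard + k \<le> round_const * n" "halts_in sort_round s4 k
        (\<lambda>s'. rmem s' = rmem s4 \<and>
          (\<forall>v. v \<notin> {''a'', ''b'', ''w'', ''lo'', ''mid'', ''hi'', ''i'', ''j'', ''k''} \<longrightarrow>
            imem s' v = imem s4 v) \<and>
          imem s' ''w'' 0 = w + w \<and> imem s' ''a'' ` {0..<n} = imem s4 ''a'' ` {0..<n} \<and>
          block_sorted (rmem s4 ''x'') (imem s' ''a'') (w + w) n)"
        by blast
      have "bcost sort_guard + k + round_const * n * rounds n (w + w) \<le> round_const * n * rounds n w"
        using k(1) by (simp add: rounds_double[OF w])
      then show "\<exists>k. halts_in sort_round s4 k (\<lambda>s'. I s' \<and>
          bcost sort_guard + k + round_const * n * rounds n (imem s' ''w'' 0)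
            \<le> round_const * n * rounds n (imem s4 ''w'' 0))"
        using I w by (intro exI[of _ k] halts_in_mono[OF k(2) order_refl]) (simp add: I_def w_def[symmetric])
    next
      fix s' assume I: "I s'" and g: "\<not> bval s' sort_guard"
      have "n \<le> imem s' ''w'' 0" using I g n by (simp add: I_def)
      then have "descending ?X (imem s' ''a'') 0 n"
        using I[unfolded I_def block_sorted_def] by (metis add_0 min.absorb2 mult_0)
      then show "?Q s'" using I by (simp add: I_def)
    qed
    then show "halts_in (iset ''w'' (INum 1) ;; While sort_guard sort_round) s2
      (time_bound (iset ''w'' (INum 1)) + (round_const * n * rounds n 1 + bcost sort_guard)) ?Q"
      unfolding s3_def[symmetric] I3(2)
      by (intro halts_in_loop_free_Seq) (simp_all only: s3_def, simp)
  qed simp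
qed

section \<open>The bounds\<close>

text \<open>
  The scan is not stopped at a violated bound: the last one found is kept in \<open>viol\<close>, with the
  coefficient of its variable in \<open>sgn\<close>.  The array \<open>alpha\<close> is filled afterwards.
\<close>

definition box_step :: com where
  "box_step =
     Cond (RLess (RRead ''x'' (ivar ''j'')) (rvar ''l''))
       (iset ''answer'' (INum 1) ;; iset ''viol'' (ivar ''j'') ;;
        rset ''alpha0'' (RSub (RNum 0) (rvar ''l'')) ;; rset ''sgn'' (RNum 1))
       (Cond (RLess (rvar ''u'') (RRead ''x'' (ivar ''j'')))
         (iset ''answer'' (INum 1) ;; iset ''viol'' (ivar ''j'') ;;
          rset ''alpha0'' (rvar ''u'') ;; rset ''sgn'' (RNum (- 1)))
         Skip) ;;
     incr ''j''"

abbreviation box_guard :: bexp where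
  "box_guard \<equiv> BNot (ILess (ivar ''n'') (ivar ''j''))"

definition bound_violated :: "nat \<Rightarrow> ram_state \<Rightarrow> bool" where
  "bound_violated n s \<longleftrightarrow> imem s ''viol'' 0 \<in> {1..n} \<and>
     (rmem s ''sgn'' 0 = 1 \<and> rmem s ''alpha0'' 0 = - rmem s ''l'' 0 \<and>
        rmem s ''x'' (imem s ''viol'' 0) < rmem s ''l'' 0 \<or>
      rmem s ''sgn'' 0 = - 1 \<and> rmem s ''alpha0'' 0 = rmem s ''u'' 0 \<and>
        rmem s ''u'' 0 < rmem s ''x'' (imem s ''viol'' 0))"

lemma box_loop:
  assumes s: "imem s ''n'' 0 = n" "imem s ''j'' 0 = 1" "imem s ''answer'' 0 = 0"
  shows "halts_in (While box_guard box_step) s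
    ((bcost box_guard + time_bound box_step) * n + bcost box_guard)
    (\<lambda>s'. (\<forall>v. v \<notin> {''alpha0'', ''sgn''} \<longrightarrow> rmem s' v = rmem s v) \<and>
      (\<forall>v. v \<notin> {''j'', ''answer'', ''viol''} \<longrightarrow> imem s' v = imem s v) \<and>
      (imem s' ''answer'' 0 = 0 \<and>
         (\<forall>p\<in>{1..n}. rmem s ''l'' 0 \<le> rmem s ''x'' p \<and> rmem s ''x'' p \<le> rmem s ''u'' 0) \<or>
       imem s' ''answer'' 0 = 1 \<and> bound_violated n s'))"
proof -
  define I where "I s' \<longleftrightarrow> (\<forall>v. v \<notin> {''alpha0'', ''sgn''} \<longrightarrow> rmem s' v = rmem s v) \<and>
      (\<forall>v. v \<notin> {''j'', ''answer'', ''viol''} \<longrightarrow> imem s' v = imem s v) \<and>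
      1 \<le> imem s' ''j'' 0 \<and> imem s' ''j'' 0 \<le> Suc n \<and>
      (imem s' ''answer'' 0 = 0 \<and> (\<forall>p\<in>{1..<imem s' ''j'' 0}.
         rmem s ''l'' 0 \<le> rmem s ''x'' p \<and> rmem s ''x'' p \<le> rmem s ''u'' 0) \<or>
       imem s' ''answer'' 0 = 1 \<and> bound_violated n s')" for s' :: ram_state
  have "halts_in (While box_guard box_step) s
    ((bcost box_guard + time_bound box_step) * (Suc n - imem s ''j'' 0) + bcost box_guard)
    (\<lambda>s'. I s' \<and> \<not> bval s' box_guard)"
  proof (rule halts_in_simple_While[where I=I and V="\<lambda>s'. Suc n - imem s' ''j'' 0"])
    show "I s" using s by (simp add: I_def)
    show "loop_free box_step" by (simp add: box_step_def)
    fix s' assume I: "I s'" and g: "bval s' box_guard"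
    have fr: "imem s' ''n'' = imem s ''n''" "rmem s' ''x'' = rmem s ''x''" "rmem s' ''l'' = rmem s ''l''"
      "rmem s' ''u'' = rmem s ''u''" using I by (simp_all add: I_def)
    have j: "1 \<le> imem s' ''j'' 0" "imem s' ''j'' 0 \<le> n" using I g fr s by (simp_all add: I_def)
    consider (low) "rmem s ''x'' (imem s' ''j'' 0) < rmem s ''l'' 0"
      | (high) "\<not> rmem s ''x'' (imem s' ''j'' 0) < rmem s ''l'' 0"
          "rmem s ''u'' 0 < rmem s ''x'' (imem s' ''j'' 0)"
      | (ok) "\<not> rmem s ''x'' (imem s' ''j'' 0) < rmem s ''l'' 0"
          "\<not> rmem s ''u'' 0 < rmem s ''x'' (imem s' ''j'' 0)" by blast
    then have "I (run box_step s')"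
    proof cases
      case low
      then show ?thesis using I j fr by (simp add: I_def box_step_def bound_violated_def)
    next
      case high
      then show ?thesis using I j fr by (simp add: I_def box_step_def bound_violated_def)
    next
      case ok
      have "{1..<Suc (imem s' ''j'' 0)} = insert (imem s' ''j'' 0) {1..<imem s' ''j'' 0}" using j by auto
      then show ?thesis using I j fr ok by (auto simp: I_def box_step_def bound_violated_def)
    qed
    moreover have "imem (run box_step s') ''j'' 0 = Suc (imem s' ''j'' 0)" by (simp add: box_step_def)
    ultimately show "I (run box_step s') \<and> Suc n - imem (run box_step s') ''j'' 0 < Suc n - imem s' ''j'' 0"
      using j by simp
  qed simp
  then show ?thesis
  proof (rule halts_in_mono)
    fix s' assume I: "I s' \<and> \<not> bval s' box_guard"
    then have "imem s' ''n'' = imem s ''n''" "imem s' ''j'' 0 \<le> Suc n" by (simp_all add: I_def)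
    then have "imem s' ''j'' 0 = Suc n" using I s by simp
    then show "(\<forall>v. v \<notin> {''alpha0'', ''sgn''} \<longrightarrow> rmem s' v = rmem s v) \<and>
      (\<forall>v. v \<notin> {''j'', ''answer'', ''viol''} \<longrightarrow> imem s' v = imem s v) \<and>
      (imem s' ''answer'' 0 = 0 \<and>
         (\<forall>p\<in>{1..n}. rmem s ''l'' 0 \<le> rmem s ''x'' p \<and> rmem s ''x'' p \<le> rmem s ''u'' 0) \<or>
       imem s' ''answer'' 0 = 1 \<and> bound_violated n s')"
      using I by (simp add: I_def atLeastLessThanSuc_atLeastAtMost)
  qed (simp add: s)
qed

definition clear_step :: com where
  "clear_step = RAssign ''alpha'' (ivar ''j'') (RNum 0) ;; incr ''j''"

definition report_prog :: com where
  "report_prog = iset ''j'' (INum 1) ;; While box_guard clear_step ;;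
     (RAssign ''alpha'' (ivar ''viol'') (rvar ''sgn'') ;; rset ''alphay'' (RNum 0))"

definition report_const :: nat where
  "report_const = bcost box_guard + time_bound clear_step + (time_bound (iset ''j'' (INum 1)) + bcost box_guard
    + time_bound (RAssign ''alpha'' (ivar ''viol'') (rvar ''sgn'') ;; rset ''alphay'' (RNum 0)))"

lemma report_prog:
  assumes s: "imem s ''n'' 0 = n" and n: "1 \<le> n"
  shows "halts_in report_prog s (report_const * n)
    (\<lambda>s'. imem s' ''answer'' = imem s ''answer'' \<and> rmem s' ''alpha0'' = rmem s ''alpha0'' \<and>
      rmem s' ''alphay'' 0 = 0 \<and>
      (\<forall>p\<in>{1..n}. rmem s' ''alpha'' p = (if p = imem s ''viol'' 0 then rmem s ''sgn'' 0 else 0)))"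
  (is "halts_in _ _ _ ?Q")
proof -
  define s1 where "s1 = run (iset ''j'' (INum 1)) s"
  have s1: "imem s1 ''n'' 0 = n" "imem s1 ''j'' 0 = 1" "rmem s1 = rmem s"
    "imem s1 ''viol'' = imem s ''viol''" "imem s1 ''answer'' = imem s ''answer''"
    using s by (simp_all add: s1_def)
  define I where "I s' \<longleftrightarrow> (\<forall>v. v \<noteq> ''alpha'' \<longrightarrow> rmem s' v = rmem s1 v) \<and>
      (\<forall>v. v \<noteq> ''j'' \<longrightarrow> imem s' v = imem s1 v) \<and> imem s' ''j'' 0 \<le> Suc n \<and>
      (\<forall>p\<in>{1..<imem s' ''j'' 0}. rmem s' ''alpha'' p = 0)" for s' :: ram_state
  let ?tail = "RAssign ''alpha'' (ivar ''viol'') (rvar ''sgn'') ;; rset ''alphay'' (RNum 0)"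
  have loop: "halts_in (While box_guard clear_step) s1
    ((bcost box_guard + time_bound clear_step) * (Suc n - imem s1 ''j'' 0) + bcost box_guard)
    (\<lambda>s'. I s' \<and> \<not> bval s' box_guard)"
  proof (rule halts_in_simple_While[where I=I and V="\<lambda>s'. Suc n - imem s' ''j'' 0"])
    show "I s1" using s1 by (simp add: I_def)
    show "loop_free clear_step" by (simp add: clear_step_def)
    fix s' assume I: "I s'" and g: "bval s' box_guard"
    have "imem s' ''n'' = imem s1 ''n''" using I by (simp add: I_def)
    then have "imem s' ''j'' 0 \<le> n" using g s1 by simp
    then show "I (run clear_step s') \<and> Suc n - imem (run clear_step s') ''j'' 0 < Suc n - imem s' ''j'' 0"
      using I by (auto simp: I_def clear_step_def less_Suc_eq)
  qed simp
  have "halts_in report_prog s (time_bound (iset ''j'' (INum 1)) +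
      ((bcost box_guard + time_bound clear_step) * n + bcost box_guard + time_bound ?tail)) ?Q"
    unfolding report_prog_def
  proof (rule halts_in_loop_free_Seq, simp, fold s1_def, rule halts_in_Seq, rule halts_in_mono[OF loop])
    show "(bcost box_guard + time_bound clear_step) * (Suc n - imem s1 ''j'' 0) + bcost box_guard
      \<le> (bcost box_guard + time_bound clear_step) * n + bcost box_guard" by (simp add: s1)
  next
    fix s' assume I: "I s' \<and> \<not> bval s' box_guard"
    then have "imem s' ''n'' = imem s1 ''n''" "imem s' ''j'' 0 \<le> Suc n" by (simp_all add: I_def)
    then have "imem s' ''j'' 0 = Suc n" using I s1 by simp
    then have "?Q (run ?tail s')" using I s1 by (auto simp: I_def)
    then show "halts_in ?tail s' (time_bound ?tail) ?Q" by (rule halts_in_loop_free[rotated]) simp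
  qed
  moreover have "time_bound (iset ''j'' (INum 1)) +
      ((bcost box_guard + time_bound clear_step) * n + bcost box_guard + time_bound ?tail) \<le> report_const * n"
    using linear_bound[OF n, of "bcost box_guard + time_bound clear_step" "time_bound (iset ''j'' (INum 1)) +
      bcost box_guard + time_bound ?tail"] unfolding report_const_def by linarith
  ultimately show ?thesis by (rule halts_in_mono)
qed

section \<open>The loop over the core facets\<close>

abbreviation j_guard :: bexp where
  "j_guard \<equiv> ILess (ivar ''j'') (ivar ''n'')"

abbreviation beta_entry :: rexp where
  "beta_entry \<equiv> RRead ''beta'' (IAdd (IAdd (ivar ''base'') (ivar ''j'')) (INum 1))"

definition sum_step :: com where
  "sum_step = rset ''sum'' (RAdd (rvar ''sum'') (RMul beta_entry (RRead ''x'' (IRead ''a'' (ivar ''j''))))) ;;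
     incr ''j''"

lemma sum_loop:
  assumes s: "imem s ''n'' 0 = n" "imem s ''j'' 0 = 0"
  shows "halts_in (While j_guard sum_step) s ((bcost j_guard + time_bound sum_step) * n + bcost j_guard)
    (\<lambda>s'. (\<forall>v. v \<noteq> ''sum'' \<longrightarrow> rmem s' v = rmem s v) \<and> (\<forall>v. v \<noteq> ''j'' \<longrightarrow> imem s' v = imem s v) \<and>
      rmem s' ''sum'' 0 = rmem s ''sum'' 0 +
        (\<Sum>p<n. rmem s ''beta'' (imem s ''base'' 0 + p + 1) * rmem s ''x'' (imem s ''a'' p)))"
proof -
  define I where "I s' \<longleftrightarrow> (\<forall>v. v \<noteq> ''sum'' \<longrightarrow> rmem s' v = rmem s v) \<and>
      (\<forall>v. v \<noteq> ''j'' \<longrightarrow> imem s' v = imem s v) \<and> imem s' ''j'' 0 \<le> n \<and>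
      rmem s' ''sum'' 0 = rmem s ''sum'' 0 + (\<Sum>p<imem s' ''j'' 0.
        rmem s ''beta'' (imem s ''base'' 0 + p + 1) * rmem s ''x'' (imem s ''a'' p))" for s' :: ram_state
  have "halts_in (While j_guard sum_step) s
    ((bcost j_guard + time_bound sum_step) * (n - imem s ''j'' 0) + bcost j_guard)
    (\<lambda>s'. I s' \<and> \<not> bval s' j_guard)"
  proof (rule halts_in_simple_While[where I=I and V="\<lambda>s'. n - imem s' ''j'' 0"])
    show "I s" using s by (simp add: I_def)
    show "loop_free sum_step" by (simp add: sum_step_def)
    fix s' assume I: "I s'" and g: "bval s' j_guard"
    have "imem s' ''n'' = imem s ''n''" using I by (simp add: I_def)
    then have "imem s' ''j'' 0 < n" using g s by simp
    then show "I (run sum_step s') \<and> n - imem (run sum_step s') ''j'' 0 < n - imem s' ''j'' 0"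
      using I by (simp add: I_def sum_step_def)
  qed simp
  then show ?thesis
  proof (rule halts_in_mono)
    fix s' assume I: "I s' \<and> \<not> bval s' j_guard"
    then have "imem s' ''n'' = imem s ''n''" "imem s' ''j'' 0 \<le> n" by (simp_all add: I_def)
    then have "imem s' ''j'' 0 = n" using I s by simp
    then show "(\<forall>v. v \<noteq> ''sum'' \<longrightarrow> rmem s' v = rmem s v) \<and> (\<forall>v. v \<noteq> ''j'' \<longrightarrow> imem s' v = imem s v) \<and>
      rmem s' ''sum'' 0 = rmem s ''sum'' 0 +
        (\<Sum>p<n. rmem s ''beta'' (imem s ''base'' 0 + p + 1) * rmem s ''x'' (imem s ''a'' p))"
      using I by (simp add: I_def)
  qed (simp add: s)
qed

definition output_step :: com where
  "output_step = RAssign ''alpha'' (IRead ''a'' (ivar ''j'')) beta_entry ;; incr ''j''"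

lemma output_loop:
  assumes s: "imem s ''n'' 0 = n" "imem s ''j'' 0 = 0" and inj: "inj_on (imem s ''a'') {..<n}"
  shows "halts_in (While j_guard output_step) s ((bcost j_guard + time_bound output_step) * n + bcost j_guard)
    (\<lambda>s'. (\<forall>v. v \<noteq> ''alpha'' \<longrightarrow> rmem s' v = rmem s v) \<and> (\<forall>v. v \<noteq> ''j'' \<longrightarrow> imem s' v = imem s v) \<and>
      (\<forall>p<n. rmem s' ''alpha'' (imem s ''a'' p) = rmem s ''beta'' (imem s ''base'' 0 + p + 1)))"
proof -
  define I where "I s' \<longleftrightarrow> (\<forall>v. v \<noteq> ''alpha'' \<longrightarrow> rmem s' v = rmem s v) \<and>
      (\<forall>v. v \<noteq> ''j'' \<longrightarrow> imem s' v = imem s v) \<and> imem s' ''j'' 0 \<le> n \<and>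
      (\<forall>p<imem s' ''j'' 0. rmem s' ''alpha'' (imem s ''a'' p) = rmem s ''beta'' (imem s ''base'' 0 + p + 1))"
    for s' :: ram_state
  have "halts_in (While j_guard output_step) s
    ((bcost j_guard + time_bound output_step) * (n - imem s ''j'' 0) + bcost j_guard)
    (\<lambda>s'. I s' \<and> \<not> bval s' j_guard)"
  proof (rule halts_in_simple_While[where I=I and V="\<lambda>s'. n - imem s' ''j'' 0"])
    show "I s" using s by (simp add: I_def)
    show "loop_free output_step" by (simp add: output_step_def)
    fix s' assume I: "I s'" and g: "bval s' j_guard"
    have "imem s' ''n'' = imem s ''n''" using I by (simp add: I_def)
    then have j: "imem s' ''j'' 0 < n" using g s by simp
    have "imem s ''a'' p \<noteq> imem s ''a'' (imem s' ''j'' 0)" if "p < imem s' ''j'' 0" for p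
      using inj_onD[OF inj, of p "imem s' ''j'' 0"] that j by auto
    then show "I (run output_step s') \<and> n - imem (run output_step s') ''j'' 0 < n - imem s' ''j'' 0"
      using I j by (auto simp: I_def output_step_def less_Suc_eq)
  qed simp
  then show ?thesis
  proof (rule halts_in_mono)
    fix s' assume I: "I s' \<and> \<not> bval s' j_guard"
    then have "imem s' ''n'' = imem s ''n''" "imem s' ''j'' 0 \<le> n" by (simp_all add: I_def)
    then have "imem s' ''j'' 0 = n" using I s by simp
    then show "(\<forall>v. v \<noteq> ''alpha'' \<longrightarrow> rmem s' v = rmem s v) \<and> (\<forall>v. v \<noteq> ''j'' \<longrightarrow> imem s' v = imem s v) \<and>
      (\<forall>p<n. rmem s' ''alpha'' (imem s ''a'' p) = rmem s ''beta'' (imem s ''base'' 0 + p + 1))"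
      using I by (simp add: I_def)
  qed (simp add: s)
qed

definition facet_setup :: com where
  "facet_setup = rset ''sum'' (RAdd (RRead ''beta0'' (ivar ''k'')) (RMul (RRead ''betay'' (ivar ''k'')) (rvar ''y''))) ;;
     iset ''j'' (INum 0)"

definition output_setup :: com where
  "output_setup = iset ''answer'' (INum 1) ;; rset ''alpha0'' (RRead ''beta0'' (ivar ''k'')) ;;
     rset ''alphay'' (RRead ''betay'' (ivar ''k'')) ;; iset ''j'' (INum 0)"

abbreviation violated_guard :: bexp where
  "violated_guard \<equiv> RLess (rvar ''sum'') (RNum 0)"

definition facet_next :: com where
  "facet_next = incr ''k'' ;; iset ''base'' (IAdd (ivar ''base'') (ivar ''n''))"

text \<open>
  The coefficients of facet \<open>k\<close> start at the address \<open>base = k * n\<close>, which is maintained by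
  addition.  The loop continues after a violated facet, and a later one overwrites the output.
\<close>

definition facet_step :: com where
  "facet_step = facet_setup ;; While j_guard sum_step ;;
     Cond violated_guard (output_setup ;; While j_guard output_step) Skip ;; facet_next"

abbreviation facet_guard :: bexp where
  "facet_guard \<equiv> ILess (ivar ''k'') (ivar ''t'')"

definition facet_const :: nat where
  "facet_const = bcost j_guard + time_bound sum_step + (bcost j_guard + time_bound output_step) +
     (bcost facet_guard + time_bound facet_setup + bcost j_guard + (bcost violated_guard +
      (time_bound output_setup + bcost j_guard)) + time_bound facet_next)"

text \<open>
  The left-hand side of facet \<open>k\<close> at the point whose coordinates are rearranged by the array \<open>a\<close>.
\<close>

definition row_value :: "nat \<Rightarrow> ram_state \<Rightarrow> nat \<Rightarrow> real" where
  "row_value n s k = rmem s ''beta0'' k + rmem s ''betay'' k * rmem s ''y'' 0 +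
     (\<Sum>p<n. rmem s ''beta'' (k * n + p + 1) * rmem s ''x'' (imem s ''a'' p))"

lemma facet_step:
  assumes s: "imem s ''n'' 0 = n" "imem s ''k'' 0 = k" "imem s ''base'' 0 = k * n"
    and n: "1 \<le> n" and inj: "inj_on (imem s ''a'') {..<n}"
  shows "\<exists>c. bcost facet_guard + c \<le> facet_const * n \<and> halts_in facet_step s c
    (\<lambda>s'. (\<forall>v. v \<notin> {''sum'', ''alpha0'', ''alpha'', ''alphay''} \<longrightarrow> rmem s' v = rmem s v) \<and>
      (\<forall>v. v \<notin> {''j'', ''k'', ''base'', ''answer''} \<longrightarrow> imem s' v = imem s v) \<and>
      imem s' ''k'' 0 = Suc k \<and> imem s' ''base'' 0 = Suc k * n \<and>
      (if row_value n s k < 0 then imem s' ''answer'' 0 = 1 \<and> rmem s' ''alpha0'' 0 = rmem s ''beta0'' k \<and>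
          rmem s' ''alphay'' 0 = rmem s ''betay'' k \<and>
          (\<forall>p<n. rmem s' ''alpha'' (imem s ''a'' p) = rmem s ''beta'' (k * n + p + 1))
        else imem s' ''answer'' = imem s ''answer'' \<and> (\<forall>v. v \<noteq> ''sum'' \<longrightarrow> rmem s' v = rmem s v)))"
    (is "\<exists>c. _ \<and> halts_in _ _ c ?Q")
proof -
  define s1 where "s1 = run facet_setup s"
  have s1: "imem s1 ''n'' 0 = n" "imem s1 ''j'' 0 = 0" "imem s1 ''base'' 0 = k * n"
    "imem s1 ''a'' = imem s ''a''" "rmem s1 ''sum'' 0 = rmem s ''beta0'' k + rmem s ''betay'' k * rmem s ''y'' 0"
    using s by (simp_all add: s1_def facet_setup_def)
  have s1r: "rmem s1 v = rmem s v" if "v \<noteq> ''sum''" for v using that by (simp add: s1_def facet_setup_def)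
  have s1i: "imem s1 v = imem s v" if "v \<noteq> ''j''" for v using that by (simp add: s1_def facet_setup_def)
  let ?sum = "(bcost j_guard + time_bound sum_step) * n + bcost j_guard"
  let ?out = "time_bound output_setup + ((bcost j_guard + time_bound output_step) * n + bcost j_guard)"
  let ?c = "time_bound facet_setup + (?sum + (bcost violated_guard + ?out + time_bound facet_next))"
  have "halts_in facet_step s ?c ?Q"
    unfolding facet_step_def
  proof (rule halts_in_loop_free_Seq, simp add: facet_setup_def, fold s1_def, rule halts_in_Seq,
      rule halts_in_mono[OF sum_loop[OF s1(1,2)] order_refl])
    fix s2 :: ram_state
    assume s2: "(\<forall>v. v \<noteq> ''sum'' \<longrightarrow> rmem s2 v = rmem s1 v) \<and> (\<forall>v. v \<noteq> ''j'' \<longrightarrow> imem s2 v = imem s1 v) \<and>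
      rmem s2 ''sum'' 0 = rmem s1 ''sum'' 0 +
        (\<Sum>p<n. rmem s1 ''beta'' (imem s1 ''base'' 0 + p + 1) * rmem s1 ''x'' (imem s1 ''a'' p))"
    then have val: "rmem s2 ''sum'' 0 = row_value n s k"
      by (simp add: s1 s1r row_value_def)
    have r2: "rmem s2 v = rmem s v" if "v \<noteq> ''sum''" for v using s2 s1r that by simp
    have i2: "imem s2 v = imem s v" if "v \<noteq> ''j''" for v using s2 s1i that by simp
    show "halts_in (Cond violated_guard (output_setup ;; While j_guard output_step) Skip ;; facet_next) s2
      (bcost violated_guard + ?out + time_bound facet_next) ?Q"
    proof (rule halts_in_Seq, rule halts_in_Cond)
      assume neg: "bval s2 violated_guard"
      then have row: "row_value n s k < 0" using val by simp
      define s3 where "s3 = run output_setup s2"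
      have s3: "imem s3 ''n'' 0 = n" "imem s3 ''j'' 0 = 0" "inj_on (imem s3 ''a'') {..<n}"
        "rmem s3 ''alpha0'' 0 = rmem s ''beta0'' k" "rmem s3 ''alphay'' 0 = rmem s ''betay'' k"
        "imem s3 ''answer'' 0 = 1" "imem s3 ''base'' 0 = k * n" "imem s3 ''k'' 0 = k"
        using s inj r2 i2 by (simp_all add: s3_def output_setup_def)
      have r3: "rmem s3 v = rmem s v" if "v \<notin> {''sum'', ''alpha0'', ''alphay''}" for v
        using that r2 by (simp add: s3_def output_setup_def)
      have i3: "imem s3 v = imem s v" if "v \<notin> {''j'', ''answer''}" for v
        using that i2 by (simp add: s3_def output_setup_def)
      show "halts_in (output_setup ;; While j_guard output_step) s2 ?out
        (\<lambda>s'. halts_in facet_next s' (time_bound facet_next) ?Q)"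
      proof (rule halts_in_loop_free_Seq, simp add: output_setup_def, fold s3_def,
          rule halts_in_mono[OF output_loop[OF s3(1-3)] order_refl])
        fix s4 :: ram_state
        assume s4: "(\<forall>v. v \<noteq> ''alpha'' \<longrightarrow> rmem s4 v = rmem s3 v) \<and>
          (\<forall>v. v \<noteq> ''j'' \<longrightarrow> imem s4 v = imem s3 v) \<and>
          (\<forall>p<n. rmem s4 ''alpha'' (imem s3 ''a'' p) = rmem s3 ''beta'' (imem s3 ''base'' 0 + p + 1))"
        have "?Q (run facet_next s4)"
          using s4 s3 r3 i3 row by (simp add: facet_next_def)
        then show "halts_in facet_next s4 (time_bound facet_next) ?Q"
          by (rule halts_in_loop_free[rotated]) (simp add: facet_next_def)
      qed
    next
      assume "\<not> bval s2 violated_guard"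
      then have row: "\<not> row_value n s k < 0" using val by simp
      have "?Q (run facet_next s2)"
        using row r2 i2 s by (simp add: facet_next_def)
      then have "halts_in facet_next s2 (time_bound facet_next) ?Q"
        by (rule halts_in_loop_free[rotated]) (simp add: facet_next_def)
      then have "halts_in facet_next (run Skip s2) (time_bound facet_next) ?Q"
        by (simp only: run.simps)
      then have "halts_in Skip s2 (time_bound Skip) (\<lambda>s'. halts_in facet_next s' (time_bound facet_next) ?Q)"
        by (rule halts_in_loop_free[rotated]) simp
      then show "halts_in Skip s2 ?out (\<lambda>s'. halts_in facet_next s' (time_bound facet_next) ?Q)"
        by (rule halts_in_mono) (simp_all add: output_setup_def)
    qed
  qed
  moreover have "bcost facet_guard + ?c \<le> facet_const * n"
    using linear_bound[OF n, of "bcost j_guard + time_bound sum_step + (bcost j_guard + time_bound output_step)"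
      "bcost facet_guard + time_bound facet_setup + bcost j_guard + (bcost violated_guard +
      (time_bound output_setup + bcost j_guard)) + time_bound facet_next"]
    unfolding facet_const_def distrib_right[of "bcost j_guard + time_bound sum_step"] by linarith
  ultimately show ?thesis by blast
qed

definition facet_prog :: com where
  "facet_prog = (iset ''k'' (INum 0) ;; iset ''base'' (INum 0)) ;; While facet_guard facet_step"

definition facet_time :: "nat \<Rightarrow> nat \<Rightarrow> nat" where
  "facet_time n t = time_bound (iset ''k'' (INum 0) ;; iset ''base'' (INum 0)) +
     (facet_const * n * t + bcost facet_guard)"

text \<open>
  The loop knows nothing about polytopes: \<open>S\<close> is any property of inequalities that a row with
  negative value guarantees after its coefficients are put back at the original indices.
\<close>

lemma facet_prog:
  assumes s: "imem s ''n'' 0 = n" "imem s ''t'' 0 = t" "imem s ''answer'' 0 = 0"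
    and n: "1 \<le> n" and inj: "inj_on (imem s ''a'') {..<n}"
    and sep: "\<And>k \<alpha>. k < t \<Longrightarrow> row_value n s k < 0 \<Longrightarrow>
      (\<And>p. p < n \<Longrightarrow> \<alpha> (imem s ''a'' p) = rmem s ''beta'' (k * n + p + 1)) \<Longrightarrow>
      S (rmem s ''beta0'' k) \<alpha> (rmem s ''betay'' k)"
  shows "halts_in facet_prog s (facet_time n t)
    (\<lambda>s'. imem s' ''answer'' 0 = 0 \<and> (\<forall>k<t. 0 \<le> row_value n s k) \<or>
      imem s' ''answer'' 0 = 1 \<and> S (rmem s' ''alpha0'' 0) (rmem s' ''alpha'') (rmem s' ''alphay'' 0))"
    (is "halts_in _ _ _ ?Q")
proof -
  define s1 where "s1 = run (iset ''k'' (INum 0) ;; iset ''base'' (INum 0)) s"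
  define I where "I s' \<longleftrightarrow>
      (\<forall>v. v \<notin> {''sum'', ''alpha0'', ''alpha'', ''alphay''} \<longrightarrow> rmem s' v = rmem s v) \<and>
      (\<forall>v. v \<notin> {''j'', ''k'', ''base'', ''answer''} \<longrightarrow> imem s' v = imem s v) \<and>
      imem s' ''k'' 0 \<le> t \<and> imem s' ''base'' 0 = imem s' ''k'' 0 * n \<and>
      (imem s' ''answer'' 0 = 0 \<and> (\<forall>k<imem s' ''k'' 0. 0 \<le> row_value n s k) \<or>
      imem s' ''answer'' 0 = 1 \<and> S (rmem s' ''alpha0'' 0) (rmem s' ''alpha'') (rmem s' ''alphay'' 0))"
    for s' :: ram_state
  have I1: "I s1" "imem s1 ''k'' 0 = 0" using s by (simp_all add: I_def s1_def)
  have "halts_in (While facet_guard facet_step) s1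
      (facet_const * n * (t - imem s1 ''k'' 0) + bcost facet_guard) ?Q"
  proof (rule halts_in_While[where I=I and V="\<lambda>s'. facet_const * n * (t - imem s' ''k'' 0)"])
    show "I s1" by (rule I1)
  next
    fix s2 assume I: "I s2" and g: "bval s2 facet_guard"
    define k where "k = imem s2 ''k'' 0"
    have fr: "imem s2 ''n'' = imem s ''n''" "imem s2 ''t'' = imem s ''t''" "imem s2 ''a'' = imem s ''a''"
      "rmem s2 ''beta0'' = rmem s ''beta0''" "rmem s2 ''beta'' = rmem s ''beta''"
      "rmem s2 ''betay'' = rmem s ''betay''" "rmem s2 ''x'' = rmem s ''x''" "rmem s2 ''y'' = rmem s ''y''"
      using I by (simp_all add: I_def)
    have k: "k < t" using g fr s by (simp add: k_def)
    have row: "row_value n s2 k = row_value n s k" by (simp add: row_value_def fr)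
    have "imem s2 ''n'' 0 = n" "imem s2 ''base'' 0 = k * n" "inj_on (imem s2 ''a'') {..<n}"
      using I s fr inj by (simp_all add: I_def k_def)
    from facet_step[OF this(1) k_def[symmetric] this(2) n this(3)]
    obtain c where c: "bcost facet_guard + c \<le> facet_const * n" and step: "halts_in facet_step s2 c
      (\<lambda>s'. (\<forall>v. v \<notin> {''sum'', ''alpha0'', ''alpha'', ''alphay''} \<longrightarrow> rmem s' v = rmem s2 v) \<and>
      (\<forall>v. v \<notin> {''j'', ''k'', ''base'', ''answer''} \<longrightarrow> imem s' v = imem s2 v) \<and>
      imem s' ''k'' 0 = Suc k \<and> imem s' ''base'' 0 = Suc k * n \<and>
      (if row_value n s2 k < 0 then imem s' ''answer'' 0 = 1 \<and> rmem s' ''alpha0'' 0 = rmem s2 ''beta0'' k \<and>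
          rmem s' ''alphay'' 0 = rmem s2 ''betay'' k \<and>
          (\<forall>p<n. rmem s' ''alpha'' (imem s2 ''a'' p) = rmem s2 ''beta'' (k * n + p + 1))
        else imem s' ''answer'' = imem s2 ''answer'' \<and> (\<forall>v. v \<noteq> ''sum'' \<longrightarrow> rmem s' v = rmem s2 v)))"
      by blast
    have "halts_in facet_step s2 c (\<lambda>s'. I s' \<and> imem s' ''k'' 0 = Suc k)"
    proof (rule halts_in_mono[OF step order_refl], unfold row fr)
      fix s' :: ram_state
      assume s': "(\<forall>v. v \<notin> {''sum'', ''alpha0'', ''alpha'', ''alphay''} \<longrightarrow> rmem s' v = rmem s2 v) \<and>
      (\<forall>v. v \<notin> {''j'', ''k'', ''base'', ''answer''} \<longrightarrow> imem s' v = imem s2 v) \<and>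
      imem s' ''k'' 0 = Suc k \<and> imem s' ''base'' 0 = Suc k * n \<and>
      (if row_value n s k < 0 then imem s' ''answer'' 0 = 1 \<and> rmem s' ''alpha0'' 0 = rmem s ''beta0'' k \<and>
          rmem s' ''alphay'' 0 = rmem s ''betay'' k \<and>
          (\<forall>p<n. rmem s' ''alpha'' (imem s ''a'' p) = rmem s ''beta'' (k * n + p + 1))
        else imem s' ''answer'' = imem s2 ''answer'' \<and> (\<forall>v. v \<noteq> ''sum'' \<longrightarrow> rmem s' v = rmem s2 v))"
      show "I s' \<and> imem s' ''k'' 0 = Suc k"
      proof (cases "row_value n s k < 0")
        case True
        have "S (rmem s ''beta0'' k) (rmem s' ''alpha'') (rmem s ''betay'' k)"
          by (rule sep[OF k True]) (use s' True in simp)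
        then show ?thesis using s' True I k by (simp add: I_def)
      next
        case False
        then have "imem s' ''answer'' = imem s2 ''answer''" "rmem s' ''alpha0'' = rmem s2 ''alpha0''"
          "rmem s' ''alpha'' = rmem s2 ''alpha''" "rmem s' ''alphay'' = rmem s2 ''alphay''"
          using s' by simp_all
        then show ?thesis using s' False I k by (auto simp: I_def k_def less_Suc_eq)
      qed
    qed
    moreover have "bcost facet_guard + c + facet_const * n * (t - Suc k) \<le> facet_const * n * (t - k)"
    proof -
      have "t - k = Suc (t - Suc k)" using k by simp
      then show ?thesis using c by simp
    qed
    ultimately show "\<exists>c. halts_in facet_step s2 c (\<lambda>s'. I s' \<and>
        bcost facet_guard + c + facet_const * n * (t - imem s' ''k'' 0) \<le> facet_const * n * (t - imem s2 ''k'' 0))"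
      unfolding k_def[symmetric] by (intro exI[of _ c]) (erule halts_in_mono, simp, metis)
  next
    fix s' assume I: "I s'" and g: "\<not> bval s' facet_guard"
    then have "imem s' ''t'' = imem s ''t''" "imem s' ''k'' 0 \<le> t" by (simp_all add: I_def)
    then have "imem s' ''k'' 0 = t" using g s by simp
    then show "?Q s'" using I by (simp add: I_def)
  qed
  then have "halts_in (While facet_guard facet_step) s1 (facet_const * n * t + bcost facet_guard) ?Q"
    by (simp only: I1 diff_zero)
  then show ?thesis
    unfolding facet_prog_def facet_time_def s1_def
    by (rule halts_in_loop_free_Seq[rotated]) simp
qed

section \<open>The separation algorithm\<close>

lemma ineq_lhs_cong:
  "(\<And>j. j \<in> {1..n} \<Longrightarrow> b j = a j) \<Longrightarrow> ineq_lhs n b0 b b' p = ineq_lhs n b0 a b' p"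
  by (cases p) (auto intro!: sum.cong)

lemma bound_separates:
  assumes x: "x \<in> Rn n" and k: "k \<in> {1..n}"
    and \<alpha>: "\<And>p. p \<in> {1..n} \<Longrightarrow> \<alpha> p = (if p = k then s else 0)"
    and viol: "s = 1 \<and> a0 = - l \<and> coord x k < l \<or> s = - 1 \<and> a0 = u \<and> u < coord x k"
  shows "valid_ineq n a0 \<alpha> 0 (conv_G n l u c) \<and> ineq_lhs n a0 \<alpha> 0 (x, y) < 0"
proof -
  have lhs: "ineq_lhs n a0 \<alpha> 0 p = a0 + s * coord (fst p) k" for p
  proof -
    have "(\<Sum>j=1..n. \<alpha> j * coord (fst p) j) = (\<Sum>j=1..n. if j = k then s * coord (fst p) j else 0)"
      by (intro sum.cong) (auto simp: \<alpha>)
    also have "\<dots> = s * coord (fst p) k" using k by simp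
    finally show ?thesis by (cases p) simp
  qed
  have "0 \<le> a0 + s * coord (fst p) k" if "p \<in> conv_G n l u c" for p
  proof -
    have "l \<le> coord (fst p) k" "coord (fst p) k \<le> u"
      using conv_G_fst_box[OF that] k unfolding box_X_def by blast+
    then show ?thesis using viol by auto
  qed
  then show ?thesis unfolding valid_ineq_def lhs using viol by auto
qed

text \<open>
  The sorted array is indexed from 0, permutations act on \<open>{1..n}\<close>.
\<close>

lemma index_permutation:
  assumes A: "A ` {0..<n} = {1..n}"
  obtains \<sigma> where "\<sigma> permutes {1..n}" "\<And>p. p < n \<Longrightarrow> \<sigma> (Suc p) = A p" "inj_on A {..<n}"
proof -
  have "card (A ` {0..<n}) = card {0..<n}" by (simp add: A)
  then have inj: "inj_on A {0..<n}" by (rule eq_card_imp_inj_on[rotated]) simp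
  define \<sigma> where "\<sigma> j = (if j \<in> {1..n} then A (j - 1) else j)" for j
  have "bij_betw (\<lambda>j. j - 1) {1..n} {0..<n}"
    by (rule bij_betw_byWitness[where f'=Suc]) auto
  then have "bij_betw (A \<circ> (\<lambda>j. j - 1)) {1..n} {1..n}"
    by (rule bij_betw_trans) (simp add: bij_betw_def inj A)
  then have "bij_betw \<sigma> {1..n} {1..n}"
    by (rule bij_betw_cong[THEN iffD1, rotated]) (auto simp: \<sigma>_def)
  then have "\<sigma> permutes {1..n}" by (rule bij_imp_permutes) (auto simp: \<sigma>_def)
  then show ?thesis using inj by (intro that[of \<sigma>]) (auto simp: \<sigma>_def lessThan_atLeast0)
qed

text \<open>
  Putting the coefficient of rank \<open>p\<close> at the index \<open>A p\<close> of the coordinate of that rank permutes a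
  facet by a symmetry of the hull, and does not change its value.
\<close>

lemma permuted_facet_separates:
  assumes lu: "l < u" and facet: "(b0, b, b') \<in> core_facets n l u c"
    and A: "A ` {0..<n} = {1..n}" and \<alpha>: "\<And>p. p < n \<Longrightarrow> \<alpha> (A p) = coord b (Suc p)"
    and neg: "b0 + b' * y + (\<Sum>p<n. coord b (Suc p) * coord x (A p)) < 0"
  shows "valid_ineq n b0 \<alpha> b' (conv_G n l u c) \<and> ineq_lhs n b0 \<alpha> b' (x, y) < 0"
proof -
  obtain \<sigma> where \<sigma>: "\<sigma> permutes {1..n}" and \<sigma>A: "\<And>p. p < n \<Longrightarrow> \<sigma> (Suc p) = A p"
    using index_permutation[OF A] by blast
  have eq: "\<alpha> j = (coord b \<circ> inv \<sigma>) j" if j: "j \<in> {1..n}" for j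
  proof -
    obtain p where p: "p < n" "j = A p" using A j by (metis atLeastLessThan_iff imageE)
    then have "inv \<sigma> j = Suc p" using \<sigma>A permutes_inverses(2)[OF \<sigma>] by metis
    then show ?thesis using \<alpha> p by simp
  qed
  have valid: "valid_ineq n b0 (coord b) b' (conv_G n l u c)"
    using facet by (simp add: core_facets_def)
  have "valid_ineq n b0 \<alpha> b' (conv_G n l u c)"
    using valid_ineq_permute[OF lu permutes_inv[OF \<sigma>] valid] ineq_lhs_cong[of n \<alpha> "coord b \<circ> inv \<sigma>", OF eq]
    by (simp add: valid_ineq_def del: ineq_lhs.simps)
  moreover have "(\<Sum>j=1..n. \<alpha> j * coord x j) = (\<Sum>j\<in>A ` {0..<n}. \<alpha> j * coord x j)" by (simp add: A)
  moreover have "inj_on A {0..<n}" by (rule index_permutation[OF A]) (simp add: lessThan_atLeast0)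
  then have "(\<Sum>j\<in>A ` {0..<n}. \<alpha> j * coord x j) = (\<Sum>p<n. coord b (Suc p) * coord x (A p))"
    by (simp add: sum.reindex \<alpha> lessThan_atLeast0)
  ultimately show ?thesis using neg by simp
qed

text \<open>
  A core facet violated under some permutation is violated under the decreasing arrangement of the
  point, which minimises its left-hand side.
\<close>

lemma membership_if_core_facets_hold:
  assumes lu: "l < u" and c: "\<exists>i\<in>{2..n}. c i \<noteq> 0" and x: "x \<in> box_X n l u"
    and A: "A ` {0..<n} = {1..n}" and desc: "descending (coord x) A 0 n"
    and nonneg: "\<And>b0 b b'. (b0, b, b') \<in> core_facets n l u c \<Longrightarrow>
      0 \<le> b0 + b' * y + (\<Sum>p<n. coord b (Suc p) * coord x (A p))"
  shows "(x, y) \<in> conv_G n l u c"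
proof (rule ccontr)
  assume "(x, y) \<notin> conv_G n l u c"
  then obtain b0 b b' \<pi> where facet: "(b0, b, b') \<in> core_facets n l u c" and \<pi>: "\<pi> permutes {1..n}"
    and neg: "b0 + (\<Sum>j=1..n. coord b j * coord x (\<pi> j)) + b' * y < 0"
    using violated_core_facet[OF lu c x] by metis
  obtain \<sigma> where \<sigma>: "\<sigma> permutes {1..n}" and \<sigma>A: "\<And>p. p < n \<Longrightarrow> \<sigma> (Suc p) = A p"
    using index_permutation[OF A] by blast
  define z where "z j = coord x (\<sigma> j)" for j
  have "mono_on {1..n} (coord b)" using facet by (simp add: core_facets_def core_ineq_def)
  moreover have "antimono_on {1..n} z"
  proof (rule monotone_onI)
    fix i j assume ij: "i \<in> {1..n}" "j \<in> {1..n}" "i \<le> j"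
    then have "\<sigma> i = A (i - 1)" "\<sigma> j = A (j - 1)" using \<sigma>A[of "i - 1"] \<sigma>A[of "j - 1"] by auto
    then show "z j \<le> z i" using desc ij by (auto simp: descending_def z_def)
  qed
  ultimately have "(\<Sum>j=1..n. coord b j * z j) \<le> (\<Sum>j=1..n. coord b j * z ((inv \<sigma> \<circ> \<pi>) j))"
    by (rule rearrangement) (rule permutes_compose[OF \<pi> permutes_inv[OF \<sigma>]])
  moreover have "z ((inv \<sigma> \<circ> \<pi>) j) = coord x (\<pi> j)" for j
    using permutes_inverses(1)[OF \<sigma>] by (simp add: z_def)
  moreover have "(\<Sum>j=1..n. coord b j * z j) = (\<Sum>p<n. coord b (Suc p) * coord x (A p))"
    by (rule sum.reindex_bij_witness[where i=Suc and j="\<lambda>j. j - 1"]) (auto simp: z_def \<sigma>A[symmetric])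
  ultimately show False using neg nonneg[OF facet] by simp
qed

definition separation_prog :: com where
  "separation_prog = (iset ''answer'' (INum 0) ;; iset ''j'' (INum 1)) ;; While box_guard box_step ;;
     Cond (ILess (ivar ''answer'') (INum 1)) (sort_prog ;; facet_prog) report_prog"

definition separation_time :: "nat \<Rightarrow> nat \<Rightarrow> nat" where
  "separation_time n t = time_bound (iset ''answer'' (INum 0) ;; iset ''j'' (INum 1)) +
     ((bcost box_guard + time_bound box_step) * n + bcost box_guard +
      (bcost (ILess (ivar ''answer'') (INum 1)) + (sort_time n + facet_time n t + report_const * n)))"

lemma separation_prog_correct:
  assumes n: "2 \<le> n" and lu: "l < u" and c: "\<exists>i\<in>{2..n}. c i \<noteq> 0"
    and Fs: "set Fs = core_facets n l u c" and x: "x \<in> Rn n" and inp: "separation_input n l u Fs x y s"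
  shows "halts_in separation_prog s (separation_time n (length Fs))
    (separation_output n (conv_G n l u c) x y)" (is "halts_in _ _ _ ?Q")
proof -
  let ?P = "conv_G n l u c"
  have in0: "imem s ''n'' 0 = n" "imem s ''t'' 0 = length Fs" "rmem s ''l'' 0 = l" "rmem s ''u'' 0 = u"
    "\<And>j. j \<in> {1..n} \<Longrightarrow> rmem s ''x'' j = coord x j" "rmem s ''y'' 0 = y"
    using inp by (simp_all add: separation_input_def)
  have row: "rmem s ''beta0'' k = b0" "rmem s ''betay'' k = b'"
    "\<And>p. p < n \<Longrightarrow> rmem s ''beta'' (k * n + p + 1) = coord b (Suc p)"
    if "k < length Fs" "Fs ! k = (b0, b, b')" for k b0 b b'
  proof -
    have r: "rmem s ''beta0'' k = b0 \<and> (\<forall>j\<in>{1..n}. rmem s ''beta'' (k * n + j) = coord b j) \<and>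
        rmem s ''betay'' k = b'"
      using inp that by (auto simp: separation_input_def)
    then show "rmem s ''beta0'' k = b0" "rmem s ''betay'' k = b'" by simp_all
    show "rmem s ''beta'' (k * n + p + 1) = coord b (Suc p)" if "p < n" for p
      using r that by (auto dest!: bspec[of _ _ "Suc p"])
  qed
  define s1 where "s1 = run (iset ''answer'' (INum 0) ;; iset ''j'' (INum 1)) s"
  have s1: "imem s1 ''n'' 0 = n" "imem s1 ''j'' 0 = 1" "imem s1 ''answer'' 0 = 0" "rmem s1 = rmem s"
    "imem s1 ''t'' 0 = length Fs"
    using in0 by (simp_all add: s1_def)
  show ?thesis
    unfolding separation_prog_def separation_time_def
  proof (rule halts_in_loop_free_Seq, simp, fold s1_def, rule halts_in_Seq,
      rule halts_in_mono[OF box_loop[OF s1(1-3)] order_refl])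
    fix s2 :: ram_state
    assume s2: "(\<forall>v. v \<notin> {''alpha0'', ''sgn''} \<longrightarrow> rmem s2 v = rmem s1 v) \<and>
      (\<forall>v. v \<notin> {''j'', ''answer'', ''viol''} \<longrightarrow> imem s2 v = imem s1 v) \<and>
      (imem s2 ''answer'' 0 = 0 \<and>
         (\<forall>p\<in>{1..n}. rmem s1 ''l'' 0 \<le> rmem s1 ''x'' p \<and> rmem s1 ''x'' p \<le> rmem s1 ''u'' 0) \<or>
       imem s2 ''answer'' 0 = 1 \<and> bound_violated n s2)"
    have s2n: "imem s2 ''n'' 0 = n" "imem s2 ''t'' 0 = length Fs" using s2 s1 by simp_all
    have s2r: "rmem s2 v = rmem s v" if "v \<notin> {''alpha0'', ''sgn''}" for v using s2 s1 that by simp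
    show "halts_in (Cond (ILess (ivar ''answer'') (INum 1)) (sort_prog ;; facet_prog) report_prog) s2
      (bcost (ILess (ivar ''answer'') (INum 1)) + (sort_time n + facet_time n (length Fs) + report_const * n)) ?Q"
    proof (rule halts_in_Cond)
      assume "bval s2 (ILess (ivar ''answer'') (INum 1))"
      then have ans: "imem s2 ''answer'' 0 = 0" by simp
      have box: "x \<in> box_X n l u"
        unfolding box_X_def using s2 ans x in0 s1 by auto
      have "halts_in (sort_prog ;; facet_prog) s2 (sort_time n + facet_time n (length Fs)) ?Q"
      proof (rule halts_in_Seq, rule halts_in_mono[OF sort_prog[OF s2n(1)] order_refl])
        fix s3 :: ram_state
        assume s3: "rmem s3 = rmem s2 \<and>
          (\<forall>v. v \<notin> {''a'', ''b'', ''w'', ''lo'', ''mid'', ''hi'', ''i'', ''j'', ''k''} \<longrightarrow>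
            imem s3 v = imem s2 v) \<and>
          imem s3 ''a'' ` {0..<n} = {1..n} \<and> descending (rmem s2 ''x'') (imem s3 ''a'') 0 n"
        define A where "A = imem s3 ''a''"
        have A: "A ` {0..<n} = {1..n}" using s3 by (simp add: A_def)
        have Ain: "A p \<in> {1..n}" if "p < n" for p using A that by auto
        have xA: "rmem s ''x'' (A p) = coord x (A p)" if "p < n" for p using in0(5)[OF Ain[OF that]] .
        have desc: "descending (coord x) A 0 n"
          using s3 s2r xA by (simp add: descending_def A_def)
        have inj: "inj_on A {..<n}" by (rule index_permutation[OF A])
        have r3: "rmem s3 v = rmem s v" if "v \<notin> {''alpha0'', ''sgn''}" for v using s3 s2r[OF that] by simp
        have val: "row_value n s3 k = b0 + b' * y + (\<Sum>p<n. coord b (Suc p) * coord x (A p))"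
          if k: "k < length Fs" "Fs ! k = (b0, b, b')" for k b0 b b'
          using row[OF k] in0(6) xA by (simp add: row_value_def r3 A_def[symmetric])
        have "halts_in facet_prog s3 (facet_time n (length Fs))
          (\<lambda>s'. imem s' ''answer'' 0 = 0 \<and> (\<forall>k<length Fs. 0 \<le> row_value n s3 k) \<or>
            imem s' ''answer'' 0 = 1 \<and> (valid_ineq n (rmem s' ''alpha0'' 0) (rmem s' ''alpha'') (rmem s' ''alphay'' 0) ?P \<and>
              ineq_lhs n (rmem s' ''alpha0'' 0) (rmem s' ''alpha'') (rmem s' ''alphay'' 0) (x, y) < 0))"
        proof (rule facet_prog)
          show "imem s3 ''n'' 0 = n" "imem s3 ''t'' 0 = length Fs" "imem s3 ''answer'' 0 = 0"
            using s3 s2n ans by simp_all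
          show "1 \<le> n" using n by simp
          show "inj_on (imem s3 ''a'') {..<n}" using inj by (simp add: A_def)
          fix k and \<alpha> :: "nat \<Rightarrow> real" assume k: "k < length Fs" and neg: "row_value n s3 k < 0"
            and \<alpha>: "\<And>p. p < n \<Longrightarrow> \<alpha> (imem s3 ''a'' p) = rmem s3 ''beta'' (k * n + p + 1)"
          obtain b0 b b' where F: "Fs ! k = (b0, b, b')" by (cases "Fs ! k")
          then have facet: "(b0, b, b') \<in> core_facets n l u c" using k Fs nth_mem by metis
          have "rmem s3 ''beta0'' k = b0" "rmem s3 ''betay'' k = b'" using row[OF k F] r3 by simp_all
          moreover have "\<alpha> (A p) = coord b (Suc p)" if "p < n" for p
            using \<alpha>[OF that] row(3)[OF k F that] r3 by (simp add: A_def)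
          moreover have "b0 + b' * y + (\<Sum>p<n. coord b (Suc p) * coord x (A p)) < 0"
            using neg val[OF k F] by simp
          ultimately show "valid_ineq n (rmem s3 ''beta0'' k) \<alpha> (rmem s3 ''betay'' k) ?P \<and>
              ineq_lhs n (rmem s3 ''beta0'' k) \<alpha> (rmem s3 ''betay'' k) (x, y) < 0"
            using permuted_facet_separates[OF lu facet A] by blast
        qed
        then show "halts_in facet_prog s3 (facet_time n (length Fs)) ?Q"
        proof (rule halts_in_mono[OF _ order_refl])
          fix s' :: ram_state
          assume s': "imem s' ''answer'' 0 = 0 \<and> (\<forall>k<length Fs. 0 \<le> row_value n s3 k) \<or>
            imem s' ''answer'' 0 = 1 \<and> (valid_ineq n (rmem s' ''alpha0'' 0) (rmem s' ''alpha'') (rmem s' ''alphay'' 0) ?P \<and>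
              ineq_lhs n (rmem s' ''alpha0'' 0) (rmem s' ''alpha'') (rmem s' ''alphay'' 0) (x, y) < 0)"
          have "(x, y) \<in> ?P" if all: "\<forall>k<length Fs. 0 \<le> row_value n s3 k"
          proof (rule membership_if_core_facets_hold[OF lu c box A desc])
            fix b0 b b' assume "(b0, b, b') \<in> core_facets n l u c"
            then obtain k where "k < length Fs" "Fs ! k = (b0, b, b')" using Fs by (metis in_set_conv_nth)
            then show "0 \<le> b0 + b' * y + (\<Sum>p<n. coord b (Suc p) * coord x (A p))"
              using all val by metis
          qed
          then show "?Q s'" using s' by (auto simp: separation_output_def Let_def simp del: ineq_lhs.simps)
        qed
      qed
      then show "halts_in (sort_prog ;; facet_prog) s2
          (sort_time n + facet_time n (length Fs) + report_const * n) ?Q"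
        by (rule halts_in_mono) simp_all
    next
      assume "\<not> bval s2 (ILess (ivar ''answer'') (INum 1))"
      then have ans: "imem s2 ''answer'' 0 = 1" and viol: "bound_violated n s2" using s2 by auto
      let ?k = "imem s2 ''viol'' 0"
      have k: "?k \<in> {1..n}" using viol by (simp add: bound_violated_def)
      have n1: "1 \<le> n" using n by simp
      have v: "rmem s2 ''sgn'' 0 = 1 \<and> rmem s2 ''alpha0'' 0 = - l \<and> coord x ?k < l \<or>
          rmem s2 ''sgn'' 0 = - 1 \<and> rmem s2 ''alpha0'' 0 = u \<and> u < coord x ?k"
        using viol in0(5)[OF k] in0(3,4) by (simp add: bound_violated_def s2r)
      have "halts_in report_prog s2 (report_const * n) ?Q"
      proof (rule halts_in_mono[OF report_prog[OF s2n(1) n1] order_refl])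
        fix s' :: ram_state
        assume s': "imem s' ''answer'' = imem s2 ''answer'' \<and> rmem s' ''alpha0'' = rmem s2 ''alpha0'' \<and>
          rmem s' ''alphay'' 0 = 0 \<and>
          (\<forall>p\<in>{1..n}. rmem s' ''alpha'' p = (if p = imem s2 ''viol'' 0 then rmem s2 ''sgn'' 0 else 0))"
        have "valid_ineq n (rmem s' ''alpha0'' 0) (rmem s' ''alpha'') 0 ?P \<and>
            ineq_lhs n (rmem s' ''alpha0'' 0) (rmem s' ''alpha'') 0 (x, y) < 0"
          by (rule bound_separates[OF x k, where s="rmem s2 ''sgn'' 0"]) (use s' v in auto)
        then show "?Q s'"
          using s' ans by (simp add: separation_output_def Let_def del: ineq_lhs.simps)
      qed
      then show "halts_in report_prog s2 (sort_time n + facet_time n (length Fs) + report_const * n) ?Q"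
        by (rule halts_in_mono) simp_all
    qed
  qed
qed

text \<open>
  For \<open>n \<ge> 2\<close> the term \<open>n log n\<close> dominates \<open>n\<close> and every constant, and rounding up the logarithm at most
  doubles it.
\<close>

lemma separation_time_bound:
  "\<exists>C. \<forall>n t. 2 \<le> n \<longrightarrow> real (separation_time n t) \<le> C * (real n * real t + real n * log 2 (real n))"
proof -
  define a where "a = time_bound (iset ''answer'' (INum 0) ;; iset ''j'' (INum 1)) + bcost box_guard +
    bcost (ILess (ivar ''answer'') (INum 1)) + (time_bound (iset ''i'' (INum 0)) + bcost i_guard +
    time_bound (iset ''w'' (INum 1)) + bcost sort_guard) +
    (time_bound (iset ''k'' (INum 0) ;; iset ''base'' (INum 0)) + bcost facet_guard)"
  define b where "b = bcost box_guard + time_bound box_step + (bcost i_guard + time_bound identity_step) + report_const"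
  \<comment> \<open>the running time is affine in \<open>n\<close>, \<open>n * rounds n 1\<close> and \<open>n * t\<close>\<close>
  have T: "separation_time n t = a + b * n + round_const * (n * rounds n 1) + facet_const * (n * t)" for n t
    unfolding separation_time_def sort_time_def facet_time_def a_def b_def distrib_right
    by (simp only: ac_simps)
  let ?C = "real (a + b + 2 * round_const + facet_const)"
  have "real (separation_time n t) \<le> ?C * (real n * real t + real n * log 2 (real n))" if n: "2 \<le> n" for n t
  proof -
    define L where "L = log 2 (real n)"
    define M where "M = real n * real t + real n * L"
    have L: "1 \<le> L" using n by (simp add: L_def le_log_iff)
    have nL: "real n \<le> real n * L" using L by (simp add: mult_le_cancel_left1)
    have "real (rounds n 1) \<le> L + 1"
      unfolding rounds_def using L by (simp add: L_def)
    then have "real n * real (rounds n 1) \<le> real n * (2 * L)"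
      using L by (intro mult_left_mono) auto
    moreover have "real n * (2 * L) \<le> 2 * M" by (simp add: M_def)
    ultimately have r: "real (n * rounds n 1) \<le> 2 * M" by simp
    have nt: "0 \<le> real n * real t" by simp
    have m: "real n \<le> M" using nL nt unfolding M_def by linarith
    then have one: "1 \<le> M" using n by simp
    have "0 \<le> real n * L" using L by simp
    then have t: "real (n * t) \<le> M" unfolding M_def of_nat_mult by linarith
    have "real (separation_time n t) = real a * 1 + real b * real n + real round_const * real (n * rounds n 1)
        + real facet_const * real (n * t)" by (simp only: T of_nat_add of_nat_mult mult_1_right)
    also have "\<dots> \<le> real a * M + real b * M + real round_const * (2 * M) + real facet_const * M"
      using one m r t by (intro add_mono mult_left_mono) simp_all
    also have "\<dots> = ?C * M" by (simp add: algebra_simps)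
    finally show ?thesis by (simp add: M_def L_def)
  qed
  then show ?thesis by blast
qed

theorem proposition2p4:
  shows "\<exists>(prog :: com) (C :: real).
    \<forall>(n :: nat) (l :: real) (u :: real) (c :: nat \<Rightarrow> real) (Fs :: (real \<times> rvec \<times> real) list)
      (t :: nat) (xbar :: rvec) (ybar :: real) (s :: ram_state).
      2 \<le> n \<longrightarrow> l < u \<longrightarrow> (\<exists>i\<in>{2..n}. c i \<noteq> 0) \<longrightarrow>
      distinct Fs \<longrightarrow> set Fs = core_facets n l u c \<longrightarrow> length Fs = t \<longrightarrow>
      xbar \<in> Rn n \<longrightarrow> separation_input n l u Fs xbar ybar s \<longrightarrow>
      (\<exists>steps s'. exec prog s steps s' \<and>
         real steps \<le> C * (real n * real t + real n * log 2 (real n)) \<and>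
         separation_output n (conv_G n l u c) xbar ybar s')"
proof -
  obtain C where C: "\<And>n t. 2 \<le> n \<Longrightarrow>
      real (separation_time n t) \<le> C * (real n * real t + real n * log 2 (real n))"
    using separation_time_bound by blast
  show ?thesis
  proof (intro exI[of _ separation_prog] exI[of _ C] allI impI)
    fix n t :: nat and l u :: real and c :: "nat \<Rightarrow> real" and Fs :: "(real \<times> rvec \<times> real) list"
      and xbar :: rvec and ybar :: real and s :: ram_state
    assume n: "2 \<le> n" and "l < u" "\<exists>i\<in>{2..n}. c i \<noteq> 0" "distinct Fs" "set Fs = core_facets n l u c"
      and t: "length Fs = t" and "xbar \<in> Rn n" "separation_input n l u Fs xbar ybar s"
    then have "halts_in separation_prog s (separation_time n t)
        (separation_output n (conv_G n l u c) xbar ybar)"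
      using separation_prog_correct by blast
    then obtain steps s' where "exec separation_prog s steps s'" "steps \<le> separation_time n t"
      "separation_output n (conv_G n l u c) xbar ybar s'"
      unfolding halts_in_def by blast
    moreover from this(2) have "real steps \<le> real (separation_time n t)" by simp
    ultimately show "\<exists>steps s'. exec separation_prog s steps s' \<and>
        real steps \<le> C * (real n * real t + real n * log 2 (real n)) \<and>
        separation_output n (conv_G n l u c) xbar ybar s'"
      using C[OF n, of t] order_trans by blast
  qed
qed

end
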